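(* Let $\tau\in[0,1)$ be fixed, let $N$ be a positive integer, and let $R_N^{\mathbb{H}}$ be the one-point function of the $N\times N$ symplectic elliptic Ginibre ensemble (eGinSE) with parameter $\tau$. Let $z\in\mathbb{C}\setminus E$, where $E=\{x+iy:(\frac{x}{1+\tau})^2+(\frac{y}{1-\tau})^2\le1\}$. Then as $N\to\infty$, $$R_N^{\mathbb{H}}(z)=\frac{\operatorname{Im}z}{1-\tau}\sqrt{\frac{N}{\pi^3(1-\tau^2)}}\;\frac{|\psi'(z)|}{|\psi(z)^2-1|^2}\;\frac{\operatorname{Im}[\psi(z)^2]}{\operatorname{Re}[\psi(z)-\psi(z)^{-1}]}\;e^{-2N\Omega(z)}\Big(1+O\Big(\frac1N\Big)\Big),$$ where $\psi(z)=\frac{z+\sqrt{z^2-4\tau}}{2}$ and $$\Omega(z)=\frac{1}{1-\tau^2}\big(|z|^2-\tau\operatorname{Re}z^2\big)-\operatorname{Re}\Big[\frac{2z}{z+\sqrt{z^2-4\tau}}\Big]-2\log\Big|\frac{z+\sqrt{z^2-4\tau}}{2}\Big|.$$ The error term is uniform for $z$ within a set bounded away from $E$.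
   Context: The eGinSE: let $\mathcal{G}$ be an $N\times N$ matrix with i.i.d. centred Gaussian quaternion entries whose four real components are independent of variance $1/(4N)$, represented as a $2N\times2N$ complex matrix via $2\times2$ blocks $\begin{pmatrix}a&b\\-\bar b&\bar a\end{pmatrix}$, and $\mathcal{X}_\tau=\frac{\sqrt{1+\tau}}{2}(\mathcal{G}+\mathcal{G}^\dagger)+\frac{\sqrt{1-\tau}}{2}(\mathcal{G}-\mathcal{G}^\dagger)$. Its $2N$ eigenvalues come in complex conjugate pairs, and $z_1,\dots,z_N$ (one from each pair) have joint density on $\mathbb{C}^N$ proportional to $\prod_{j<k}|z_j-z_k|^2|z_j-\bar z_k|^2\prod_j|z_j-\bar z_j|^2e^{-2NV(z_j)}$ with $V(z)=\frac{1}{1-\tau^2}(|z|^2-\tau\operatorname{Re}z^2)$. The one-point function $R_N^{\mathbb{H}}$ is the continuous function with $\mathbb{E}\big[\sum_{j=1}^N f(z_j)\big]=\int_{\mathbb{C}}f(z)R_N^{\mathbb{H}}(z)\,d^2z$ for suitable test functions $f$, where $d^2z$ is Lebesgue measure on $\mathbb{C}$. The square root $\sqrt{z^2-4\tau}$ is the branch analytic on $\mathbb{C}\setminus[-2\sqrt\tau,2\sqrt\tau]$ with $\sqrt{z^2-4\tau}\sim z$ as $z\to\infty$. "Bounded away from $E$" means at positive distance from $E$. When $\operatorname{Re}z=0$ the quotient $\operatorname{Im}[\psi^2]/\operatorname{Re}[\psi-\psi^{-1}]$ is of the form $0/0$ and is understood by continuous extension. *)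

theory Defs
  imports
    "HOL-Complex_Analysis.Complex_Analysis"
    "HOL-Probability.Probability"
    "HOL-Library.Landau_Symbols"
    "Jordan_Normal_Form.Schur_Decomposition"
begin

section \<open>The symplectic elliptic Ginibre ensemble\<close>

text \<open>
  An $N\times N$ quaternion matrix is given by its real components: $g\,i\,j\,k$ with
  $i,j<N$, $k<4$, the entry $(i,j)$ being the block with $a = g_0 + i g_1$ and $b = g_2 + i g_3$.
  Indices start at 0, so the block of the entry $(i,j)$ occupies rows $2i,2i+1$ and
  columns $2j,2j+1$.
\<close>

definition quat_mat :: "nat \<Rightarrow> (nat \<Rightarrow> nat \<Rightarrow> nat \<Rightarrow> real) \<Rightarrow> complex mat" where
  "quat_mat N g = mat (2 * N) (2 * N) (\<lambda>(p, q).
     let i = p div 2; j = q div 2;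
         a = Complex (g i j 0) (g i j 1);
         b = Complex (g i j 2) (g i j 3)
     in if even p then (if even q then a else b)
        else (if even q then - cnj b else cnj a))"

definition eGinSE_mat :: "real \<Rightarrow> complex mat \<Rightarrow> complex mat" where
  "eGinSE_mat \<tau> G =
     complex_of_real (sqrt (1 + \<tau>) / 2) \<cdot>\<^sub>m (G + mat_adjoint G)
     + complex_of_real (sqrt (1 - \<tau>) / 2) \<cdot>\<^sub>m (G - mat_adjoint G)"

definition eGinSE_V :: "real \<Rightarrow> complex \<Rightarrow> real" where
  "eGinSE_V \<tau> z = 1 / (1 - \<tau>\<^sup>2) * ((cmod z)\<^sup>2 - \<tau> * Re (z\<^sup>2))"

definition eGinSE_weight :: "real \<Rightarrow> nat \<Rightarrow> (nat \<Rightarrow> complex) \<Rightarrow> real" where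
  "eGinSE_weight \<tau> N z =
     (\<Prod>k<N. \<Prod>j<k. (cmod (z j - z k))\<^sup>2 * (cmod (z j - cnj (z k)))\<^sup>2)
     * (\<Prod>j<N. (cmod (z j - cnj (z j)))\<^sup>2 * exp (- 2 * real N * eGinSE_V \<tau> (z j)))"

text \<open>
  \<open>g\<close> is the random Gaussian quaternion matrix and \<open>z\<close> the random vector formed by one
  eigenvalue from each conjugate pair of the matrix \<open>\<X>\<^sub>\<tau>\<close> built from \<open>g\<close>. Which member of each
  pair is taken, and in which order the pairs are listed, is not determined by the matrix; the
  last clause, the joint density on $\mathbb{C}^N$, fixes the law of the labelling (the density
  is symmetric under permutations and under conjugation of each coordinate). The constant \<open>c\<close> is
  forced to be the normalising one, because \<open>M\<close> is a probability space.
\<close>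

definition eGinSE ::
  "real \<Rightarrow> nat \<Rightarrow> 'w measure \<Rightarrow> ('w \<Rightarrow> nat \<Rightarrow> nat \<Rightarrow> nat \<Rightarrow> real) \<Rightarrow> ('w \<Rightarrow> nat \<Rightarrow> complex) \<Rightarrow> bool"
where
  "eGinSE \<tau> N M g z \<longleftrightarrow>
     prob_space M
   \<and> prob_space.indep_vars M (\<lambda>_. borel) (\<lambda>(i, j, k) \<omega>. g \<omega> i j k) ({..<N} \<times> {..<N} \<times> {..<4})
   \<and> (\<forall>i<N. \<forall>j<N. \<forall>k<4.
        distributed M lborel (\<lambda>\<omega>. g \<omega> i j k)
          (\<lambda>x. ennreal (normal_density 0 (sqrt (1 / (4 * real N))) x)))
   \<and> (AE \<omega> in M. char_poly (eGinSE_mat \<tau> (quat_mat N (g \<omega>)))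
                   = (\<Prod>j<N. [:- z \<omega> j, 1:] * [:- cnj (z \<omega> j), 1:]))
   \<and> (\<exists>c>0. distributed M (Pi\<^sub>M {..<N} (\<lambda>_. lborel)) (\<lambda>\<omega>. \<lambda>j\<in>{..<N}. z \<omega> j)
          (\<lambda>x. ennreal (c * eGinSE_weight \<tau> N x)))"

text \<open>
  The test functions are the continuous functions with compact support; together with
  continuity of \<open>R\<close> they determine \<open>R\<close> uniquely.
\<close>

definition one_point_function ::
  "nat \<Rightarrow> 'w measure \<Rightarrow> ('w \<Rightarrow> nat \<Rightarrow> complex) \<Rightarrow> (complex \<Rightarrow> real) \<Rightarrow> bool"
where
  "one_point_function N M z R \<longleftrightarrow>
     continuous_on UNIV R
   \<and> (\<forall>f :: complex \<Rightarrow> real.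
        continuous_on UNIV f \<and> (\<exists>K. compact K \<and> (\<forall>w. w \<notin> K \<longrightarrow> f w = 0)) \<longrightarrow>
        prob_space.expectation M (\<lambda>\<omega>. \<Sum>j<N. f (z \<omega> j)) = (LINT w|lborel. f w * R w))"


section \<open>The objects in the asymptotic formula\<close>

definition ellipseE :: "real \<Rightarrow> complex set" where
  "ellipseE \<tau> = {z. (Re z / (1 + \<tau>))\<^sup>2 + (Im z / (1 - \<tau>))\<^sup>2 \<le> 1}"

definition bounded_away :: "complex set \<Rightarrow> complex set \<Rightarrow> bool" where
  "bounded_away E S \<longleftrightarrow> (\<exists>\<delta>>0. \<forall>z\<in>S. \<forall>w\<in>E. \<delta> \<le> dist z w)"

text \<open>
  The branch of $\sqrt{z^2-4\tau}$ that is analytic off $[-2\sqrt\tau,2\sqrt\tau]$ and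
  asymptotic to $z$ at infinity; for $z \neq 0$ the argument of the principal root below lies on
  $(-\infty,0]$ exactly when $z$ lies on that segment.
\<close>

definition sqrt_branch :: "real \<Rightarrow> complex \<Rightarrow> complex" where
  "sqrt_branch \<tau> z = z * csqrt (1 - 4 * complex_of_real \<tau> / z\<^sup>2)"

definition psi :: "real \<Rightarrow> complex \<Rightarrow> complex" where
  "psi \<tau> z = (z + sqrt_branch \<tau> z) / 2"

definition Omega :: "real \<Rightarrow> complex \<Rightarrow> real" where
  "Omega \<tau> z =
     1 / (1 - \<tau>\<^sup>2) * ((cmod z)\<^sup>2 - \<tau> * Re (z\<^sup>2))
     - Re (2 * z / (z + sqrt_branch \<tau> z))
     - 2 * ln (cmod ((z + sqrt_branch \<tau> z) / 2))"

text \<open>On the imaginary axis the quotient is $0/0$ and is replaced by its limit from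
  off the axis.\<close>

definition psi_quotient :: "real \<Rightarrow> complex \<Rightarrow> real" where
  "psi_quotient \<tau> z =
     (let q = (\<lambda>w. Im ((psi \<tau> w)\<^sup>2) / Re (psi \<tau> w - inverse (psi \<tau> w)))
      in if Re z = 0 then Lim (at z within {w. Re w \<noteq> 0}) q else q z)"

definition R_leading :: "real \<Rightarrow> nat \<Rightarrow> complex \<Rightarrow> real" where
  "R_leading \<tau> N z =
     Im z / (1 - \<tau>) * sqrt (real N / (pi ^ 3 * (1 - \<tau>\<^sup>2)))
     * (cmod (deriv (psi \<tau>) z) / (cmod ((psi \<tau> z)\<^sup>2 - 1))\<^sup>2)
     * psi_quotient \<tau> z
     * exp (- 2 * real N * Omega \<tau> z)"


section \<open>The chosen root is the stated branch\<close>

lemma sqrt_branch_square: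
  assumes "\<tau> = 0 \<or> z \<noteq> 0"
  shows "(sqrt_branch \<tau> z)\<^sup>2 = z\<^sup>2 - 4 * complex_of_real \<tau>"
  using assms by (auto simp: sqrt_branch_def power_mult_distrib field_simps)

lemma sqrt_branch_holomorphic:
  assumes "0 \<le> \<tau>"
  shows "sqrt_branch \<tau> holomorphic_on
           - closed_segment (- complex_of_real (2 * sqrt \<tau>)) (complex_of_real (2 * sqrt \<tau>))"
    (is "_ holomorphic_on - ?S")
proof -
  have mem: "complex_of_real x \<in> ?S" if "x\<^sup>2 \<le> 4 * \<tau>" for x
  proof -
    have "\<bar>x\<bar> \<le> 2 * sqrt \<tau>"
      using real_le_rsqrt[of "\<bar>x\<bar>" "4 * \<tau>"] that by (simp add: real_sqrt_mult)
    hence "x \<in> closed_segment (- (2 * sqrt \<tau>)) (2 * sqrt \<tau>)"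
      using assms by (auto simp: closed_segment_eq_real_ivl abs_le_iff)
    hence "complex_of_real x \<in> complex_of_real ` closed_segment (- (2 * sqrt \<tau>)) (2 * sqrt \<tau>)"
      by (rule imageI)
    thus ?thesis
      unfolding closed_segment_of_real[symmetric] by simp
  qed
  have nz: "z \<noteq> 0" if "z \<notin> ?S" for z
    using mem[of 0] assms that by auto
  have cut: "1 - 4 * complex_of_real \<tau> / z\<^sup>2 \<notin> \<real>\<^sub>\<le>\<^sub>0" if z: "z \<notin> ?S" for z
  proof
    assume "1 - 4 * complex_of_real \<tau> / z\<^sup>2 \<in> \<real>\<^sub>\<le>\<^sub>0"
    then obtain r where r: "r \<le> 0" "1 - 4 * complex_of_real \<tau> / z\<^sup>2 = complex_of_real r"
      by (auto elim!: nonpos_Reals_cases)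
    from r(2) nz[OF z] have "z\<^sup>2 * complex_of_real (1 - r) = complex_of_real (4 * \<tau>)"
      by (simp add: field_simps)
    hence z2: "z\<^sup>2 = complex_of_real (4 * \<tau> / (1 - r))"
      using r(1) nonzero_eq_divide_eq[of "complex_of_real (1 - r)" "z\<^sup>2" "complex_of_real (4 * \<tau>)"]
      by (metis diff_eq_eq add.left_neutral not_one_le_zero of_real_divide of_real_eq_0_iff)
    define x where "x = sqrt (4 * \<tau> / (1 - r))"
    have x2: "x\<^sup>2 = 4 * \<tau> / (1 - r)"
      unfolding x_def using assms r(1) by simp
    have "z\<^sup>2 = (complex_of_real x)\<^sup>2"
      unfolding z2 x2[symmetric] by simp
    hence "z = complex_of_real x \<or> z = complex_of_real (- x)"
      by (simp add: power2_eq_iff)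
    moreover have "x\<^sup>2 \<le> 4 * \<tau>"
      unfolding x2 using assms r(1) by (simp add: field_simps mult_nonneg_nonpos)
    ultimately show False
      using mem[of x] mem[of "- x"] z by auto
  qed
  show ?thesis
    unfolding sqrt_branch_def using nz cut by (intro holomorphic_intros) auto
qed

lemma sqrt_branch_asymp: "((\<lambda>z. sqrt_branch \<tau> z / z) \<longlongrightarrow> 1) at_infinity"
proof -
  have "((\<lambda>z::complex. 4 * complex_of_real \<tau> / z\<^sup>2) \<longlongrightarrow> 0) at_infinity"
    by (intro tendsto_divide_0[OF tendsto_const] filterlim_power_at_infinity filterlim_ident) simp
  hence "((\<lambda>z::complex. 1 - 4 * complex_of_real \<tau> / z\<^sup>2) \<longlongrightarrow> 1 - 0) at_infinity"
    by (intro tendsto_diff tendsto_const)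
  hence "((\<lambda>z::complex. csqrt (1 - 4 * complex_of_real \<tau> / z\<^sup>2)) \<longlongrightarrow> csqrt 1) at_infinity"
    by (intro isCont_tendsto_compose[OF continuous_at_csqrt]) auto
  moreover have "\<forall>\<^sub>F z::complex in at_infinity.
      csqrt (1 - 4 * complex_of_real \<tau> / z\<^sup>2) = sqrt_branch \<tau> z / z"
    using eventually_not_equal_at_infinity[of 0]
    by eventually_elim (simp add: sqrt_branch_def)
  ultimately show ?thesis
    by (simp add: tendsto_cong)
qed

end

theory Submission
  imports Defs
begin

text \<open>
  The joint density makes the eigenvalues a Pfaffian point process, so the one-point function is
  a finite sum of Hermite polynomials; outside the ellipse this sum is geometric up to relative
  errors of order $1/N$, and the claimed formula is the value of the limiting geometric sum.
  Throughout, $n = 2N$.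

  \<^bold>\<open>Finite sum.\<close> The weight is $\prod_j (z_j-\bar z_j)e^{-nV(z_j)}$ times the Vandermonde
  determinant of $z_1,\bar z_1,\dots,z_N,\bar z_N$, in which the powers may be replaced by any
  monic polynomials. Choose them skew-orthogonal for
  $\langle p,q\rangle=\int(z-\bar z)e^{-nV(z)}p(z)q(\bar z)\,d^2z$. Then, after integrating the
  Leibniz expansion against a test function of one variable, only the permutations survive that
  map pairs of neighbouring indices to such pairs (\<open>sum_skew_permutations\<close>), and the one-point
  function can be read off (\<open>one_point_function_eq\<close>). The polynomials are explicit: integration
  by parts shows that the rescaled Hermite polynomials $C_k$ are orthogonal on the plane, so
  $\langle C_j,C_k\rangle$ vanishes unless $|j-k|=1$ and two-term recursions give the even
  members of the skew-orthogonal family.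

  \<^bold>\<open>Uniform asymptotics of the polynomials.\<close> Write $z=\psi+\tau/\psi$ and $\beta=\tau/\psi^2$.
  The generating function of the $C_k$ shows that $C_k(z)$ is $\psi^k$ times a polynomial in
  $\beta$ alone (\<open>poly_herm_joukowski\<close>), which by Cauchy's formula is an integral of
  $e^{n\varphi}$ over the unit circle, with a saddle at $1$. The real part of the exponent is at
  most $-(1-|\beta|)(1-\cos t)$ on the whole circle (\<open>Re_phase_le\<close>), and $|\beta|\le\tau<1$ outside
  the ellipse. So Laplace's method has an error that is uniform in $\beta$, without any steepest
  descent path and without a condition on $z$ (\<open>laplace_asymptotics\<close>). The same circle, with
  another radius, bounds the terms of low degree. Together, the normalised coefficient
  with index $a$ counted from the top is $1+O((1+a)^8/N)$ for every $a<N$ (\<open>profile_bounds\<close>).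

  \<^bold>\<open>Summation.\<close> What remains is a double sum of terms
  $\operatorname{Im}(\psi u^a\bar u^b)$, $a\le b$, with $u=\psi^{-2}$ and factors close to $1$. The result vanishes
  on the real axis, so the error must be relative to $|\operatorname{Im}\psi|$: the factors are holomorphic in
  $\beta$ and real for real $\beta$, hence by Cauchy's estimate their imaginary parts are
  $O(|\operatorname{Im}\beta|/N)$ (\<open>profile_bounds_Im\<close>, \<open>dominant_sum_error\<close>). Stirling's formula with error $O(1/N)$,
  needed for the prefactor, is the case $\beta=0$ of Laplace's method.
  Finally, points at distance $\delta$ from the ellipse satisfy $|\psi|\ge1+\delta/2$
  (\<open>psi_bounded_away\<close>), which makes the geometric series, and with them all constants, uniform.
\<close>

section \<open>Gaussian integrals on the line and on the plane\<close>

lemma gaussian_eq_normal_density: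
  fixes a :: real
  assumes "a > 0"
  defines "s \<equiv> 1 / sqrt (2 * a)"
  shows "s > 0" "2 / s\<^sup>2 = 4 * a" "exp (- a * x\<^sup>2) = sqrt (pi / a) * normal_density 0 s x"
proof -
  show s: "s > 0" using assms by simp
  have s2: "2 * s\<^sup>2 = 1 / a" using assms by (auto simp: s_def power_divide)
  show "2 / s\<^sup>2 = 4 * a" using s s2 assms by (simp add: field_simps)
  have "2 * pi * s\<^sup>2 = pi / a"
    using s2 by (metis mult.commute mult.left_commute times_divide_eq_right mult_1_right)
  thus "exp (- a * x\<^sup>2) = sqrt (pi / a) * normal_density 0 s x"
    using assms(1) unfolding normal_density_def s2 by simp
qed

lemma integrable_monomial_gaussian:
  fixes a :: real
  assumes "a > 0"
  shows "integrable lborel (\<lambda>x. exp (- a * x\<^sup>2) * x ^ k)"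
    and "integrable lborel (\<lambda>x. exp (- a * x\<^sup>2) * \<bar>x\<bar> ^ k)"
proof -
  define s where "s = 1 / sqrt (2 * a)"
  note eq = gaussian_eq_normal_density(3)[OF assms, folded s_def]
    and s = gaussian_eq_normal_density(1)[OF assms, folded s_def]
  have "integrable lborel (\<lambda>x. sqrt (pi / a) * (normal_density 0 s x * (x - 0) ^ k))"
    by (intro integrable_mult_right integrable_normal_moment s)
  thus "integrable lborel (\<lambda>x. exp (- a * x\<^sup>2) * x ^ k)" unfolding eq by (simp add: mult_ac)
  have "integrable lborel (\<lambda>x. sqrt (pi / a) * (normal_density 0 s x * \<bar>x - 0\<bar> ^ k))"
    by (intro integrable_mult_right integrable_normal_moment_abs s)
  thus "integrable lborel (\<lambda>x. exp (- a * x\<^sup>2) * \<bar>x\<bar> ^ k)" unfolding eq by (simp add: mult_ac)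
qed

lemma integral_monomial_gaussian:
  fixes a :: real
  assumes "a > 0"
  shows "(\<integral>x. exp (- a * x\<^sup>2) * x ^ (2 * k) \<partial>lborel)
           = sqrt (pi / a) * fact (2 * k) / ((4 * a) ^ k * fact k)"
    and "(\<integral>x. exp (- a * x\<^sup>2) * x ^ (2 * k + 1) \<partial>lborel) = 0"
proof -
  define s where "s = 1 / sqrt (2 * a)"
  note s = gaussian_eq_normal_density(1,2)[OF assms, folded s_def]
    and eq = gaussian_eq_normal_density(3)[OF assms, folded s_def]
  show "(\<integral>x. exp (- a * x\<^sup>2) * x ^ (2 * k) \<partial>lborel)
           = sqrt (pi / a) * fact (2 * k) / ((4 * a) ^ k * fact k)"
    using integral_normal_moment_even[OF s(1), of 0 k] unfolding eq mult.assoc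
    by (simp add: s(2))
  show "(\<integral>x. exp (- a * x\<^sup>2) * x ^ (2 * k + 1) \<partial>lborel) = 0"
    using integral_normal_moment_odd[OF s(1), of 0 k] unfolding eq mult.assoc by simp
qed

text \<open>
  The integrand is the derivative of a function that vanishes at infinity. With the even and
  odd Gaussian moments at hand, no limit is needed: on monomials the identity is the
  recursion between consecutive moments.
\<close>

lemma integral_gaussian_by_parts:
  fixes a :: real and r :: "complex poly"
  assumes a: "a > 0"
  shows "(\<integral>x. of_real (exp (- a * x\<^sup>2)) *
            (poly (pderiv r) (of_real x) - of_real (2 * a * x) * poly r (of_real x)) \<partial>lborel) = 0"
proof -
  let ?m = "\<lambda>k. \<integral>x. exp (- a * x\<^sup>2) * x ^ k \<partial>lborel"
  have int: "integrable lborel (\<lambda>x. exp (- a * x\<^sup>2) * x ^ k)" for k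
    by (rule integrable_monomial_gaussian[OF a])
  \<comment> \<open>For k = 0 the truncated k - 1 is harmless, since the factor k vanishes.\<close>
  have rec: "real k * ?m (k - 1) = 2 * a * ?m (k + 1)" for k
  proof (cases "even k")
    case True
    then obtain j where k: "k = 2 * j" by (elim evenE)
    have "real k * ?m (k - 1) = 0"
    proof (cases j)
      case (Suc i)
      hence "k - 1 = 2 * i + 1" by (simp add: k)
      thus ?thesis by (simp only: integral_monomial_gaussian(2)[OF a])
    qed (simp add: k)
    thus ?thesis unfolding k integral_monomial_gaussian(2)[OF a] by simp
  next
    case False
    then obtain j where k: "k = 2 * j + 1" by (elim oddE)
    have e: "k + 1 = 2 * Suc j" "k - 1 = 2 * j" by (simp_all add: k)
    have "?m (2 * Suc j) = (2 * real j + 1) / (2 * a) * ?m (2 * j)"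
      unfolding integral_monomial_gaussian(1)[OF a] using a by (simp add: divide_simps) (simp add: algebra_simps)
    thus ?thesis unfolding e using a by (simp add: k field_simps)
  qed
  have I: "(\<integral>x. of_real (exp (- a * x\<^sup>2)) *
      (of_nat k * complex_of_real x ^ (k - 1) - of_real (2 * a * x) * of_real x ^ k) \<partial>lborel) = 0"
    and J: "integrable lborel (\<lambda>x. of_real (exp (- a * x\<^sup>2)) *
      (of_nat k * complex_of_real x ^ (k - 1) - of_real (2 * a * x) * of_real x ^ k))" for k
  proof -
    have e: "(\<lambda>x. of_real (exp (- a * x\<^sup>2)) *
      (of_nat k * complex_of_real x ^ (k - 1) - of_real (2 * a * x) * of_real x ^ k)) =
      (\<lambda>x. complex_of_real (real k * (exp (- a * x\<^sup>2) * x ^ (k - 1)) - 2 * a * (exp (- a * x\<^sup>2) * x ^ (k + 1))))"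
      by (auto simp: algebra_simps fun_eq_iff)
    have i: "integrable lborel (\<lambda>x. real k * (exp (- a * x\<^sup>2) * x ^ (k - 1)) - 2 * a * (exp (- a * x\<^sup>2) * x ^ (k + 1)))"
      by (intro Bochner_Integration.integrable_diff integrable_mult_right int)
    show "integrable lborel (\<lambda>x. of_real (exp (- a * x\<^sup>2)) *
      (of_nat k * complex_of_real x ^ (k - 1) - of_real (2 * a * x) * of_real x ^ k))"
      unfolding e by (rule integrable_of_real[OF i])
    have "(\<integral>x. real k * (exp (- a * x\<^sup>2) * x ^ (k - 1)) - 2 * a * (exp (- a * x\<^sup>2) * x ^ (k + 1)) \<partial>lborel)
       = real k * ?m (k - 1) - 2 * a * ?m (k + 1)"
      by (subst Bochner_Integration.integral_diff) (intro integrable_mult_right int, intro integrable_mult_right int, simp)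
    hence "(\<integral>x. real k * (exp (- a * x\<^sup>2) * x ^ (k - 1)) - 2 * a * (exp (- a * x\<^sup>2) * x ^ (k + 1)) \<partial>lborel) = 0"
      using rec[of k] by simp
    thus "(\<integral>x. of_real (exp (- a * x\<^sup>2)) *
      (of_nat k * complex_of_real x ^ (k - 1) - of_real (2 * a * x) * of_real x ^ k) \<partial>lborel) = 0"
      unfolding e by (metis integral_complex_of_real of_real_0)
  qed
  have p: "poly (pderiv r) x = (\<Sum>k\<le>degree r. coeff r k * (of_nat k * x ^ (k - 1)))" for x
  proof -
    have "poly (pderiv r) x = deriv (poly r) x"
      by (metis DERIV_imp_deriv poly_DERIV)
    also have "poly r = (\<lambda>x. \<Sum>k\<le>degree r. coeff r k * x ^ k)"
      by (simp add: poly_altdef fun_eq_iff)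
    also have "deriv \<dots> x = (\<Sum>k\<le>degree r. coeff r k * (of_nat k * x ^ (k - 1)))"
      by (rule DERIV_imp_deriv) (auto intro!: derivative_eq_intros sum.cong simp: mult_ac)
    finally show ?thesis .
  qed
  have e: "(\<lambda>x. of_real (exp (- a * x\<^sup>2)) *
            (poly (pderiv r) (of_real x) - of_real (2 * a * x) * poly r (of_real x)))
      = (\<lambda>x. \<Sum>k\<le>degree r. coeff r k * (of_real (exp (- a * x\<^sup>2)) *
      (of_nat k * complex_of_real x ^ (k - 1) - of_real (2 * a * x) * of_real x ^ k)))"
    unfolding p unfolding poly_altdef by (simp add: sum_distrib_left sum_subtractf[symmetric] algebra_simps)
  show ?thesis unfolding e
    by (subst Bochner_Integration.integral_sum, intro integrable_mult_right J)
      (simp only: integral_mult_right_zero I mult_zero_right sum.neutral_const)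
qed

lemma measurable_Complex: "(\<lambda>(x, y). Complex x y) \<in> borel_measurable (lborel \<Otimes>\<^sub>M lborel)"
  unfolding borel_measurable_complex_iff by (auto simp: case_prod_unfold)

lemma lborel_complex: "(lborel :: complex measure) = distr (lborel \<Otimes>\<^sub>M lborel) borel (\<lambda>(x, y). Complex x y)"
proof (rule lborel_eqI)
  fix l u :: complex assume lu: "\<And>b. b \<in> Basis \<Longrightarrow> l \<bullet> b \<le> u \<bullet> b"
  have le: "Re l \<le> Re u" "Im l \<le> Im u" using lu[of 1] lu[of \<i>] by (auto simp: Basis_complex_def)
  have v: "(\<lambda>(x, y). Complex x y) -` box l u \<inter> space (lborel \<Otimes>\<^sub>M lborel)
      = box (Re l) (Re u) \<times> box (Im l) (Im u)"
    by (auto simp: space_pair_measure in_box_complex_iff)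
  show "emeasure (distr (lborel \<Otimes>\<^sub>M lborel) borel (\<lambda>(x, y). Complex x y)) (box l u)
      = ennreal (\<Prod>b\<in>Basis. (u - l) \<bullet> b)"
    using le by (subst emeasure_distr[OF measurable_Complex]) (simp_all add: v lborel.emeasure_pair_measure_Times
        Basis_complex_def ennreal_mult inner_diff_left)
qed simp

lemma integrable_lborel_complex_iff:
  fixes f :: "complex \<Rightarrow> 'b :: {banach, second_countable_topology}"
  assumes "f \<in> borel_measurable borel"
  shows "integrable lborel f \<longleftrightarrow> integrable (lborel \<Otimes>\<^sub>M lborel) (\<lambda>(x, y). f (Complex x y))"
proof -
  have "f \<in> borel_measurable (lborel :: complex measure)" using assms by simp
  thus ?thesis
    by (subst lborel_complex, subst integrable_distr_eq[OF measurable_Complex])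
       (use assms in \<open>auto simp: case_prod_unfold\<close>)
qed

lemma integral_lborel_complex:
  fixes f :: "complex \<Rightarrow> 'b :: {banach, second_countable_topology}"
  assumes "integrable lborel f"
  shows "(\<integral>z. f z \<partial>lborel) = (\<integral>y. \<integral>x. f (Complex x y) \<partial>lborel \<partial>lborel)"
    and "(\<integral>z. f z \<partial>lborel) = (\<integral>x. \<integral>y. f (Complex x y) \<partial>lborel \<partial>lborel)"
proof -
  have m: "f \<in> borel_measurable borel" using borel_measurable_integrable[OF assms] by simp
  have i: "integrable (lborel \<Otimes>\<^sub>M lborel) (\<lambda>(x, y). f (Complex x y))"
    using assms integrable_lborel_complex_iff[OF m] by simp
  have "(\<integral>z. f z \<partial>lborel) = (\<integral>z. (case z of (x, y) \<Rightarrow> f (Complex x y)) \<partial>(lborel \<Otimes>\<^sub>M lborel))"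
    by (subst lborel_complex, subst integral_distr[OF measurable_Complex m]) (simp add: case_prod_unfold)
  thus "(\<integral>z. f z \<partial>lborel) = (\<integral>y. \<integral>x. f (Complex x y) \<partial>lborel \<partial>lborel)"
    and "(\<integral>z. f z \<partial>lborel) = (\<integral>x. \<integral>y. f (Complex x y) \<partial>lborel \<partial>lborel)"
    using lborel_pair.integral_snd[OF i] lborel_pair.integral_fst[OF i] by simp_all
qed

lemma norm_poly_le:
  fixes p :: "complex poly"
  shows "norm (poly p z) \<le> (\<Sum>k\<le>degree p. norm (coeff p k)) * (1 + norm z) ^ degree p"
proof -
  have "norm (poly p z) \<le> (\<Sum>k\<le>degree p. norm (coeff p k) * norm z ^ k)"
    unfolding poly_altdef by (rule sum_norm_le) (simp add: norm_mult norm_power)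
  also have "\<dots> \<le> (\<Sum>k\<le>degree p. norm (coeff p k) * (1 + norm z) ^ degree p)"
    by (intro sum_mono mult_left_mono order_trans[OF power_mono[of "norm z" "1 + norm z"] power_increasing]) auto
  finally show ?thesis by (simp add: sum_distrib_right)
qed

lemma integrable_one_plus_abs_power_gaussian:
  fixes a :: real
  assumes "a > 0"
  shows "integrable lborel (\<lambda>x. exp (- a * x\<^sup>2) * (1 + \<bar>x\<bar>) ^ k)"
proof -
  have "integrable lborel (\<lambda>x. \<Sum>i\<le>k. of_nat (k choose i) * (exp (- a * x\<^sup>2) * \<bar>x\<bar> ^ i))"
    by (intro Bochner_Integration.integrable_sum integrable_mult_right integrable_monomial_gaussian assms)
  moreover have "(\<Sum>i\<le>k. of_nat (k choose i) * (exp (- a * x\<^sup>2) * \<bar>x\<bar> ^ i)) = exp (- a * x\<^sup>2) * (1 + \<bar>x\<bar>) ^ k" for x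
    unfolding binomial_ring[of "\<bar>x\<bar>" 1, simplified add.commute[of "\<bar>x\<bar>"]] by (simp add: sum_distrib_left mult_ac)
  ultimately show ?thesis by simp
qed

text \<open>
  Since $1+|x+iy|\le(1+|x|)(1+|y|)$, the integrand is dominated by a product of two
  functions of one variable.
\<close>

lemma integrable_planar_gaussian_power:
  fixes a b :: real
  assumes "a > 0" "b > 0"
  shows "integrable lborel (\<lambda>z. exp (- a * (Re z)\<^sup>2 - b * (Im z)\<^sup>2) * (1 + norm z) ^ k)"
proof -
  let ?f = "\<lambda>x. exp (- a * x\<^sup>2) * (1 + \<bar>x\<bar>) ^ k" and ?g = "\<lambda>x. exp (- b * x\<^sup>2) * (1 + \<bar>x\<bar>) ^ k"
  have i: "integrable lborel ?f" "integrable lborel ?g"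
    using assms by (intro integrable_one_plus_abs_power_gaussian; simp)+
  have "integrable (lborel \<Otimes>\<^sub>M lborel) (\<lambda>(x, y). ?f x * ?g y)"
  proof (rule lborel_pair.Fubini_integrable)
    show "integrable lborel (\<lambda>x. \<integral>y. norm (case (x, y) of (x, y) \<Rightarrow> ?f x * ?g y) \<partial>lborel)"
      using i by (simp add: abs_mult)
    show "AE x in lborel. integrable lborel (\<lambda>y. case (x, y) of (x, y) \<Rightarrow> ?f x * ?g y)"
      using i by simp
  qed measurable
  hence "integrable (lborel \<Otimes>\<^sub>M lborel) (\<lambda>(x, y). exp (- a * (Re (Complex x y))\<^sup>2 - b * (Im (Complex x y))\<^sup>2) * (1 + norm (Complex x y)) ^ k)"
  proof (rule Bochner_Integration.integrable_bound)
    show "(\<lambda>(x, y). exp (- a * (Re (Complex x y))\<^sup>2 - b * (Im (Complex x y))\<^sup>2) * (1 + norm (Complex x y)) ^ k)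
        \<in> borel_measurable (lborel \<Otimes>\<^sub>M lborel)"
      unfolding complex_norm case_prod_unfold complex.sel by measurable
    have "norm (exp (- a * x\<^sup>2 - b * y\<^sup>2) * (1 + norm (Complex x y)) ^ k) \<le> norm (?f x * ?g y)" for x y
    proof -
      have "norm (Complex x y) \<le> \<bar>x\<bar> + \<bar>y\<bar>" using cmod_le[of "Complex x y"] by simp
      hence "1 + norm (Complex x y) \<le> (1 + \<bar>x\<bar>) * (1 + \<bar>y\<bar>)" by (simp add: algebra_simps) (smt (verit) abs_ge_zero mult_nonneg_nonneg)
      hence "(1 + norm (Complex x y)) ^ k \<le> ((1 + \<bar>x\<bar>) * (1 + \<bar>y\<bar>)) ^ k" by (intro power_mono) auto
      hence "exp (- a * x\<^sup>2 - b * y\<^sup>2) * (1 + norm (Complex x y)) ^ k \<le>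
          exp (- a * x\<^sup>2 - b * y\<^sup>2) * ((1 + \<bar>x\<bar>) ^ k * (1 + \<bar>y\<bar>) ^ k)"
        by (simp add: power_mult_distrib)
      also have "\<dots> = ?f x * ?g y" by (simp add: exp_diff exp_minus field_simps)
      finally show ?thesis by (simp add: abs_mult)
    qed
    thus "AE z in lborel \<Otimes>\<^sub>M lborel. norm (case z of (x, y) \<Rightarrow> exp (- a * (Re (Complex x y))\<^sup>2 - b * (Im (Complex x y))\<^sup>2) * (1 + norm (Complex x y)) ^ k)
       \<le> norm (case z of (x, y) \<Rightarrow> ?f x * ?g y)"
      by (intro always_eventually) (simp add: case_prod_unfold)
  qed
  thus ?thesis by (subst integrable_lborel_complex_iff) auto
qed

section \<open>Planar Hermite polynomials\<close>

locale elliptic_weight =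
  fixes \<tau> n :: real
  assumes tau_nonneg: "0 \<le> \<tau>" and tau_less_1: "\<tau> < 1" and n_pos: "0 < n"
begin

text \<open>
  The factor of the joint density that belongs to a single eigenvalue, with $n$ in place of
  $2N$: up to the assembly at the end, only $n>0$ matters.
\<close>

definition weight :: "complex \<Rightarrow> real" where
  "weight z = exp (- n * eGinSE_V \<tau> z)"

lemma weight_eq: "weight z = exp (- (n / (1 + \<tau>)) * (Re z)\<^sup>2 - (n / (1 - \<tau>)) * (Im z)\<^sup>2)"
proof -
  have ne: "1 + \<tau> \<noteq> 0" "1 - \<tau> \<noteq> 0" using tau_nonneg tau_less_1 by auto
  have "(1 - \<tau>\<^sup>2) = (1 + \<tau>) * (1 - \<tau>)" by (simp add: power2_eq_square algebra_simps)
  hence "eGinSE_V \<tau> z = (Re z)\<^sup>2 / (1 + \<tau>) + (Im z)\<^sup>2 / (1 - \<tau>)"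
    unfolding eGinSE_V_def using ne by (simp add: cmod_power2 divide_simps) (simp add: power2_eq_square algebra_simps)
  thus ?thesis unfolding weight_def by (simp add: algebra_simps)
qed

lemma weight_pos: "weight z > 0" by (simp add: weight_def)

lemma continuous_on_weight [continuous_intros]: "continuous_on A weight"
  unfolding weight_eq by (intro continuous_intros)

lemma measurable_weight [measurable]: "weight \<in> borel_measurable borel"
  by (rule borel_measurable_continuous_onI) (rule continuous_on_weight)

lemma integrable_weight_power: "integrable lborel (\<lambda>z. weight z * (1 + norm z) ^ k)"
  unfolding weight_eq
  using tau_nonneg tau_less_1 n_pos by (intro integrable_planar_gaussian_power) auto

lemma integrable_weight_polys:
  fixes g :: "complex \<Rightarrow> complex"
  assumes [measurable]: "g \<in> borel_measurable borel" and g: "\<And>z. norm (g z) \<le> C * (1 + norm z)"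
  shows "integrable lborel (\<lambda>z. g z * of_real (weight z) * (poly p z * poly q (cnj z)))"
proof -
  define A where "A = (\<Sum>k\<le>degree p. norm (coeff p k)) * (\<Sum>k\<le>degree q. norm (coeff q k))"
  have "0 \<le> norm (g 0)" by simp
  also have "\<dots> \<le> C" using g[of 0] by simp
  finally have C: "C \<ge> 0" .
  have bd: "norm (poly p z * poly q (cnj z)) \<le> A * (1 + norm z) ^ (degree p + degree q)" for z
    using mult_mono[OF norm_poly_le[of p z] norm_poly_le[of q "cnj z"]]
    by (simp add: norm_mult A_def power_add mult_ac sum_nonneg)
  have cont: "continuous_on UNIV (\<lambda>z. poly p z * poly q (cnj z))"
    by (intro continuous_intros)
  have [measurable]: "(\<lambda>z. poly p z * poly q (cnj z)) \<in> borel_measurable borel"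
    by (rule borel_measurable_continuous_onI[OF cont])
  show ?thesis
  proof (rule Bochner_Integration.integrable_bound)
    show "integrable lborel (\<lambda>z. (C * A) * (weight z * (1 + norm z) ^ (1 + degree p + degree q)))"
      by (intro integrable_mult_right integrable_weight_power)
    have "norm (g z * of_real (weight z) * (poly p z * poly q (cnj z)))
       \<le> C * (1 + norm z) * weight z * (A * (1 + norm z) ^ (degree p + degree q))" for z
      unfolding norm_mult[of "g z * _"] norm_mult[of "g z"]
      by (intro mult_mono g bd) (use C weight_pos[of z] in \<open>auto intro!: mult_nonneg_nonneg\<close>)
    moreover have "C * (1 + norm z) * weight z * (A * (1 + norm z) ^ (degree p + degree q))
       = (C * A) * (weight z * (1 + norm z) ^ (1 + degree p + degree q))" for z
      by (simp add: mult_ac)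
    ultimately have "norm (g z * of_real (weight z) * (poly p z * poly q (cnj z)))
       \<le> norm ((C * A) * (weight z * (1 + norm z) ^ (1 + degree p + degree q)))" for z
      unfolding real_norm_def by (metis order_trans abs_ge_self)
    thus "AE z in lborel. norm (g z * of_real (weight z) * (poly p z * poly q (cnj z)))
       \<le> norm ((C * A) * (weight z * (1 + norm z) ^ (1 + degree p + degree q)))" by simp
  qed measurable
qed

text \<open>
  The form $\int p(z)q(\bar z)e^{-nV(z)}d^2z$. It has no conjugate on the coefficients of
  $q$, so it is bilinear; on polynomials with real coefficients it agrees with the $L^2$
  inner product.
\<close>

definition planar :: "complex poly \<Rightarrow> complex poly \<Rightarrow> complex" where
  "planar p q = (\<integral>z. of_real (weight z) * (poly p z * poly q (cnj z)) \<partial>lborel)"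

lemma integrable_planar: "integrable lborel (\<lambda>z. of_real (weight z) * (poly p z * poly q (cnj z)))"
  using integrable_weight_polys[of "\<lambda>_. 1" 1 p q] by simp

lemma planar_add_left: "planar (p + p') q = planar p q + planar p' q"
  unfolding planar_def by (subst Bochner_Integration.integral_add[symmetric])
    (intro integrable_planar, intro integrable_planar, simp add: algebra_simps)

lemma planar_add_right: "planar p (q + q') = planar p q + planar p q'"
  unfolding planar_def by (subst Bochner_Integration.integral_add[symmetric])
    (intro integrable_planar, intro integrable_planar, simp add: algebra_simps)

lemma planar_smult_left: "planar (Polynomial.smult c p) q = c * planar p q"
  unfolding planar_def by (subst integral_mult_right_zero[symmetric]) (simp add: mult_ac)

lemma planar_smult_right: "planar p (Polynomial.smult c q) = c * planar p q"
  unfolding planar_def by (subst integral_mult_right_zero[symmetric]) (simp add: mult_ac)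

lemma planar_diff_left: "planar (p - p') q = planar p q - planar p' q"
  using planar_add_left[of "p - p'" p' q] by simp

lemma planar_zero [simp]: "planar 0 q = 0" "planar p 0 = 0"
  by (simp_all add: planar_def)

abbreviation xpoly :: "complex poly \<Rightarrow> complex poly" where "xpoly p \<equiv> pCons 0 p"

text \<open>
  On a horizontal line, $p(z)q(\bar z)$ is a polynomial in the real variable $x$, so the
  integral over the plane vanishes line by line.
\<close>

lemma planar_x_by_parts:
  "planar (pderiv p) q + planar p (pderiv q)
     = of_real (n / (1 + \<tau>)) * (planar (xpoly p) q + planar p (xpoly q))"
proof -
  let ?a = "n / (1 + \<tau>)" and ?b = "n / (1 - \<tau>)"
  have a: "?a > 0" using n_pos tau_nonneg by simp
  define F where "F = (\<lambda>z. of_real (weight z) * (poly (pderiv p) z * poly q (cnj z))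
    + of_real (weight z) * (poly p z * poly (pderiv q) (cnj z))
    - of_real ?a * (of_real (weight z) * (poly (xpoly p) z * poly q (cnj z))
    + of_real (weight z) * (poly p z * poly (xpoly q) (cnj z))))"
  have iF: "integrable lborel F" unfolding F_def
    by (intro Bochner_Integration.integrable_diff Bochner_Integration.integrable_add integrable_mult_right integrable_planar)
  have "(\<integral>z. F z \<partial>lborel) = (\<integral>y. \<integral>x. F (Complex x y) \<partial>lborel \<partial>lborel)"
    by (rule integral_lborel_complex[OF iF])
  also have "(\<lambda>y. \<integral>x. F (Complex x y) \<partial>lborel) = (\<lambda>y. 0)"
  proof
    fix y :: real
    define r where "r = pcompose p [:\<i> * of_real y, 1:] * pcompose q [:- \<i> * of_real y, 1:]"
    have c: "Complex x y = of_real x + \<i> * of_real y" "cnj (Complex x y) = of_real x - \<i> * of_real y" for x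
      by (auto simp: complex_eq_iff)
    have pr: "poly r (of_real x) = poly p (Complex x y) * poly q (cnj (Complex x y))" for x
      unfolding r_def c by (simp add: poly_pcompose algebra_simps)
    have pd: "pderiv [:c, 1:] = 1" for c :: complex by (simp add: pderiv_pCons)
    have dr: "poly (pderiv r) (of_real x) = poly (pderiv p) (Complex x y) * poly q (cnj (Complex x y))
        + poly p (Complex x y) * poly (pderiv q) (cnj (Complex x y))" for x
      unfolding r_def c pderiv_mult pderiv_pcompose pd by (simp add: poly_pcompose algebra_simps)
    have "F (Complex x y) = of_real (exp (- ?b * y\<^sup>2)) * (of_real (exp (- ?a * x\<^sup>2)) *
       (poly (pderiv r) (of_real x) - of_real (2 * ?a * x) * poly r (of_real x)))" for x
    proof -
      have w: "weight (Complex x y) = exp (- ?b * y\<^sup>2) * exp (- ?a * x\<^sup>2)"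
        unfolding weight_eq by (simp add: exp_add[symmetric])
      have s: "Complex x y + cnj (Complex x y) = of_real (2 * x)" by (simp add: complex_eq_iff)
      have "F (Complex x y) = of_real (weight (Complex x y)) * (poly (pderiv p) (Complex x y) * poly q (cnj (Complex x y))
        + poly p (Complex x y) * poly (pderiv q) (cnj (Complex x y))
        - of_real ?a * (Complex x y + cnj (Complex x y)) * (poly p (Complex x y) * poly q (cnj (Complex x y))))"
        unfolding F_def by (simp add: algebra_simps)
      also have "\<dots> = of_real (weight (Complex x y)) * (poly (pderiv r) (of_real x) - of_real (2 * ?a * x) * poly r (of_real x))"
        unfolding dr pr s by (simp add: mult_ac)
      finally show ?thesis unfolding w by (simp add: mult_ac)
    qed
    thus "(\<integral>x. F (Complex x y) \<partial>lborel) = 0"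
      using integral_gaussian_by_parts[OF a, of r] by simp
  qed
  finally have "(\<integral>z. F z \<partial>lborel) = 0" by simp
  moreover have "(\<integral>z. F z \<partial>lborel) = planar (pderiv p) q + planar p (pderiv q)
     - of_real ?a * (planar (xpoly p) q + planar p (xpoly q))"
    unfolding F_def planar_def
    by (subst Bochner_Integration.integral_diff Bochner_Integration.integral_add integral_mult_right_zero;
        (intro Bochner_Integration.integrable_add integrable_mult_right integrable_planar)?)+ simp
  ultimately show ?thesis by simp
qed

lemma planar_y_by_parts:
  "planar (pderiv p) q - planar p (pderiv q)
     = of_real (n / (1 - \<tau>)) * (planar p (xpoly q) - planar (xpoly p) q)"
proof -
  let ?a = "n / (1 + \<tau>)" and ?b = "n / (1 - \<tau>)"
  have b: "?b > 0" using n_pos tau_less_1 by simp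
  define F where "F = (\<lambda>z. of_real (weight z) * (poly (pderiv p) z * poly q (cnj z))
    - of_real (weight z) * (poly p z * poly (pderiv q) (cnj z))
    - of_real ?b * (of_real (weight z) * (poly p z * poly (xpoly q) (cnj z))
    - of_real (weight z) * (poly (xpoly p) z * poly q (cnj z))))"
  have iF: "integrable lborel F" unfolding F_def
    by (intro Bochner_Integration.integrable_diff Bochner_Integration.integrable_add integrable_mult_right integrable_planar)
  have "(\<integral>z. F z \<partial>lborel) = (\<integral>x. \<integral>y. F (Complex x y) \<partial>lborel \<partial>lborel)"
    by (rule integral_lborel_complex[OF iF])
  also have "(\<lambda>x. \<integral>y. F (Complex x y) \<partial>lborel) = (\<lambda>x. 0)"
  proof
    fix x :: real
    define r where "r = pcompose p [:of_real x, \<i>:] * pcompose q [:of_real x, -\<i>:]"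
    have c: "Complex x y = of_real x + \<i> * of_real y" "cnj (Complex x y) = of_real x - \<i> * of_real y" for y
      by (auto simp: complex_eq_iff)
    have pr: "poly r (of_real y) = poly p (Complex x y) * poly q (cnj (Complex x y))" for y
      unfolding r_def c by (simp add: poly_pcompose algebra_simps)
    have pd: "pderiv [:c, d:] = [:d:]" for c d :: complex by (simp add: pderiv_pCons)
    have dr: "poly (pderiv r) (of_real y) = \<i> * (poly (pderiv p) (Complex x y) * poly q (cnj (Complex x y))
        - poly p (Complex x y) * poly (pderiv q) (cnj (Complex x y)))" for y
      unfolding r_def c pderiv_mult pderiv_pcompose pd by (simp add: poly_pcompose algebra_simps)
    have "F (Complex x y) = (- \<i> * of_real (exp (- ?a * x\<^sup>2))) * (of_real (exp (- ?b * y\<^sup>2)) *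
       (poly (pderiv r) (of_real y) - of_real (2 * ?b * y) * poly r (of_real y)))" for y
    proof -
      have w: "weight (Complex x y) = exp (- ?a * x\<^sup>2) * exp (- ?b * y\<^sup>2)"
        unfolding weight_eq by (simp add: exp_add[symmetric])
      have s: "cnj (Complex x y) - Complex x y = - \<i> * of_real (2 * y)" by (simp add: complex_eq_iff)
      have "F (Complex x y) = of_real (weight (Complex x y)) * (poly (pderiv p) (Complex x y) * poly q (cnj (Complex x y))
        - poly p (Complex x y) * poly (pderiv q) (cnj (Complex x y))
        - of_real ?b * (cnj (Complex x y) - Complex x y) * (poly p (Complex x y) * poly q (cnj (Complex x y))))"
        unfolding F_def by (simp add: algebra_simps)
      also have "\<dots> = of_real (weight (Complex x y)) * (- \<i> * (poly (pderiv r) (of_real y) - of_real (2 * ?b * y) * poly r (of_real y)))"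
        unfolding dr pr s by (simp add: algebra_simps)
      finally show ?thesis unfolding w by (simp add: mult_ac)
    qed
    thus "(\<integral>y. F (Complex x y) \<partial>lborel) = 0"
      using integral_gaussian_by_parts[OF b, of r] by simp
  qed
  finally have "(\<integral>z. F z \<partial>lborel) = 0" by simp
  moreover have "(\<integral>z. F z \<partial>lborel) = planar (pderiv p) q - planar p (pderiv q)
     - of_real ?b * (planar p (xpoly q) - planar (xpoly p) q)"
    unfolding F_def planar_def
    by (subst Bochner_Integration.integral_diff Bochner_Integration.integral_add integral_mult_right_zero;
        (intro Bochner_Integration.integrable_diff integrable_mult_right integrable_planar)?)+ simp
  ultimately show ?thesis by simp
qed

text \<open>
  The raising operator $p\mapsto zp-\frac{\tau}{n}p'$ is adjoint to differentiation. This is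
  the combination of the two integrations by parts in which $\int zp(z)q(\bar z)e^{-nV}$ is
  isolated, and it is the only property of the weight that the orthogonality relations use
  besides the total mass.
\<close>

lemma planar_raise:
  "planar (xpoly p - Polynomial.smult (of_real (\<tau> / n)) (pderiv p)) q = of_real (1 / n) * planar p (pderiv q)"
proof -
  define A B C D T m where defs: "A = planar (pderiv p) q" "B = planar p (pderiv q)" "C = planar (xpoly p) q" "D = planar p (xpoly q)"
    "T = complex_of_real \<tau>" "m = complex_of_real n"
  have ne: "m \<noteq> 0" using n_pos by (simp add: defs)
  have e: "(1 + T) * of_real (n / (1 + \<tau>)) = m" "(1 - T) * of_real (n / (1 - \<tau>)) = m"
  proof -
    have "(1 + \<tau>) * (n / (1 + \<tau>)) = n" "(1 - \<tau>) * (n / (1 - \<tau>)) = n"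
      using tau_nonneg tau_less_1 by simp_all
    thus "(1 + T) * of_real (n / (1 + \<tau>)) = m" "(1 - T) * of_real (n / (1 - \<tau>)) = m"
      unfolding defs by (metis of_real_1 of_real_add of_real_mult, metis of_real_1 of_real_diff of_real_mult)
  qed
  have 1: "(1 + T) * (A + B) = m * (C + D)"
    unfolding defs(1-4) planar_x_by_parts mult.assoc[symmetric] e ..
  have 2: "(1 - T) * (A - B) = m * (D - C)"
    unfolding defs(1-4) planar_y_by_parts mult.assoc[symmetric] e ..
  have "(1 + T) * (A + B) - (1 - T) * (A - B) = m * (C + D) - m * (D - C)" using 1 2 by simp
  moreover have "(1 + T) * (A + B) - (1 - T) * (A - B) = 2 * (B + T * A)" by (simp add: algebra_simps)
  moreover have "m * (C + D) - m * (D - C) = 2 * (m * C)" by (simp add: algebra_simps)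
  ultimately have "2 * (m * C) = 2 * (B + T * A)" by simp
  hence "m * C = B + T * A" by (simp only: mult_cancel_left) simp
  hence "m * C - T * A = B" by simp
  hence "C - T / m * A = 1 / m * B" using ne by (simp add: field_simps)
  thus ?thesis unfolding planar_diff_left planar_smult_left by (simp add: defs)
qed

text \<open>
  The monic Hermite polynomials $(\tau/2n)^{k/2}H_k(\sqrt{n/2\tau}\,z)$, generated from 1 by
  the raising operator; in this form $\tau=0$ gives the monomials.
\<close>

fun herm :: "nat \<Rightarrow> complex poly" where
  "herm 0 = 1"
| "herm (Suc k) = xpoly (herm k) - Polynomial.smult (of_real (\<tau> / n)) (pderiv (herm k))"

lemma pderiv_herm: "pderiv (herm k) = Polynomial.smult (of_nat k) (herm (k - 1))"
proof (induction k)
  case (Suc k)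
  have "pderiv (herm (Suc k)) = herm k + xpoly (pderiv (herm k)) - Polynomial.smult (of_real (\<tau> / n)) (pderiv (pderiv (herm k)))"
    by (simp add: pderiv_pCons pderiv_diff pderiv_smult)
  also have "\<dots> = herm k + Polynomial.smult (of_nat k) (xpoly (herm (k - 1)) - Polynomial.smult (of_real (\<tau> / n)) (pderiv (herm (k - 1))))"
    by (simp add: Suc pderiv_smult smult_diff_right mult_ac)
  also have "\<dots> = herm k + Polynomial.smult (of_nat k) (herm k)" by (cases k) simp_all
  also have "\<dots> = Polynomial.smult (of_nat (Suc k)) (herm k)" by (simp add: Polynomial.smult_add_left)
  finally show ?case by simp
qed simp

lemma herm_rec: "xpoly (herm k) = herm (Suc k) + Polynomial.smult (of_real (\<tau> / n) * of_nat k) (herm (k - 1))"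
  by (simp add: pderiv_herm)

declare herm.simps(2) [simp del]

lemma degree_herm_lead: "degree (herm k) = k \<and> lead_coeff (herm k) = 1"
proof (induction k)
  case (Suc k)
  have nz: "herm k \<noteq> 0" using Suc by (metis leading_coeff_0_iff zero_neq_one)
  have d: "degree (xpoly (herm k)) = Suc k" using Suc nz by simp
  have "degree (Polynomial.smult (of_real (\<tau> / n)) (pderiv (herm k))) \<le> degree (pderiv (herm k))"
    by (rule degree_smult_le)
  also have "\<dots> \<le> k" using Suc degree_pderiv[of "herm k"] by simp
  finally have l: "degree (Polynomial.smult (of_real (\<tau> / n)) (pderiv (herm k))) < degree (xpoly (herm k))" using d by simp
  have "degree (herm (Suc k)) = Suc k"
    unfolding herm.simps(2) using l d by (metis degree_add_eq_left degree_minus diff_conv_add_uminus)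
  moreover have "coeff (Polynomial.smult (of_real (\<tau> / n)) (pderiv (herm k))) (Suc k) = 0"
    using l d by (intro coeff_eq_0) simp
  hence "coeff (herm (Suc k)) (Suc k) = 1"
    unfolding herm.simps(2) coeff_diff coeff_pCons_Suc using Suc by (metis diff_zero)
  ultimately show ?case by simp
qed simp

lemma cnj_poly_herm: "cnj (poly (herm k) z) = poly (herm k) (cnj z)"
proof (induction k rule: less_induct)
  case (less k)
  show ?case
  proof (cases k)
    case (Suc j)
    have "poly (herm k) z = z * poly (herm j) z - of_real (\<tau> / n) * of_nat j * poly (herm (j - 1)) z" for z
      unfolding Suc herm.simps(2) pderiv_herm by simp
    thus ?thesis using less[of j] less[of "j - 1"] Suc by simp
  qed simp
qed

definition norm_sq :: "nat \<Rightarrow> real" where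
  "norm_sq k = pi * sqrt (1 - \<tau>\<^sup>2) / n * fact k / n ^ k"

lemma norm_sq_pos: "norm_sq k > 0"
proof -
  have "\<tau>\<^sup>2 < 1" using tau_nonneg tau_less_1 by (simp add: power_less_one_iff abs_square_less_1)
  thus ?thesis unfolding norm_sq_def using n_pos by simp
qed

lemma norm_sq_Suc: "norm_sq (Suc k) = (real k + 1) / n * norm_sq k"
  unfolding norm_sq_def using n_pos by (simp add: field_simps)

lemma planar_one: "planar 1 1 = of_real (norm_sq 0)"
proof -
  let ?a = "n / (1 + \<tau>)" and ?b = "n / (1 - \<tau>)"
  have a: "?a > 0" and b: "?b > 0" using n_pos tau_nonneg tau_less_1 by auto
  have i: "integrable lborel weight" using integrable_weight_power[of 0] by simp
  have "(\<integral>z. weight z \<partial>lborel) = (\<integral>y. \<integral>x. exp (- ?b * y\<^sup>2) * exp (- ?a * x\<^sup>2) \<partial>lborel \<partial>lborel)"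
  proof -
    have "weight (Complex x y) = exp (- ?b * y\<^sup>2) * exp (- ?a * x\<^sup>2)" for x y
      unfolding weight_eq by (simp add: exp_add[symmetric])
    thus ?thesis by (subst integral_lborel_complex(1)[OF i]) simp
  qed
  also have "\<dots> = sqrt (pi / ?a) * sqrt (pi / ?b)"
    using integral_monomial_gaussian(1)[OF a, of 0] integral_monomial_gaussian(1)[OF b, of 0] by simp
  also have "\<dots> = sqrt (pi\<^sup>2 * (1 - \<tau>\<^sup>2) / n\<^sup>2)"
    unfolding real_sqrt_mult[symmetric] by (rule arg_cong[of _ _ sqrt]) (simp add: power2_eq_square field_simps)
  also have "\<dots> = norm_sq 0" unfolding norm_sq_def using n_pos by (simp add: real_sqrt_divide real_sqrt_mult)
  finally have w: "(\<integral>z. weight z \<partial>lborel) = norm_sq 0" .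
  have "planar 1 1 = (\<integral>z. complex_of_real (weight z) \<partial>lborel)" unfolding planar_def by simp
  also have "\<dots> = of_real (norm_sq 0)" unfolding integral_complex_of_real w ..
  finally show ?thesis .
qed

text \<open>
  Moving the raising operators over to the other factor differentiates it, and
  differentiation lowers the degree. The case $j=0$ follows by conjugation, as the
  coefficients are real.
\<close>

lemma planar_herm: "planar (herm j) (herm k) = (if j = k then of_real (norm_sq j) else 0)"
proof (induction j arbitrary: k)
  case 0
  have *: "planar (herm (Suc j)) 1 = 0" for j
    unfolding herm.simps(2) planar_raise by (simp add: pderiv_1)
  show ?case
  proof (cases k)
    case (Suc i)
    have "planar 1 (herm k) = (\<integral>z. cnj (of_real (weight z) * (poly (herm k) z * poly 1 (cnj z))) \<partial>lborel)"
      unfolding planar_def by (simp add: cnj_poly_herm)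
    also have "\<dots> = cnj (planar (herm k) 1)" unfolding planar_def
      by (rule integral_bounded_linear[OF bounded_linear_cnj integrable_planar])
    finally have "planar 1 (herm k) = cnj (planar (herm k) 1)" .
    thus ?thesis using * Suc by simp
  qed (simp add: planar_one)
next
  case (Suc j)
  have "planar (herm (Suc j)) (herm k) = of_real (1 / n) * (of_nat k * planar (herm j) (herm (k - 1)))"
    unfolding herm.simps(2) planar_raise unfolding pderiv_herm planar_smult_right ..
  also have "\<dots> = (if Suc j = k then of_real (norm_sq (Suc j)) else 0)"
    unfolding Suc.IH norm_sq_Suc by (cases k) auto
  finally show ?case .
qed

section \<open>Skew-orthogonal polynomials\<close>

definition skew :: "complex poly \<Rightarrow> complex poly \<Rightarrow> complex" where
  "skew p q = (\<integral>z. (z - cnj z) * of_real (weight z) * (poly p z * poly q (cnj z)) \<partial>lborel)"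

lemma skew_planar: "skew p q = planar (xpoly p) q - planar p (xpoly q)"
  unfolding skew_def planar_def
  by (subst Bochner_Integration.integral_diff[symmetric])
    (intro integrable_planar, intro integrable_planar, simp add: algebra_simps)

lemma skew_add_left: "skew (p + p') q = skew p q + skew p' q"
  and skew_add_right: "skew p (q + q') = skew p q + skew p q'"
  and skew_smult_left: "skew (Polynomial.smult c p) q = c * skew p q"
  and skew_smult_right: "skew p (Polynomial.smult c q) = c * skew p q"
proof -
  have x: "xpoly (p + p') = xpoly p + xpoly p'" "xpoly (Polynomial.smult c p) = Polynomial.smult c (xpoly p)" for p p' c by simp_all
  show "skew (p + p') q = skew p q + skew p' q" "skew p (q + q') = skew p q + skew p q'"
    "skew (Polynomial.smult c p) q = c * skew p q" "skew p (Polynomial.smult c q) = c * skew p q"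
    unfolding skew_planar x planar_add_left planar_add_right planar_smult_left planar_smult_right
    by (simp_all add: algebra_simps)
qed

definition skew_norm :: "nat \<Rightarrow> real" where
  "skew_norm j = (1 - \<tau>) * norm_sq (Suc j)"

text \<open>
  Multiplication by $z$ is tridiagonal in the Hermite basis, so only neighbouring degrees
  interact.
\<close>

lemma skew_herm: "skew (herm j) (herm k) =
   (if k = Suc j then of_real (skew_norm j) else if j = Suc k then - of_real (skew_norm k) else 0)"
proof -
  have "skew (herm j) (herm k) = planar (herm (Suc j)) (herm k) + of_real (\<tau> / n) * of_nat j * planar (herm (j - 1)) (herm k)
     - (planar (herm j) (herm (Suc k)) + of_real (\<tau> / n) * of_nat k * planar (herm j) (herm (k - 1)))"
    unfolding skew_planar herm_rec planar_add_left planar_add_right planar_smult_left planar_smult_right ..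
  also have "\<dots> = (if k = Suc j then of_real (skew_norm j) else if j = Suc k then - of_real (skew_norm k) else 0)"
  proof -
    have r: "norm_sq (Suc i) - \<tau> / n * (real i + 1) * norm_sq i = skew_norm i" for i
      unfolding skew_norm_def norm_sq_Suc by (simp add: algebra_simps diff_divide_distrib add_divide_distrib)
    have r': "complex_of_real (norm_sq (Suc i)) - of_real (\<tau> / n) * of_nat (Suc i) * of_real (norm_sq i) = of_real (skew_norm i)" for i
      unfolding r[symmetric] by simp
    consider "k = Suc j" | "j = Suc k" | "k \<noteq> Suc j" "j \<noteq> Suc k" by blast
    thus ?thesis
    proof cases
      case 1
      thus ?thesis unfolding planar_herm using r'[of j] by (cases j) (simp_all add: algebra_simps)
    next
      case 2
      thus ?thesis unfolding planar_herm using r'[of k] by (cases k) (simp_all add: algebra_simps)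
    next
      case 3
      thus ?thesis unfolding planar_herm by (cases j; cases k) auto
    qed
  qed
  finally show ?thesis .
qed

text \<open>
  The coefficient is forced: it is the quotient of consecutive skew norms that makes the
  polynomial of degree $2k+2$ orthogonal to the Hermite polynomial of degree $2k+1$. In odd
  degrees the Hermite polynomials themselves complete the skew-orthogonal family.
\<close>

fun even_skew :: "nat \<Rightarrow> complex poly" where
  "even_skew 0 = 1"
| "even_skew (Suc k) = herm (2 * Suc k) + Polynomial.smult (of_real (2 * real (Suc k) / n)) (even_skew k)"

lemma degree_even_skew: "degree (even_skew k) = 2 * k \<and> lead_coeff (even_skew k) = 1"
proof (induction k)
  case (Suc k)
  have h: "degree (herm (2 * Suc k)) = 2 * Suc k" "coeff (herm (2 * Suc k)) (2 * Suc k) = 1"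
    using degree_herm_lead[of "2 * Suc k"] by metis+
  have l: "degree (Polynomial.smult (of_real (2 * real (Suc k) / n)) (even_skew k)) < 2 * Suc k"
    using Suc degree_smult_le[of "of_real (2 * real (Suc k) / n)" "even_skew k"] by simp
  have "degree (even_skew (Suc k)) = 2 * Suc k"
    unfolding even_skew.simps using l h(1) by (simp only: degree_add_eq_left)
  moreover have "coeff (Polynomial.smult (of_real (2 * real (Suc k) / n)) (even_skew k)) (2 * Suc k) = 0"
    using l by (intro coeff_eq_0)
  hence "coeff (even_skew (Suc k)) (2 * Suc k) = 1"
    unfolding even_skew.simps coeff_add h(2) by simp
  ultimately show ?case by simp
qed simp

lemma skew_even_skew_odd:
  "skew (even_skew k) (herm (2 * l + 1)) = (if k = l then of_real (skew_norm (2 * k)) else 0)"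
proof -
  have le: "skew (even_skew k) (herm (2 * l + 1)) = (if k = l then of_real (skew_norm (2 * k)) else 0)" if "k \<le> l" for k
    using that
  proof (induction k)
    case 0
    show ?case using skew_herm[of 0 "2 * l + 1"] by auto
  next
    case (Suc k)
    thus ?case unfolding even_skew.simps skew_add_left skew_smult_left skew_herm by auto
  qed
  moreover have "skew (even_skew k) (herm (2 * l + 1)) = 0" if "k > l"
    using that
  proof (induction k)
    case (Suc k)
    show ?case
    proof (cases "k = l")
      case True
      have "skew (even_skew l) (herm (2 * l + 1)) = of_real (skew_norm (2 * l))"
        using le[of l] by simp
      \<comment> \<open>the two neighbours of degree 2 l + 1 cancel by the choice of the
          recursion coefficient\<close>
      moreover have "skew_norm (Suc (2 * l)) = 2 * real (Suc l) / n * skew_norm (2 * l)"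
        unfolding skew_norm_def norm_sq_Suc[of "Suc (2 * l)"] using n_pos by (simp add: field_simps)
      ultimately show ?thesis
        unfolding even_skew.simps skew_add_left skew_smult_left skew_herm True by simp
    next
      case False
      with Suc have "skew (even_skew k) (herm (2 * l + 1)) = 0" by simp
      thus ?thesis unfolding even_skew.simps skew_add_left skew_smult_left skew_herm using Suc False by auto
    qed
  qed simp
  ultimately show ?thesis using le[of k] by (cases "k \<le> l") auto
qed

end

section \<open>The Vandermonde determinant of conjugate pairs\<close>

text \<open>
  Induction on the size: as a function of the last node, the determinant is a polynomial of
  degree at most $n$, whose leading coefficient is the smaller determinant and which
  vanishes at the earlier nodes.
\<close>

lemma det_monic_polys:
  fixes P :: "nat \<Rightarrow> 'a :: idom poly" and u :: "nat \<Rightarrow> 'a"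
  assumes P: "\<And>i. i < n \<Longrightarrow> degree (P i) = i" "\<And>i. i < n \<Longrightarrow> lead_coeff (P i) = 1"
  shows "det (mat n n (\<lambda>(i, j). poly (P j) (u i))) = (\<Prod>k<n. \<Prod>j<k. u k - u j)"
  using P
proof (induction n)
  case (Suc n)
  define A where "A = (\<lambda>x. mat (Suc n) (Suc n) (\<lambda>(i, j). poly (P j) (if i = n then x else u i)))"
  have A: "A x \<in> carrier_mat (Suc n) (Suc n)" for x by (simp add: A_def)
  define c where "c = (\<lambda>j. cofactor (A 0) n j)"
  have cof: "cofactor (A x) n j = c j" if "j < Suc n" for x j
    unfolding c_def cofactor_def
    by (rule arg_cong[of _ _ "\<lambda>M. _ * det M"], rule eq_matI) (use that in \<open>auto simp: mat_delete_def A_def\<close>)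
  have IH: "det (mat n n (\<lambda>(i, j). poly (P j) (u i))) = (\<Prod>k<n. \<Prod>j<k. u k - u j)" (is "_ = ?D")
    by (rule Suc.IH) (use Suc.prems in auto)
  have cn: "c n = ?D"
  proof -
    have "mat_delete (A 0) n n = mat n n (\<lambda>(i, j). poly (P j) (u i))"
      by (rule eq_matI) (auto simp: mat_delete_def A_def)
    thus ?thesis unfolding c_def cofactor_def using IH by (simp flip: mult_2)
  qed
  define Q where "Q = (\<Sum>j<Suc n. Polynomial.smult (c j) (P j))"
  have detA: "det (A x) = poly Q x" for x
  proof -
    have "A x $$ (n, j) = poly (P j) x" if "j < Suc n" for j using that by (simp add: A_def)
    thus ?thesis unfolding laplace_expansion_row[OF A lessI] Q_def poly_sum
      by (intro sum.cong) (auto simp: cof mult.commute)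
  qed
  have identical: "det (A x) = 0" if "i < n" "x = u i" for i x
    by (rule det_identical_rows[OF A, of i n]) (use that in \<open>auto simp: A_def intro!: eq_vecI\<close>)
  have eqA: "mat (Suc n) (Suc n) (\<lambda>(i, j). poly (P j) (u i)) = A (u n)"
    by (rule eq_matI) (auto simp: A_def)
  show ?case
  proof (cases "inj_on u {..<n}")
    case True
    define R where "R = (\<Prod>j<n. [:- u j, 1:])"
    have R: "degree R = n" "lead_coeff R = 1"
      unfolding R_def by (simp add: degree_prod_sum_eq) (simp add: lead_coeff_prod)
    define T where "T = Q - Polynomial.smult ?D R"
    have dQ: "degree Q \<le> n" unfolding Q_def
      by (intro degree_sum_le) (auto intro!: order_trans[OF degree_smult_le] simp: Suc.prems)
    have "coeff Q n = c n"
    proof -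
      have "coeff Q n = (\<Sum>j<Suc n. c j * coeff (P j) n)" unfolding Q_def by (simp add: coeff_sum)
      also have "\<dots> = (\<Sum>j<Suc n. if j = n then c n else 0)"
        by (rule sum.cong) (use Suc.prems(1) Suc.prems(2)[of n] in \<open>auto simp: coeff_eq_0 less_Suc_eq\<close>)
      finally show ?thesis by simp
    qed
    hence T0: "coeff T n = 0" unfolding T_def using R by (simp add: cn)
    have dT: "degree T \<le> n" unfolding T_def using dQ R
      by (intro degree_diff_le) (auto intro: order_trans[OF degree_smult_le])
    have roots: "poly T (u i) = 0" if "i < n" for i
      unfolding T_def R_def using that detA[of "u i"] identical[of i "u i"] by (auto simp: poly_prod)
    \<comment> \<open>T has degree below n but vanishes at n distinct nodes\<close>
    have "T = 0"
    proof (rule ccontr)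
      assume "T \<noteq> 0"
      have "u ` {..<n} \<subseteq> {x. poly T x = 0}" using roots by auto
      hence "card (u ` {..<n}) \<le> card {x. poly T x = 0}" by (intro card_mono poly_roots_finite \<open>T \<noteq> 0\<close>)
      hence "n \<le> degree T" using card_image[OF True] card_poly_roots_bound[OF \<open>T \<noteq> 0\<close>] by simp
      with dT have "degree T = n" by simp
      with T0 \<open>T \<noteq> 0\<close> show False by (metis leading_coeff_0_iff)
    qed
    hence "poly Q (u n) = ?D * (\<Prod>j<n. u n - u j)"
      unfolding T_def R_def by (simp add: poly_prod)
    thus ?thesis unfolding eqA detA by simp
  next
    case False
    then obtain i j where ij: "i < n" "j < n" "i < j" "u i = u j"
      unfolding inj_on_def by (metis lessThan_iff linorder_neqE_nat)
    have "u j - u i = 0" using ij by simp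
    hence "(\<Prod>i<j. u j - u i) = 0" using ij(3) by (intro prod_zero finite_lessThan bexI[of _ i]) auto
    have "(\<Prod>k<n. \<Prod>j<k. u k - u j) = 0"
    proof (rule prod_zero[OF finite_lessThan], rule bexI[of _ j])
      show "(\<Prod>i<j. u j - u i) = 0" by fact
    qed (use ij in simp)
    moreover have "det (A (u n)) = 0"
      by (rule det_identical_rows[OF A, of i j]) (use ij in \<open>auto simp: A_def intro!: eq_vecI\<close>)
    ultimately show ?thesis unfolding eqA by simp
  qed
qed simp

lemma prod_lessThan_double:
  fixes f :: "nat \<Rightarrow> 'a :: comm_monoid_mult"
  shows "(\<Prod>i<2 * n. f i) = (\<Prod>j<n. f (2 * j) * f (2 * j + 1))"
  by (induction n) (simp_all add: mult_ac)

text \<open>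
  The nodes $z_0,\bar z_0,z_1,\bar z_1,\dots$ of the Vandermonde determinant.
\<close>

definition pairing :: "(nat \<Rightarrow> complex) \<Rightarrow> nat \<Rightarrow> complex" where
  "pairing z i = (if even i then z (i div 2) else cnj (z (i div 2)))"

lemma pairing_simps [simp]: "pairing z (2 * j) = z j" "pairing z (Suc (2 * j)) = cnj (z j)"
  by (simp_all add: pairing_def)

lemma prod_differences_pairing:
  "(\<Prod>k<2 * N. \<Prod>j<k. pairing z k - pairing z j)
     = of_real (\<Prod>k<N. \<Prod>j<k. (cmod (z j - z k))\<^sup>2 * (cmod (z j - cnj (z k)))\<^sup>2) * (\<Prod>j<N. cnj (z j) - z j)"
proof (induction N)
  case (Suc N)
  have "(\<Prod>k<2 * Suc N. \<Prod>j<k. pairing z k - pairing z j) =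
     (\<Prod>k<2 * N. \<Prod>j<k. pairing z k - pairing z j) * ((\<Prod>j<2 * N. z N - pairing z j) * (\<Prod>j<2 * N. cnj (z N) - pairing z j)) * (cnj (z N) - z N)"
  proof -
    have "2 * Suc N = Suc (Suc (2 * N))" by simp
    moreover have "pairing z (Suc (2 * N)) - pairing z (2 * N) = cnj (z N) - z N" by simp
    moreover have "(\<Prod>j<2 * N. pairing z (2 * N) - pairing z j) = (\<Prod>j<2 * N. z N - pairing z j)"
      "(\<Prod>j<2 * N. pairing z (Suc (2 * N)) - pairing z j) = (\<Prod>j<2 * N. cnj (z N) - pairing z j)"
      by simp_all
    ultimately show ?thesis by (simp only: prod.lessThan_Suc) (simp only: mult_ac)
  qed
  also have "(\<Prod>j<2 * N. z N - pairing z j) * (\<Prod>j<2 * N. cnj (z N) - pairing z j)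
     = (\<Prod>j<N. (z N - z j) * (z N - cnj (z j)) * ((cnj (z N) - z j) * (cnj (z N) - cnj (z j))))"
    unfolding prod_lessThan_double prod.distrib[symmetric] by simp
  also have "\<dots> = (\<Prod>j<N. of_real ((cmod (z j - z N))\<^sup>2 * (cmod (z j - cnj (z N)))\<^sup>2))"
    unfolding of_real_mult complex_norm_square by (rule prod.cong) (auto simp: algebra_simps)
  finally show ?case unfolding Suc.IH by (simp add: mult_ac)
qed simp

section \<open>Permutations that respect the pairing\<close>

text \<open>
  The involution that swaps $2j$ and $2j+1$, extended by the identity so that it is a
  permutation of the natural numbers.
\<close>

definition partner :: "nat \<Rightarrow> nat \<Rightarrow> nat" where
  "partner N i = (if i < 2 * N then (if even i then i + 1 else i - 1) else i)"

lemma partner_even [simp]: "j < N \<Longrightarrow> partner N (2 * j) = Suc (2 * j)"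
  and partner_odd [simp]: "j < N \<Longrightarrow> partner N (Suc (2 * j)) = 2 * j"
  by (auto simp: partner_def)

lemma partner_partner [simp]: "partner N (partner N i) = i"
  unfolding partner_def by (cases "even i") (auto elim!: evenE oddE)

lemma partner_less [simp]: "partner N i < 2 * N \<longleftrightarrow> i < 2 * N"
  unfolding partner_def by (auto elim!: evenE oddE)

lemma even_partner [simp]: "i < 2 * N \<Longrightarrow> even (partner N i) \<longleftrightarrow> odd i"
  unfolding partner_def by auto

lemma less_double_cases:
  assumes "i < 2 * (N::nat)"
  obtains j where "j < N" "i = 2 * j" | j where "j < N" "i = Suc (2 * j)"
  using assms by (cases "even i") (auto elim!: evenE oddE)

lemma partner_permutes: "partner N permutes {..<2 * N}"
proof (rule bij_imp_permutes)
  show "bij_betw (partner N) {..<2 * N} {..<2 * N}"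
    by (rule bij_betwI[of _ _ _ "partner N"]) auto
qed (simp add: partner_def)

text \<open>
  Permutations that commute with the involution, that is, map each pair $\{2j,2j+1\}$ onto
  such a pair.
\<close>

definition pair_perms :: "nat \<Rightarrow> (nat \<Rightarrow> nat) set" where
  "pair_perms N = {p. p permutes {..<2 * N} \<and> (\<forall>i. p (partner N i) = partner N (p i))}"

lemma pair_permsI:
  assumes "p permutes {..<2 * N}" "\<And>j. j < N \<Longrightarrow> p (Suc (2 * j)) = partner N (p (2 * j))"
  shows "p \<in> pair_perms N"
proof -
  have "p (partner N i) = partner N (p i)" for i
  proof (cases "i < 2 * N")
    case True
    thus ?thesis using assms(2) by (elim less_double_cases) auto
  next
    case False
    hence "p i = i" using assms(1) by (simp add: permutes_def)
    thus ?thesis using False by (simp add: partner_def)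
  qed
  thus ?thesis using assms(1) by (simp add: pair_perms_def)
qed

lemma pair_perms_less: "p \<in> pair_perms N \<Longrightarrow> p i < 2 * N \<longleftrightarrow> i < 2 * N"
  unfolding pair_perms_def using permutes_in_image[of p "{..<2 * N}" i] by auto

text \<open>
  Such a permutation acts in the same way on the even and on the odd indices. The two
  actions are conjugate by the involution, hence have equal signs, and their product is the
  permutation.
\<close>

lemma sign_even_pair_perm:
  assumes p: "p \<in> pair_perms N" and ev: "\<And>j. j < N \<Longrightarrow> even (p (2 * j))"
  shows "sign p = 1"
proof -
  have perm: "p permutes {..<2 * N}" and com: "\<And>i. p (partner N i) = partner N (p i)"
    using p by (auto simp: pair_perms_def)
  define e where "e = (\<lambda>i. if even i then p i else i)"
  define d where "d = (\<lambda>i. if odd i then p i else i)"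
  have par: "even (p i) \<longleftrightarrow> even i" for i
  proof (cases "i < 2 * N")
    case True
    thus ?thesis
    proof (cases rule: less_double_cases)
      case (2 j)
      have "p i = partner N (p (2 * j))" using com[of "2 * j"] 2 by simp
      thus ?thesis using 2 ev[of j] pair_perms_less[OF p, of "2 * j"] by simp
    qed (use ev in auto)
  next
    case False
    thus ?thesis using perm by (simp add: permutes_def)
  qed
  have inj: "inj p" using perm by (rule permutes_inj)
  have e: "e permutes {..<2 * N}"
  proof (rule bij_imp_permutes)
    have "inj_on e {..<2 * N}"
    proof (rule inj_onI)
      fix x y assume "e x = e y"
      thus "x = y" using par[of x] par[of y] injD[OF inj, of x y]
        by (cases "even x"; cases "even y") (auto simp: e_def)
    qed
    moreover have "e ` {..<2 * N} \<subseteq> {..<2 * N}" using pair_perms_less[OF p] by (auto simp: e_def)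
    ultimately show "bij_betw e {..<2 * N} {..<2 * N}"
      by (simp add: bij_betw_def endo_inj_surj)
  qed (use perm in \<open>auto simp: e_def permutes_def\<close>)
  have dd: "d = partner N \<circ> e \<circ> partner N"
  proof
    fix i
    show "d i = (partner N \<circ> e \<circ> partner N) i"
    proof (cases "i < 2 * N")
      case True
      thus ?thesis using com[of i] by (auto simp: d_def e_def)
    next
      case False
      hence "p i = i" "partner N i = i" using perm by (auto simp: permutes_def partner_def)
      thus ?thesis by (auto simp: d_def e_def)
    qed
  qed
  have fin: "finite {..<2 * N}" by simp
  have pe: "permutation e" "permutation (partner N)"
    using e partner_permutes fin permutation_permutes by blast+
  have "sign d = sign e"
    unfolding dd using pe by (simp add: sign_compose permutation_compose)
  moreover have "p = e \<circ> d"
    by (rule ext) (simp add: e_def d_def par)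
  moreover have "permutation d" unfolding dd using pe by (simp add: permutation_compose)
  ultimately show ?thesis using pe by (simp add: sign_compose)
qed

text \<open>
  Composing with the transposition of a single pair changes both factors, which reduces the
  claim to permutations that preserve parity; the induction is on the number of pairs that
  are reversed.
\<close>

lemma sign_pair_perm:
  assumes "p \<in> pair_perms N"
  shows "of_int (sign p) * (\<Prod>j<N. if even (p (2 * j)) then 1 else - 1) = (1 :: 'a :: comm_ring_1)"
  using assms
proof (induction "card {j. j < N \<and> odd (p (2 * j))}" arbitrary: p)
  case 0
  hence "\<And>j. j < N \<Longrightarrow> even (p (2 * j))" by (auto simp: card_eq_0_iff)
  thus ?case using sign_even_pair_perm[OF 0(2)] by simp
next
  case (Suc m)
  have "{j. j < N \<and> odd (p (2 * j))} \<noteq> {}" using Suc(2) by (metis card.empty nat.distinct(1))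
  then obtain k where k: "k < N" "odd (p (2 * k))" by auto
  have perm: "p permutes {..<2 * N}" and com: "\<And>i. p (partner N i) = partner N (p i)"
    using Suc.prems by (auto simp: pair_perms_def)
  define t where "t = Transposition.transpose (2 * k) (Suc (2 * k))"
  define q where "q = p \<circ> t"
  have t: "t permutes {..<2 * N}" unfolding t_def using k by (intro permutes_swap_id) auto
  have qe: "q (2 * j) = (if j = k then partner N (p (2 * k)) else p (2 * j))"
    "q (Suc (2 * j)) = (if j = k then p (2 * k) else p (Suc (2 * j)))" if "j < N" for j
  proof -
    have "p (Suc (2 * k)) = partner N (p (2 * k))" using com[of "2 * k"] k by simp
    moreover have "2 * j \<noteq> Suc (2 * k)" "Suc (2 * j) \<noteq> 2 * k" by presburger+
    ultimately show "q (2 * j) = (if j = k then partner N (p (2 * k)) else p (2 * j))"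
      "q (Suc (2 * j)) = (if j = k then p (2 * k) else p (Suc (2 * j)))"
      by (auto simp: q_def t_def Transposition.transpose_def)
  qed
  have qH: "q \<in> pair_perms N"
  proof (rule pair_permsI)
    show "q permutes {..<2 * N}" unfolding q_def using t perm by (rule permutes_compose)
    show "q (Suc (2 * j)) = partner N (q (2 * j))" if "j < N" for j
      using com[of "2 * j"] that by (simp add: qe)
  qed
  have lt: "p (2 * k) < 2 * N" using pair_perms_less[OF Suc.prems] k by simp
  have "{j. j < N \<and> odd (q (2 * j))} = {j. j < N \<and> odd (p (2 * j))} - {k}"
    using k lt by (auto simp: qe split: if_splits)
  hence "card {j. j < N \<and> odd (q (2 * j))} = m" using Suc(2) k by simp
  hence IH: "of_int (sign q) * (\<Prod>j<N. if even (q (2 * j)) then 1 else - 1) = (1 :: 'a)"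
    using Suc.hyps(1)[OF _ qH] by simp
  have "permutation p" "permutation t" using perm t permutation_permutes by blast+
  hence "sign q = - sign p" unfolding q_def by (simp add: sign_compose) (simp add: t_def sign_swap_id)
  moreover have "(\<Prod>j<N. if even (q (2 * j)) then 1 else - 1) = - (\<Prod>j<N. if even (p (2 * j)) then 1 else - 1 :: 'a)"
  proof -
    have "(\<Prod>j<N. if even (q (2 * j)) then 1 else - 1) = (\<Prod>j<N. (if j = k then -1 else 1) * (if even (p (2 * j)) then 1 else - 1 :: 'a))"
      by (rule prod.cong) (use k lt in \<open>auto simp: qe\<close>)
    thus ?thesis using k by (simp add: prod.distrib)
  qed
  ultimately show ?case using IH by simp
qed

text \<open>
  The pairing of a skew-orthogonal family kills every permutation that does not respect the
  pairs, and by the sign lemma all remaining terms of the unperturbed sum are equal. So the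
  number of these permutations and the normalisation cancel in the quotient of the two sums.
  Replacing $A$ by $B$ in the factor $m$ multiplies the term of $p$ by the value at $p(2m)$
  of a function of one index; summed over $m$ and symmetrised under the involution, these
  values run through all indices exactly once, for every $p$.
\<close>

lemma sum_skew_permutations:
  fixes A B :: "nat \<Rightarrow> nat \<Rightarrow> complex" and r :: "nat \<Rightarrow> complex"
  assumes r: "\<And>k. k < N \<Longrightarrow> r k \<noteq> 0"
    and A1: "\<And>k. k < N \<Longrightarrow> A (2 * k) (Suc (2 * k)) = r k"
    and A2: "\<And>k. k < N \<Longrightarrow> A (Suc (2 * k)) (2 * k) = - r k"
    and A0: "\<And>i j. i < 2 * N \<Longrightarrow> j < 2 * N \<Longrightarrow> j \<noteq> partner N i \<Longrightarrow> A i j = 0"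
  shows "2 * (\<Sum>m<N. \<Sum>p | p permutes {..<2 * N}. of_int (sign p) *
            (\<Prod>j<N. (if j = m then B else A) (p (2 * j)) (p (Suc (2 * j)))))
       = (\<Sum>p | p permutes {..<2 * N}. of_int (sign p) * (\<Prod>j<N. A (p (2 * j)) (p (Suc (2 * j)))))
         * (\<Sum>k<N. (B (2 * k) (Suc (2 * k)) - B (Suc (2 * k)) (2 * k)) / r k)"
proof -
  let ?P = "{p. p permutes {..<2 * N}}" and ?H = "pair_perms N"
  have HP: "?H \<subseteq> ?P" by (auto simp: pair_perms_def)
  have finP: "finite ?P" by (rule finite_permutations) simp
  define C where "C = (\<Prod>k<N. r k)"
  define \<beta> where "\<beta> = (\<lambda>a. B a (partner N a) / A a (partner N a))"
  have Aa: "A a (partner N a) = (if even a then 1 else - 1) * r (a div 2)" if "a < 2 * N" for a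
    using that A1 A2 by (elim less_double_cases) auto
  have Anz: "A a (partner N a) \<noteq> 0" if "a < 2 * N" for a
    using Aa[OF that] r[of "a div 2"] that by auto
  have PA: "of_int (sign p) * (\<Prod>j<N. A (p (2 * j)) (p (Suc (2 * j)))) = C" if p: "p \<in> ?H" for p
  proof -
    have com: "p (Suc (2 * j)) = partner N (p (2 * j))" if "j < N" for j
      using p that by (metis (mono_tags, lifting) mem_Collect_eq pair_perms_def partner_even)
    have lt: "p (2 * j) < 2 * N" if "j < N" for j using pair_perms_less[OF p] that by simp
    have "(\<Prod>j<N. A (p (2 * j)) (p (Suc (2 * j)))) = (\<Prod>j<N. (if even (p (2 * j)) then 1 else - 1) * r (p (2 * j) div 2))"
      by (rule prod.cong) (auto simp: com Aa lt)
    also have "\<dots> = (\<Prod>j<N. (if even (p (2 * j)) then 1 else - 1)) * (\<Prod>j<N. r (p (2 * j) div 2))"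
      by (rule prod.distrib)
    also have "(\<Prod>j<N. r (p (2 * j) div 2)) = C"
    proof -
      have inj: "inj_on (\<lambda>j. p (2 * j) div 2) {..<N}"
      proof (rule inj_onI)
        fix i j assume ij: "i \<in> {..<N}" "j \<in> {..<N}" "p (2 * i) div 2 = p (2 * j) div 2"
        have "p (2 * i) = p (2 * j) \<or> p (2 * i) = partner N (p (2 * j))"
          using ij(3) lt[of j] ij(2) unfolding partner_def by (auto, presburger+)
        hence "p (2 * i) = p (2 * j) \<or> p (2 * i) = p (Suc (2 * j))" using com ij(2) by simp
        moreover have "inj p" using p permutes_inj by (auto simp: pair_perms_def)
        ultimately have "2 * i = 2 * j \<or> 2 * i = Suc (2 * j)" by (metis injD)
        thus "i = j" by presburger
      qed
      have "bij_betw (\<lambda>j. p (2 * j) div 2) {..<N} {..<N}"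
      proof -
        have "p (2 * j) div 2 < N" if "j < N" for j using lt[OF that] by linarith
        hence "(\<lambda>j. p (2 * j) div 2) ` {..<N} \<subseteq> {..<N}" by auto
        thus ?thesis unfolding bij_betw_def using inj by (simp add: endo_inj_surj)
      qed
      thus ?thesis unfolding C_def by (rule prod.reindex_bij_betw)
    qed
    finally show ?thesis using sign_pair_perm[OF p, where 'a = complex] by (simp add: mult.assoc[symmetric])
  qed
  \<comment> \<open>A permutation that respects all pairs but one respects that one as well,
      so some factor of A vanishes.\<close>
  have outside: "(\<Prod>j<N. (if j = m then B else A) (p (2 * j)) (p (Suc (2 * j)))) = 0"
    if p: "p \<in> ?P - ?H" and m: "m < N" for p m and B :: "nat \<Rightarrow> nat \<Rightarrow> complex"
  proof -
    have pp: "p permutes {..<2 * N}" using p by simp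
    have lt: "p i < 2 * N" if "i < 2 * N" for i using permutes_in_image[OF pp, of i] that by simp
    have "\<exists>j<N. j \<noteq> m \<and> p (Suc (2 * j)) \<noteq> partner N (p (2 * j))"
    proof (rule ccontr)
      assume "\<not> ?thesis"
      hence other: "p (Suc (2 * j)) = partner N (p (2 * j))" if "j < N" "j \<noteq> m" for j using that by blast
      have inj: "inj p" using pp by (rule permutes_inj)
      obtain i where i: "i < 2 * N" "p i = partner N (p (2 * m))"
      proof -
        have "partner N (p (2 * m)) \<in> p ` {..<2 * N}" using permutes_image[OF pp] lt[of "2 * m"] m by simp
        thus ?thesis using that by auto
      qed
      have "i = Suc (2 * m)"
      proof (cases rule: less_double_cases[OF i(1)])
        case (1 j)
        show ?thesis
        proof (cases "j = m")
          case True
          with i 1 have "p (2 * m) = partner N (p (2 * m))" by simp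
          moreover have "even (p (2 * m)) \<noteq> even (partner N (p (2 * m)))" using lt[of "2 * m"] m by simp
          ultimately show ?thesis by metis
        next
          case False
          hence "p (Suc (2 * j)) = p (2 * m)" using other[of j] 1 i by simp
          hence "Suc (2 * j) = 2 * m" using inj by (metis injD)
          thus ?thesis by presburger
        qed
      next
        case (2 j)
        show ?thesis
        proof (cases "j = m")
          case False
          hence "partner N (p (2 * j)) = partner N (p (2 * m))" using other[of j] 2 i by simp
          hence "p (2 * j) = p (2 * m)" by (metis partner_partner)
          hence "2 * j = 2 * m" using inj by (metis injD)
          thus ?thesis using False by simp
        qed (use 2 in simp)
      qed
      hence "p (Suc (2 * j)) = partner N (p (2 * j))" if "j < N" for j using other[of j] i that by (cases "j = m") auto
      hence "p \<in> ?H" by (intro pair_permsI pp)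
      thus False using p by simp
    qed
    then obtain j where j: "j < N" "j \<noteq> m" "p (Suc (2 * j)) \<noteq> partner N (p (2 * j))" by blast
    have "A (p (2 * j)) (p (Suc (2 * j))) = 0" using j lt by (intro A0) auto
    thus ?thesis using j by (intro prod_zero) (auto intro!: bexI[of _ j])
  qed
  have SA: "(\<Sum>p\<in>?P. of_int (sign p) * (\<Prod>j<N. A (p (2 * j)) (p (Suc (2 * j))))) = of_nat (card ?H) * C" if "N > 0"
  proof -
    have "(\<Sum>p\<in>?P. of_int (sign p) * (\<Prod>j<N. A (p (2 * j)) (p (Suc (2 * j)))))
        = (\<Sum>p\<in>?H. of_int (sign p) * (\<Prod>j<N. A (p (2 * j)) (p (Suc (2 * j)))))"
      by (rule sum.mono_neutral_right[OF finP HP]) (use outside[of _ 0 A] that in auto)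
    also have "\<dots> = (\<Sum>p\<in>?H. C)" by (rule sum.cong) (auto simp: PA)
    finally show ?thesis by simp
  qed
  have SB: "(\<Sum>p\<in>?P. of_int (sign p) * (\<Prod>j<N. (if j = m then B else A) (p (2 * j)) (p (Suc (2 * j)))))
      = (\<Sum>p\<in>?H. C * \<beta> (p (2 * m)))" if m: "m < N" for m
  proof -
    have "(\<Sum>p\<in>?P. of_int (sign p) * (\<Prod>j<N. (if j = m then B else A) (p (2 * j)) (p (Suc (2 * j)))))
        = (\<Sum>p\<in>?H. of_int (sign p) * (\<Prod>j<N. (if j = m then B else A) (p (2 * j)) (p (Suc (2 * j)))))"
      by (rule sum.mono_neutral_right[OF finP HP]) (use outside[OF _ m, of _ B] in auto)
    also have "\<dots> = (\<Sum>p\<in>?H. C * \<beta> (p (2 * m)))"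
    proof (rule sum.cong[OF refl])
      fix p assume p: "p \<in> ?H"
      have com: "p (Suc (2 * m)) = partner N (p (2 * m))"
        using p m by (metis (mono_tags, lifting) mem_Collect_eq pair_perms_def partner_even)
      have lt: "p (2 * m) < 2 * N" using pair_perms_less[OF p] m by simp
      have "(\<Prod>j<N. (if j = m then B else A) (p (2 * j)) (p (Suc (2 * j))))
         = (\<Prod>j<N. (if j = m then \<beta> (p (2 * m)) else 1) * A (p (2 * j)) (p (Suc (2 * j))))"
        by (rule prod.cong) (use Anz[OF lt] in \<open>auto simp: \<beta>_def com\<close>)
      also have "\<dots> = \<beta> (p (2 * m)) * (\<Prod>j<N. A (p (2 * j)) (p (Suc (2 * j))))"
        using m by (simp add: prod.distrib)
      finally show "of_int (sign p) * (\<Prod>j<N. (if j = m then B else A) (p (2 * j)) (p (Suc (2 * j)))) = C * \<beta> (p (2 * m))"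
        using PA[OF p] by (simp add: mult_ac)
    qed
    finally show ?thesis .
  qed
  have swap: "(\<Sum>p\<in>?H. \<Sum>m<N. \<beta> (p (Suc (2 * m)))) = (\<Sum>p\<in>?H. \<Sum>m<N. \<beta> (p (2 * m)))"
  proof (rule sum.reindex_bij_witness[of _ "\<lambda>p. p \<circ> partner N" "\<lambda>p. p \<circ> partner N"])
    show "p \<circ> partner N \<in> ?H" if "p \<in> ?H" for p
      using that permutes_compose[OF partner_permutes] by (auto simp: pair_perms_def)
    show "p \<circ> partner N \<in> ?H" if "p \<in> ?H" for p
      using that permutes_compose[OF partner_permutes] by (auto simp: pair_perms_def)
  qed (auto simp: comp_def intro!: sum.cong)
  have tot: "(\<Sum>m<N. \<beta> (p (2 * m)) + \<beta> (p (Suc (2 * m)))) = (\<Sum>k<N. (B (2 * k) (Suc (2 * k)) - B (Suc (2 * k)) (2 * k)) / r k)"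
    if p: "p \<in> ?H" for p
  proof -
    have double: "(\<Sum>i<2 * n. f i) = (\<Sum>j<n. f (2 * j) + f (Suc (2 * j)))" for f :: "nat \<Rightarrow> complex" and n
      by (induction n) (simp_all add: add_ac)
    have "(\<Sum>m<N. \<beta> (p (2 * m)) + \<beta> (p (Suc (2 * m)))) = (\<Sum>i<2 * N. \<beta> (p i))" by (simp add: double)
    also have "\<dots> = (\<Sum>i<2 * N. \<beta> i)"
      using p by (intro sum.reindex_bij_betw permutes_imp_bij) (simp add: pair_perms_def)
    also have "\<dots> = (\<Sum>k<N. (B (2 * k) (Suc (2 * k)) - B (Suc (2 * k)) (2 * k)) / r k)"
      unfolding double by (rule sum.cong) (auto simp: \<beta>_def A1 A2 diff_divide_distrib)
    finally show ?thesis .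
  qed
  show ?thesis
  proof (cases "N = 0")
    case False
    have "(\<Sum>m<N. \<Sum>p\<in>?P. of_int (sign p) * (\<Prod>j<N. (if j = m then B else A) (p (2 * j)) (p (Suc (2 * j)))))
       = C * (\<Sum>p\<in>?H. \<Sum>m<N. \<beta> (p (2 * m)))"
      using SB by (simp add: sum_distrib_left sum.swap[of _ ?H])
    also have "2 * \<dots> = C * (\<Sum>p\<in>?H. \<Sum>m<N. \<beta> (p (2 * m)) + \<beta> (p (Suc (2 * m))))"
      using swap by (simp add: sum.distrib algebra_simps)
    also have "\<dots> = C * (of_nat (card ?H) * (\<Sum>k<N. (B (2 * k) (Suc (2 * k)) - B (Suc (2 * k)) (2 * k)) / r k))"
      using tot by simp
    finally show ?thesis using SA False by (simp add: mult_ac)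
  qed simp
qed

section \<open>The one-point function as a finite sum\<close>

lemma continuous_compact_support_integrable:
  fixes h :: "complex \<Rightarrow> real"
  assumes "continuous_on UNIV h" "compact K" "\<And>w. w \<notin> K \<Longrightarrow> h w = 0"
  shows "integrable lborel h"
proof -
  have "integrable lborel (\<lambda>x. indicator K x *\<^sub>R h x)"
    using assms by (intro borel_integrable_compact) (auto intro: continuous_on_subset)
  also have "(\<lambda>x. indicator K x *\<^sub>R h x) = h"
    using assms(3) by (auto simp: indicator_def fun_eq_iff)
  finally show ?thesis .
qed

text \<open>
  Test with the difference itself, cut off by a tent function: its square then integrates to
  zero against the tent.
\<close>

lemma continuous_eq_if_test_integrals_eq:
  fixes R \<rho> :: "complex \<Rightarrow> real"
  assumes R: "continuous_on UNIV R" and \<rho>: "continuous_on UNIV \<rho>"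
    and eq: "\<And>f :: complex \<Rightarrow> real. continuous_on UNIV f \<Longrightarrow> (\<exists>K. compact K \<and> (\<forall>w. w \<notin> K \<longrightarrow> f w = 0)) \<Longrightarrow>
       (\<integral>w. f w * R w \<partial>lborel) = (\<integral>w. f w * \<rho> w \<partial>lborel)"
  shows "R z = \<rho> z"
proof (rule ccontr)
  assume ne: "R z \<noteq> \<rho> z"
  define f where "f = (\<lambda>w. max 0 (1 - dist w z) * (R w - \<rho> w))"
  have f: "continuous_on UNIV f" unfolding f_def by (intro continuous_intros R \<rho>)
  have f0: "f w = 0" if "w \<notin> cball z 1" for w
    using that by (simp add: f_def dist_commute)
  have cpt: "\<exists>K. compact K \<and> (\<forall>w. w \<notin> K \<longrightarrow> f w = 0)"
    by (intro exI[of _ "cball z 1"]) (use f0 in auto)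
  have i1: "integrable lborel (\<lambda>w. f w * R w)" and i2: "integrable lborel (\<lambda>w. f w * \<rho> w)"
    by (rule continuous_compact_support_integrable[of _ "cball z 1"];
        use f0 f R \<rho> in \<open>auto intro!: continuous_intros\<close>)+
  define h where "h = (\<lambda>w. f w * R w - f w * \<rho> w)"
  have h: "continuous_on UNIV h" unfolding h_def by (intro continuous_intros f R \<rho>)
  have hsq: "h w = max 0 (1 - dist w z) * (R w - \<rho> w)\<^sup>2" for w
    by (simp add: h_def f_def power2_eq_square algebra_simps)
  have h0: "h w \<ge> 0" for w unfolding hsq by simp
  have ih: "integrable lborel h" unfolding h_def by (intro Bochner_Integration.integrable_diff i1 i2)
  have "(\<integral>w. h w \<partial>lborel) = 0"
    unfolding h_def using eq[OF f cpt] by (simp add: Bochner_Integration.integral_diff[OF i1 i2])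
  hence "AE w in lborel. h w = 0"
    using integral_nonneg_eq_0_iff_AE[OF ih] h0 by simp
  define U where "U = {w. h w \<noteq> 0}"
  have U: "open U" unfolding U_def
    using h by (auto intro!: open_Collect_neq)
  have "U \<in> null_sets lborel"
    using \<open>AE w in lborel. h w = 0\<close> U by (subst AE_iff_null_sets) (auto simp: U_def)
  hence "U \<in> null_sets lebesgue" by (rule null_sets_completionI)
  hence "negligible U" by (simp add: negligible_iff_null_sets)
  hence "U = {}" using open_not_negligible[OF U] by auto
  moreover have "h z \<noteq> 0" unfolding hsq using ne by simp
  ultimately show False by (auto simp: U_def)
qed

context elliptic_weight
begin

lemma cnj_poly_even_skew: "cnj (poly (even_skew k) z) = poly (even_skew k) (cnj z)"
  by (induction k) (simp_all add: cnj_poly_herm)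

definition skew_basis :: "nat \<Rightarrow> complex poly" where
  "skew_basis j = (if even j then even_skew (j div 2) else herm j)"

lemma skew_basis_simps [simp]:
  "skew_basis (2 * k) = even_skew k" "skew_basis (Suc (2 * k)) = herm (Suc (2 * k))"
  by (simp_all add: skew_basis_def)

lemma skew_basis_monic: "degree (skew_basis j) = j" "lead_coeff (skew_basis j) = 1"
proof -
  have "degree (skew_basis j) = j \<and> lead_coeff (skew_basis j) = 1"
    using degree_even_skew[of "j div 2"] degree_herm_lead[of j] unfolding skew_basis_def by (cases "even j") auto
  thus "degree (skew_basis j) = j" "lead_coeff (skew_basis j) = 1" by auto
qed

text \<open>
  Conjugation exchanges the two factors and changes the sign of $z-\bar z$.
\<close>

lemma skew_swap:
  assumes "\<And>z. cnj (poly p z) = poly p (cnj z)" "\<And>z. cnj (poly q z) = poly q (cnj z)"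
  shows "skew q p = - cnj (skew p q)"
proof -
  have "skew q p = (\<integral>z. - cnj ((z - cnj z) * of_real (weight z) * (poly p z * poly q (cnj z))) \<partial>lborel)"
  proof -
    have "(z - cnj z) * of_real (weight z) * (poly q z * poly p (cnj z)) =
        - cnj ((z - cnj z) * of_real (weight z) * (poly p z * poly q (cnj z)))" for z
      by (simp add: assms(1)[symmetric]) (simp add: assms(2) algebra_simps)
    thus ?thesis unfolding skew_def by simp
  qed
  also have "\<dots> = - (\<integral>z. cnj ((z - cnj z) * of_real (weight z) * (poly p z * poly q (cnj z))) \<partial>lborel)"
    by (rule Bochner_Integration.integral_minus)
  also have "(\<integral>z. cnj ((z - cnj z) * of_real (weight z) * (poly p z * poly q (cnj z))) \<partial>lborel) = cnj (skew p q)"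
    unfolding skew_def
    by (rule integral_bounded_linear[OF bounded_linear_cnj integrable_weight_polys[of _ 2]])
       (auto intro!: borel_measurable_continuous_onI continuous_intros
         intro: order_trans[OF norm_triangle_ineq4])
  finally show ?thesis .
qed

lemma skew_norm_pos: "skew_norm j > 0"
  unfolding skew_norm_def using tau_less_1 norm_sq_pos by simp

lemma skew_herm_even_even: "skew (herm (2 * j)) (herm (2 * k)) = 0"
proof -
  have "2 * k \<noteq> Suc (2 * j)" "2 * j \<noteq> Suc (2 * k)" by presburger+
  thus ?thesis unfolding skew_herm by simp
qed

lemma skew_even_skew_even: "skew (even_skew j) (even_skew k) = 0"
proof -
  have 1: "skew (even_skew j) (herm (2 * k)) = 0" for k
  proof (induction j)
    case 0
    show ?case using skew_herm_even_even[of 0 k] by simp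
  next
    case (Suc j)
    show ?case unfolding even_skew.simps skew_add_left skew_smult_left Suc skew_herm_even_even by simp
  qed
  show ?thesis
  proof (induction k)
    case 0
    show ?case using 1[of 0] by simp
  next
    case (Suc k)
    show ?case unfolding even_skew.simps skew_add_right skew_smult_right Suc 1 by simp
  qed
qed

lemma skew_skew_basis:
  "skew (skew_basis (2 * k)) (skew_basis (Suc (2 * k))) = of_real (skew_norm (2 * k))"
  "skew (skew_basis (Suc (2 * k))) (skew_basis (2 * k)) = - of_real (skew_norm (2 * k))"
  "i < 2 * N \<Longrightarrow> j < 2 * N \<Longrightarrow> j \<noteq> partner N i \<Longrightarrow> skew (skew_basis i) (skew_basis j) = 0"
proof -
  have eo: "skew (even_skew k) (herm (Suc (2 * l))) = (if k = l then of_real (skew_norm (2 * k)) else 0)" for k l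
    using skew_even_skew_odd[of k l] by simp
  have oe: "skew (herm (Suc (2 * l))) (even_skew k) = (if k = l then - of_real (skew_norm (2 * k)) else 0)" for k l
    using eo[of k l] by (subst skew_swap) (auto simp: cnj_poly_even_skew cnj_poly_herm)
  have oo: "skew (herm (Suc (2 * k))) (herm (Suc (2 * l))) = 0" for k l
  proof -
    have "Suc (2 * l) \<noteq> Suc (Suc (2 * k))" "Suc (2 * k) \<noteq> Suc (Suc (2 * l))" by presburger+
    thus ?thesis unfolding skew_herm by simp
  qed
  show "skew (skew_basis (2 * k)) (skew_basis (Suc (2 * k))) = of_real (skew_norm (2 * k))"
    "skew (skew_basis (Suc (2 * k))) (skew_basis (2 * k)) = - of_real (skew_norm (2 * k))"
    by (simp_all only: skew_basis_simps eo oe if_True refl)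
  show "skew (skew_basis i) (skew_basis j) = 0" if "i < 2 * N" "j < 2 * N" "j \<noteq> partner N i"
    using that(1)
  proof (cases rule: less_double_cases)
    case (1 a)
    show ?thesis using that(2)
    proof (cases rule: less_double_cases)
      case (1 b)
      thus ?thesis using \<open>i = 2 * a\<close> by (simp only: skew_basis_simps skew_even_skew_even)
    next
      case (2 b)
      thus ?thesis using \<open>i = 2 * a\<close> \<open>a < N\<close> that(3) by (simp only: skew_basis_simps eo) auto
    qed
  next
    case (2 a)
    show ?thesis using that(2)
    proof (cases rule: less_double_cases)
      case (1 b)
      thus ?thesis using \<open>i = Suc (2 * a)\<close> \<open>a < N\<close> that(3) by (simp only: skew_basis_simps oe) auto
    next
      case (2 b)
      thus ?thesis using \<open>i = Suc (2 * a)\<close> by (simp only: skew_basis_simps oo)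
    qed
  qed
qed

text \<open>
  The function of one eigenvalue that a pair of rows of the determinant contributes; its
  integral is the skew product.
\<close>

definition pair_density :: "nat \<Rightarrow> nat \<Rightarrow> complex \<Rightarrow> complex" where
  "pair_density a b z = (z - cnj z) * of_real (weight z) * (poly (skew_basis a) z * poly (skew_basis b) (cnj z))"

lemma integrable_pair_density: "integrable lborel (pair_density a b)"
  unfolding pair_density_def
  by (rule integrable_weight_polys[of _ 2])
     (auto intro!: borel_measurable_continuous_onI continuous_intros
         intro: order_trans[OF norm_triangle_ineq4])

lemma integrable_test_pair_density:
  assumes f: "continuous_on UNIV f" and B: "\<And>w. \<bar>f w\<bar> \<le> B"
  shows "integrable lborel (\<lambda>z. of_real (f z) * pair_density a b z)"
proof (rule Bochner_Integration.integrable_bound)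
  show "integrable lborel (\<lambda>z. of_real B * pair_density a b z)"
    by (intro integrable_mult_right integrable_pair_density)
  have "continuous_on UNIV (\<lambda>z. of_real (f z) * pair_density a b z)"
    unfolding pair_density_def by (intro continuous_intros f)
  thus "(\<lambda>z. of_real (f z) * pair_density a b z) \<in> borel_measurable lborel"
    by (simp add: borel_measurable_continuous_onI)
  have "norm (of_real (f z) * pair_density a b z) \<le> norm (of_real B * pair_density a b z)" for z
    unfolding norm_mult using order_trans[OF B abs_ge_self] by (intro mult_right_mono) auto
  thus "AE z in lborel. norm (of_real (f z) * pair_density a b z) \<le> norm (of_real B * pair_density a b z)"
    by simp
qed

text \<open>
  The factor $|z_j-\bar z_j|^2$ of the density splits as $(\bar z_j-z_j)(z_j-\bar z_j)$: one
  half completes the Vandermonde determinant, the other half goes to the skew weight.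
\<close>

lemma eGinSE_weight_expansion:
  assumes n: "n = 2 * real N"
  shows "of_real (eGinSE_weight \<tau> N z) =
     (\<Sum>p | p permutes {..<2 * N}. of_int (sign p) *
        (\<Prod>j<N. pair_density (p (2 * j)) (p (Suc (2 * j))) (z j)))"
proof -
  let ?A = "mat (2 * N) (2 * N) (\<lambda>(i, j). poly (skew_basis j) (pairing z i))"
  have "det ?A = (\<Prod>k<2 * N. \<Prod>j<k. pairing z k - pairing z j)"
    by (rule det_monic_polys) (rule skew_basis_monic)+
  also have "\<dots> = of_real (\<Prod>k<N. \<Prod>j<k. (cmod (z j - z k))\<^sup>2 * (cmod (z j - cnj (z k)))\<^sup>2) * (\<Prod>j<N. cnj (z j) - z j)"
    by (rule prod_differences_pairing)
  finally have det: "det ?A = \<dots>" .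
  have "of_real (eGinSE_weight \<tau> N z) = det ?A * (\<Prod>j<N. (z j - cnj (z j)) * of_real (weight (z j)))"
  proof -
    have w: "complex_of_real ((cmod (z j - cnj (z j)))\<^sup>2 * exp (- 2 * real N * eGinSE_V \<tau> (z j)))
       = (cnj (z j) - z j) * ((z j - cnj (z j)) * of_real (weight (z j)))" for j
    proof -
      have "weight (z j) = exp (- 2 * real N * eGinSE_V \<tau> (z j))" unfolding weight_def unfolding n by simp
      thus ?thesis unfolding of_real_mult complex_norm_square by (simp add: algebra_simps)
    qed
    have "complex_of_real (\<Prod>j<N. (cmod (z j - cnj (z j)))\<^sup>2 * exp (- 2 * real N * eGinSE_V \<tau> (z j)))
       = (\<Prod>j<N. (cnj (z j) - z j) * ((z j - cnj (z j)) * of_real (weight (z j))))"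
      unfolding of_real_prod by (rule prod.cong[OF refl w])
    thus ?thesis
      unfolding det eGinSE_weight_def of_real_mult[of "\<Prod>k<N. _ k"] by (simp only: prod.distrib mult_ac)
  qed
  also have "det ?A = (\<Sum>p | p permutes {..<2 * N}. of_int (sign p) *
       (\<Prod>j<N. poly (skew_basis (p (2 * j))) (z j) * poly (skew_basis (p (Suc (2 * j)))) (cnj (z j))))"
  proof -
    have e: "(\<Prod>i<2 * N. ?A $$ (i, p i)) = (\<Prod>j<N. poly (skew_basis (p (2 * j))) (z j) * poly (skew_basis (p (Suc (2 * j)))) (cnj (z j)))"
      if p: "p permutes {..<2 * N}" for p
    proof -
      have lt: "p i < 2 * N" if "i < 2 * N" for i using permutes_in_image[OF p, of i] that by simp
      have "(\<Prod>i<2 * N. ?A $$ (i, p i)) = (\<Prod>i<2 * N. poly (skew_basis (p i)) (pairing z i))"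
        by (rule prod.cong) (auto simp: lt)
      thus ?thesis by (simp add: prod_lessThan_double)
    qed
    show ?thesis
      by (subst det_def'[of _ "2 * N"], simp, unfold atLeast0LessThan,
          rule sum.cong[OF refl], simp only: mem_Collect_eq e)
  qed
  also have "\<dots> * (\<Prod>j<N. (z j - cnj (z j)) * of_real (weight (z j))) =
     (\<Sum>p | p permutes {..<2 * N}. of_int (sign p) * (\<Prod>j<N. pair_density (p (2 * j)) (p (Suc (2 * j))) (z j)))"
    unfolding sum_distrib_right
    by (intro sum.cong refl) (simp only: pair_density_def prod.distrib mult_ac)
  finally show ?thesis .
qed

text \<open>
  The diagonal $(z-\bar z)e^{-nV(z)}\kappa_N(z,\bar z)$ of the Pfaffian kernel, with the
  conjugate pairs of terms combined into imaginary parts.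
\<close>

definition density_sum :: "nat \<Rightarrow> complex \<Rightarrow> real" where
  "density_sum N w = 2 * Im w * weight w *
     (\<Sum>k<N. Im (poly (herm (Suc (2 * k))) w * cnj (poly (even_skew k) w)) / skew_norm (2 * k))"

lemma density_sum_eq:
  "2 * complex_of_real (density_sum N w) =
     (\<Sum>k<N. (pair_density (2 * k) (Suc (2 * k)) w - pair_density (Suc (2 * k)) (2 * k) w) / of_real (skew_norm (2 * k)))"
proof -
  have "pair_density (2 * k) (Suc (2 * k)) w - pair_density (Suc (2 * k)) (2 * k) w
     = of_real (2 * (2 * Im w * weight w) * Im (poly (herm (Suc (2 * k))) w * cnj (poly (even_skew k) w)))" for k
    unfolding pair_density_def skew_basis_simps cnj_poly_even_skew[symmetric] cnj_poly_herm[symmetric]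
    by (simp add: complex_eq_iff algebra_simps)
  thus ?thesis unfolding density_sum_def of_real_mult of_real_sum sum_distrib_left
    by (intro sum.cong) (auto simp: mult_ac)
qed

lemma continuous_on_density_sum: "continuous_on A (density_sum N)"
  unfolding density_sum_def using skew_norm_pos less_imp_neq by (intro continuous_intros) fastforce+

text \<open>
  Both sides are continuous, so it suffices to integrate them against test functions. The
  expectation of $\sum_j f(z_j)$ under the joint density is a sum over permutations with one
  factor perturbed by $f$, to which the permutation identity applies; the unknown
  normalising constant is eliminated by the total mass.
\<close>

theorem one_point_function_eq:
  fixes M :: "'w measure" and Z :: "'w \<Rightarrow> nat \<Rightarrow> complex"
  assumes n: "n = 2 * real N"
    and E: "eGinSE \<tau> N M g Z" and R: "one_point_function N M Z R"
  shows "R w = density_sum N w"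
proof (rule continuous_eq_if_test_integrals_eq)
  show "continuous_on UNIV R" using R by (simp add: one_point_function_def)
  show "continuous_on UNIV (density_sum N)" by (rule continuous_on_density_sum)
  fix f :: "complex \<Rightarrow> real"
  assume f: "continuous_on UNIV f" and cpt: "\<exists>K. compact K \<and> (\<forall>w. w \<notin> K \<longrightarrow> f w = 0)"
  then obtain K where K: "compact K" "\<And>w. w \<notin> K \<Longrightarrow> f w = 0" by blast
  have "bounded (f ` K)" using K(1) f by (intro compact_imp_bounded compact_continuous_image) (auto intro: continuous_on_subset)
  then obtain B0 where B0: "\<And>w. w \<in> K \<Longrightarrow> \<bar>f w\<bar> \<le> B0" by (auto simp: bounded_iff)
  have B: "\<bar>f w\<bar> \<le> max B0 0" for w using B0[of w] K(2)[of w] by (cases "w \<in> K") auto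
  obtain c where c: "c > 0" and D: "distributed M (Pi\<^sub>M {..<N} (\<lambda>_. lborel)) (\<lambda>\<omega>. \<lambda>j\<in>{..<N}. Z \<omega> j)
          (\<lambda>x. ennreal (c * eGinSE_weight \<tau> N x))"
    using E by (auto simp: eGinSE_def)
  interpret prob_space M using E by (simp add: eGinSE_def)
  interpret product_sigma_finite "\<lambda>_::nat. lborel :: complex measure" by standard
  let ?PM = "Pi\<^sub>M {..<N} (\<lambda>_. lborel :: complex measure)"
  have Wnn: "eGinSE_weight \<tau> N x \<ge> 0" for x
    unfolding eGinSE_weight_def by (intro mult_nonneg_nonneg prod_nonneg) auto
  define A where "A = (\<lambda>a b. skew (skew_basis a) (skew_basis b))"
  define C where "C = (\<lambda>a b. \<integral>z. of_real (f z) * pair_density a b z \<partial>lborel)"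
  have A: "A a b = (\<integral>z. pair_density a b z \<partial>lborel)" for a b
    by (simp add: A_def skew_def pair_density_def)
  \<comment> \<open>The index m = N perturbs no factor, so the total mass and the N test
      integrals are treated together.\<close>
  define h where "h = (\<lambda>(m :: nat) a b (j :: nat) z. (if j = m then of_real (f z) else 1) * pair_density a b z)"
  have ih: "integrable lborel (h m a b j)" for m a b and j :: nat
    unfolding h_def using integrable_test_pair_density[OF f B] integrable_pair_density by (cases "j = m") auto
  have Ih: "(\<integral>z. h m a b j z \<partial>lborel) = (if j = m then C else A) a b" for m a b and j :: nat
    unfolding h_def by (simp add: A C_def)
  have prodh: "of_real (if m < N then f (x m) else 1) * of_real (eGinSE_weight \<tau> N x)
      = (\<Sum>p | p permutes {..<2 * N}. of_int (sign p) * (\<Prod>j<N. h m (p (2 * j)) (p (Suc (2 * j))) j (x j)))" for m x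
  proof -
    have "(\<Prod>j<N. h m (p (2 * j)) (p (Suc (2 * j))) j (x j)) =
       of_real (if m < N then f (x m) else 1) * (\<Prod>j<N. pair_density (p (2 * j)) (p (Suc (2 * j))) (x j))" for p
      unfolding h_def prod.distrib by (simp add: prod.delta)
    thus ?thesis unfolding eGinSE_weight_expansion[OF n] sum_distrib_left by (intro sum.cong) (auto simp: mult_ac)
  qed
  have int: "integrable ?PM (\<lambda>x. complex_of_real (if m < N then f (x m) else 1) * of_real (eGinSE_weight \<tau> N x))"
    and Int: "(\<integral>x. complex_of_real (if m < N then f (x m) else 1) * of_real (eGinSE_weight \<tau> N x) \<partial>?PM)
      = (\<Sum>p | p permutes {..<2 * N}. of_int (sign p) * (\<Prod>j<N. (if j = m then C else A) (p (2 * j)) (p (Suc (2 * j)))))" for m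
  proof -
    have i: "integrable ?PM (\<lambda>x. \<Prod>j<N. h m (p (2 * j)) (p (Suc (2 * j))) j (x j))" for p
      by (rule product_integrable_prod) (auto intro: ih)
    show "integrable ?PM (\<lambda>x. complex_of_real (if m < N then f (x m) else 1) * of_real (eGinSE_weight \<tau> N x))"
      unfolding prodh by (intro Bochner_Integration.integrable_sum integrable_mult_right i)
    have "(\<integral>x. complex_of_real (if m < N then f (x m) else 1) * of_real (eGinSE_weight \<tau> N x) \<partial>?PM)
      = (\<Sum>p | p permutes {..<2 * N}. of_int (sign p) * (\<integral>x. (\<Prod>j<N. h m (p (2 * j)) (p (Suc (2 * j))) j (x j)) \<partial>?PM))"
      unfolding prodh by (subst Bochner_Integration.integral_sum, intro integrable_mult_right i) simp
    also have "\<dots> = (\<Sum>p | p permutes {..<2 * N}. of_int (sign p) * (\<Prod>j<N. (if j = m then C else A) (p (2 * j)) (p (Suc (2 * j)))))"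
      by (subst product_integral_prod) (auto intro: ih simp: Ih)
    finally show "(\<integral>x. complex_of_real (if m < N then f (x m) else 1) * of_real (eGinSE_weight \<tau> N x) \<partial>?PM)
      = (\<Sum>p | p permutes {..<2 * N}. of_int (sign p) * (\<Prod>j<N. (if j = m then C else A) (p (2 * j)) (p (Suc (2 * j)))))" .
  qed
  have Exp: "complex_of_real (\<integral>\<omega>. (if m < N then f (Z \<omega> m) else 1) \<partial>M)
      = of_real c * (\<Sum>p | p permutes {..<2 * N}. of_int (sign p) * (\<Prod>j<N. (if j = m then C else A) (p (2 * j)) (p (Suc (2 * j)))))"
    and iZ: "integrable M (\<lambda>\<omega>. if m < N then f (Z \<omega> m) else 1)" for m
  proof -
    have [measurable]: "f \<in> borel_measurable borel" using f by (rule borel_measurable_continuous_onI)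
    have meas: "(\<lambda>x. if m < N then f (x m) else 1) \<in> borel_measurable ?PM"
    proof (cases "m < N")
      case True
      have "(\<lambda>x. x m) \<in> measurable ?PM (lborel :: complex measure)"
        using True by (intro measurable_component_singleton) simp
      thus ?thesis using True by (simp add: measurable_compose[of _ _ borel f] comp_def)
    qed simp
    have e: "(\<lambda>\<omega>. if m < N then f ((\<lambda>j\<in>{..<N}. Z \<omega> j) m) else 1) = (\<lambda>\<omega>. if m < N then f (Z \<omega> m) else 1)"
      by auto
    have r: "integrable ?PM (\<lambda>x. c * eGinSE_weight \<tau> N x * (if m < N then f (x m) else 1))"
    proof -
      have "integrable ?PM (\<lambda>x. c * Re (complex_of_real (if m < N then f (x m) else 1) * of_real (eGinSE_weight \<tau> N x)))"
        using int[of m] by (intro integrable_mult_right integrable_Re)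
      also have "(\<lambda>x. c * Re (complex_of_real (if m < N then f (x m) else 1) * of_real (eGinSE_weight \<tau> N x)))
         = (\<lambda>x. c * eGinSE_weight \<tau> N x * (if m < N then f (x m) else 1))" by auto
      finally show ?thesis .
    qed
    show "integrable M (\<lambda>\<omega>. if m < N then f (Z \<omega> m) else 1)"
      using distributed_integrable[OF D meas] r c Wnn unfolding e by simp
    have "(\<integral>x. c * eGinSE_weight \<tau> N x * (if m < N then f (x m) else 1) \<partial>?PM) = (\<integral>\<omega>. (if m < N then f (Z \<omega> m) else 1) \<partial>M)"
      using distributed_integral[OF D meas] c Wnn unfolding e by simp
    hence "complex_of_real (\<integral>\<omega>. (if m < N then f (Z \<omega> m) else 1) \<partial>M)
       = (\<integral>x. complex_of_real (c * eGinSE_weight \<tau> N x * (if m < N then f (x m) else 1)) \<partial>?PM)"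
      by (metis integral_complex_of_real)
    also have "\<dots> = (\<integral>x. of_real c * (complex_of_real (if m < N then f (x m) else 1) * of_real (eGinSE_weight \<tau> N x)) \<partial>?PM)"
      by (rule Bochner_Integration.integral_cong) auto
    also have "\<dots> = of_real c * (\<integral>x. complex_of_real (if m < N then f (x m) else 1) * of_real (eGinSE_weight \<tau> N x) \<partial>?PM)"
      by (rule integral_mult_right_zero)
    finally show "complex_of_real (\<integral>\<omega>. (if m < N then f (Z \<omega> m) else 1) \<partial>M)
      = of_real c * (\<Sum>p | p permutes {..<2 * N}. of_int (sign p) * (\<Prod>j<N. (if j = m then C else A) (p (2 * j)) (p (Suc (2 * j)))))"
      unfolding Int .
  qed
  have one: "of_real c * (\<Sum>p | p permutes {..<2 * N}. of_int (sign p) * (\<Prod>j<N. A (p (2 * j)) (p (Suc (2 * j))))) = (1 :: complex)"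
  proof -
    have "(\<Prod>j<N. (if j = N then C else A) (p (2 * j)) (p (Suc (2 * j)))) = (\<Prod>j<N. A (p (2 * j)) (p (Suc (2 * j))))" for p
      by (rule prod.cong) auto
    thus ?thesis using Exp[of N] by (simp add: prob_space)
  qed
  have key: "2 * (\<Sum>m<N. \<Sum>p | p permutes {..<2 * N}. of_int (sign p) *
            (\<Prod>j<N. (if j = m then C else A) (p (2 * j)) (p (Suc (2 * j)))))
       = (\<Sum>p | p permutes {..<2 * N}. of_int (sign p) * (\<Prod>j<N. A (p (2 * j)) (p (Suc (2 * j)))))
         * (\<Sum>k<N. (C (2 * k) (Suc (2 * k)) - C (Suc (2 * k)) (2 * k)) / of_real (skew_norm (2 * k)))"
    by (rule sum_skew_permutations)
       (use skew_norm_pos in \<open>auto simp: A_def skew_skew_basis less_imp_neq[symmetric] simp del: skew_basis_simps\<close>)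
  have "complex_of_real (\<integral>\<omega>. (\<Sum>j<N. f (Z \<omega> j)) \<partial>M) = (\<Sum>m<N. complex_of_real (\<integral>\<omega>. (if m < N then f (Z \<omega> m) else 1) \<partial>M))"
  proof -
    have "(\<integral>\<omega>. (\<Sum>j<N. f (Z \<omega> j)) \<partial>M) = (\<Sum>j<N. \<integral>\<omega>. f (Z \<omega> j) \<partial>M)"
    proof (rule Bochner_Integration.integral_sum)
      fix j assume "j \<in> {..<N}"
      thus "integrable M (\<lambda>\<omega>. f (Z \<omega> j))" using iZ[of j] by simp
    qed
    thus ?thesis by simp
  qed
  also have "\<dots> = of_real c * (\<Sum>m<N. \<Sum>p | p permutes {..<2 * N}. of_int (sign p) *
            (\<Prod>j<N. (if j = m then C else A) (p (2 * j)) (p (Suc (2 * j)))))"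
    unfolding Exp sum_distrib_left ..
  finally have "2 * complex_of_real (\<integral>\<omega>. (\<Sum>j<N. f (Z \<omega> j)) \<partial>M) = of_real c * (2 * (\<Sum>m<N. \<Sum>p | p permutes {..<2 * N}. of_int (sign p) *
            (\<Prod>j<N. (if j = m then C else A) (p (2 * j)) (p (Suc (2 * j))))))"
    by simp
  also have "\<dots> = (\<Sum>k<N. (C (2 * k) (Suc (2 * k)) - C (Suc (2 * k)) (2 * k)) / of_real (skew_norm (2 * k)))"
    unfolding key mult.assoc[symmetric] one by simp
  also have "\<dots> = (\<integral>w. of_real (f w) * (2 * complex_of_real (density_sum N w)) \<partial>lborel)"
  proof -
    note it = integrable_test_pair_density[OF f B]
    have "(\<integral>w. of_real (f w) * (2 * complex_of_real (density_sum N w)) \<partial>lborel) =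
      (\<integral>w. (\<Sum>k<N. (of_real (f w) * pair_density (2 * k) (Suc (2 * k)) w - of_real (f w) * pair_density (Suc (2 * k)) (2 * k) w) / of_real (skew_norm (2 * k))) \<partial>lborel)"
      unfolding density_sum_eq sum_distrib_left by (simp add: right_diff_distrib)
    also have "\<dots> = (\<Sum>k<N. \<integral>w. (of_real (f w) * pair_density (2 * k) (Suc (2 * k)) w - of_real (f w) * pair_density (Suc (2 * k)) (2 * k) w) / of_real (skew_norm (2 * k)) \<partial>lborel)"
      by (intro Bochner_Integration.integral_sum integrable_divide_zero Bochner_Integration.integrable_diff it)
    also have "\<dots> = (\<Sum>k<N. (C (2 * k) (Suc (2 * k)) - C (Suc (2 * k)) (2 * k)) / of_real (skew_norm (2 * k)))"
      unfolding integral_divide_zero Bochner_Integration.integral_diff[OF it it] C_def ..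
    finally show ?thesis ..
  qed
  also have "\<dots> = (\<integral>w. 2 * complex_of_real (f w * density_sum N w) \<partial>lborel)"
    by (rule Bochner_Integration.integral_cong) auto
  also have "\<dots> = 2 * complex_of_real (\<integral>w. f w * density_sum N w \<partial>lborel)"
    unfolding integral_mult_right_zero integral_complex_of_real ..
  finally have "(\<integral>\<omega>. (\<Sum>j<N. f (Z \<omega> j)) \<partial>M) = (\<integral>w. f w * density_sum N w \<partial>lborel)"
    using mult_left_cancel[of "2 :: complex"] of_real_eq_iff by (simp only: mult_cancel_left of_real_eq_iff) simp
  moreover have "(\<integral>\<omega>. (\<Sum>j<N. f (Z \<omega> j)) \<partial>M) = (\<integral>w. f w * R w \<partial>lborel)"
    using R f cpt by (simp add: one_point_function_def)
  ultimately show "(\<integral>w. f w * R w \<partial>lborel) = (\<integral>w. f w * density_sum N w \<partial>lborel)" by simp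
qed

end

section \<open>The Gaussian integral with a complex parameter\<close>

lemma gbinomial_minus_half:
  "((- 1 / 2) gchoose k) * (- 1) ^ k = (fact (2 * k) / (4 ^ k * (fact k)\<^sup>2) :: complex)"
proof (induction k)
  case (Suc k)
  have "((- 1 / 2 :: complex) gchoose Suc k) = ((- 1 / 2) gchoose k) * (- 1 / 2 - of_nat k) / (of_nat k + 1)"
  proof -
    have "of_nat (Suc k) * ((- 1 / 2 :: complex) gchoose Suc k) = ((- 1 / 2) gchoose k) * (- 1 / 2 - of_nat k)"
      using gbinomial_mult_1[of "- 1 / 2 :: complex" k] by (simp add: algebra_simps)
    moreover have "of_nat k + 1 \<noteq> (0 :: complex)" by (metis of_nat_Suc of_nat_eq_0_iff nat.distinct(1) add.commute)
    ultimately show ?thesis by (metis nonzero_eq_divide_eq mult.commute add.commute of_nat_Suc)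
  qed
  hence "((- 1 / 2) gchoose Suc k) * (- 1) ^ Suc k
     = (((- 1 / 2) gchoose k) * (- 1) ^ k) * ((1 / 2 + of_nat k) / (of_nat k + 1) :: complex)"
    by (simp add: field_simps)
  also have "\<dots> = fact (2 * k) / (4 ^ k * (fact k)\<^sup>2) * ((1 / 2 + of_nat k) / (of_nat k + 1))"
    unfolding Suc ..
  also have "\<dots> = fact (2 * Suc k) / (4 ^ Suc k * (fact (Suc k))\<^sup>2)"
  proof -
    have nz: "of_nat k + 1 \<noteq> (0 :: complex)" by (metis of_nat_Suc of_nat_eq_0_iff nat.distinct(1) add.commute)
    have f: "fact (2 * Suc k) = (2 * of_nat k + 2) * (2 * of_nat k + 1) * (fact (2 * k) :: complex)"
      by (simp add: algebra_simps)
    have "fact (Suc k) = (of_nat k + 1) * (fact k :: complex)" by (simp add: algebra_simps)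
    thus ?thesis unfolding f using nz by (simp add: divide_simps power2_eq_square) (simp add: algebra_simps)
  qed
  finally show ?case .
qed simp

lemma csqrt_powr_minus_half:
  assumes "z \<noteq> 0"
  shows "csqrt z * z powr (- 1 / 2) = 1"
proof -
  have "csqrt z = exp (Ln z / 2)" using assms by (simp add: csqrt_exp_Ln)
  thus ?thesis using assms by (simp add: powr_def exp_add[symmetric])
qed

text \<open>
  Expanding $e^{\beta t^2/2}$ turns the integral into the binomial series of
  $(1-\beta)^{-1/2}$, since the Gaussian moments $(2k-1)!!$ divided by $2^kk!$ are its
  coefficients. The series also selects the branch of the root.
\<close>

lemma complex_gaussian_integral_unit:
  fixes \<beta> :: complex
  assumes \<beta>: "norm \<beta> < 1"
  shows "(\<integral>t. exp (- (1 - \<beta>) * of_real (t\<^sup>2) / 2) \<partial>lborel) * csqrt (1 - \<beta>) = of_real (sqrt (2 * pi))"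
proof -
  define c where "c = (\<lambda>k. \<beta> ^ k / (2 ^ k * fact k))"
  define f where "f = (\<lambda>k t. c k * complex_of_real (exp (- (1 / 2) * t\<^sup>2) * t ^ (2 * k)))"
  have int: "integrable lborel (\<lambda>t :: real. exp (- (1 / 2) * t\<^sup>2) * t ^ (2 * k))" for k :: nat
    using integrable_monomial_gaussian(1)[of "1/2" "2 * k"] by simp
  have mom: "(\<integral>t. exp (- (1 / 2) * t\<^sup>2) * t ^ (2 * k) \<partial>lborel) = sqrt (2 * pi) * (fact (2 * k) / (2 ^ k * fact k))" for k :: nat
    using integral_monomial_gaussian(1)[of "1/2" k] by (simp add: mult_ac)
  have f_int: "integrable lborel (f k)" for k
    unfolding f_def using int by (intro integrable_mult_right integrable_of_real)
  have nf: "norm (f k t) = norm (c k) * (exp (- (1 / 2) * t\<^sup>2) * t ^ (2 * k))" for k t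
    unfolding f_def norm_mult[of "c k"] norm_of_real by (simp add: abs_mult power_mult)
  have binom: "(\<lambda>k. (fact (2 * k) / (4 ^ k * (fact k)\<^sup>2)) * z ^ k) sums (1 - z) powr (- 1 / 2)" if "norm z < 1" for z :: complex
  proof -
    have "(\<lambda>k. ((- 1 / 2) gchoose k) * (- z) ^ k) sums (1 + (- z)) powr (- 1 / 2)"
      by (rule gen_binomial_complex) (use that in simp)
    moreover have "((- 1 / 2) gchoose k) * (- z) ^ k = (fact (2 * k) / (4 ^ k * (fact k)\<^sup>2)) * z ^ k" for k
      unfolding gbinomial_minus_half[symmetric] by (simp add: power_minus[of z])
    ultimately show ?thesis by simp
  qed
  have pt: "(\<lambda>k. f k t) sums exp (- (1 - \<beta>) * of_real (t\<^sup>2) / 2)" for t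
  proof -
    have "(\<lambda>k. (\<beta> * of_real (t\<^sup>2) / 2) ^ k /\<^sub>R fact k) sums exp (\<beta> * of_real (t\<^sup>2) / 2)"
      by (rule exp_converges)
    hence "(\<lambda>k. of_real (exp (- (1 / 2) * t\<^sup>2)) * ((\<beta> * of_real (t\<^sup>2) / 2) ^ k /\<^sub>R fact k))
        sums (of_real (exp (- (1 / 2) * t\<^sup>2)) * exp (\<beta> * of_real (t\<^sup>2) / 2))"
      by (rule sums_mult)
    moreover have "of_real (exp (- (1 / 2) * t\<^sup>2)) * exp (\<beta> * of_real (t\<^sup>2) / 2) = exp (- (1 - \<beta>) * of_real (t\<^sup>2) / 2)"
      by (simp add: exp_of_real[symmetric] exp_add[symmetric] algebra_simps diff_divide_distrib)
    moreover have "of_real (exp (- (1 / 2) * t\<^sup>2)) * ((\<beta> * of_real (t\<^sup>2) / 2) ^ k /\<^sub>R fact k) = f k t" for k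
      by (simp add: f_def c_def power_mult_distrib power_divide scaleR_conv_of_real field_simps)
        (simp add: power_mult[symmetric] mult.commute)
    ultimately show ?thesis by simp
  qed
  have "summable (\<lambda>k. (fact (2 * k) / (4 ^ k * (fact k)\<^sup>2)) * complex_of_real (norm \<beta>) ^ k)"
    using binom[of "complex_of_real (norm \<beta>)"] \<beta> by (auto intro: sums_summable)
  hence "summable (\<lambda>k. complex_of_real (fact (2 * k) / (4 ^ k * (fact k)\<^sup>2) * norm \<beta> ^ k))" by simp
  hence S: "summable (\<lambda>k. fact (2 * k) / (4 ^ k * (fact k)\<^sup>2) * norm \<beta> ^ k)"
    by (simp only: summable_complex_of_real)
  have Inf: "(\<integral>t. norm (f k t) \<partial>lborel) = sqrt (2 * pi) * (fact (2 * k) / (4 ^ k * (fact k)\<^sup>2) * norm \<beta> ^ k)" for k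
  proof -
    have "(\<integral>t. norm (f k t) \<partial>lborel) = norm (c k) * (sqrt (2 * pi) * (fact (2 * k) / (2 ^ k * fact k)))"
      unfolding nf integral_mult_right_zero mom ..
    also have "\<dots> = sqrt (2 * pi) * (fact (2 * k) / (4 ^ k * (fact k)\<^sup>2) * norm \<beta> ^ k)"
    proof -
      have "(4 :: real) ^ k = 2 ^ k * 2 ^ k" by (simp flip: power_mult_distrib)
      thus ?thesis by (simp add: c_def norm_divide norm_mult norm_power power2_eq_square field_simps)
    qed
    finally show ?thesis .
  qed
  have If: "(\<integral>t. f k t \<partial>lborel) = of_real (sqrt (2 * pi)) * ((fact (2 * k) / (4 ^ k * (fact k)\<^sup>2)) * \<beta> ^ k)" for k
  proof -
    have "(\<integral>t. f k t \<partial>lborel) = c k * of_real (sqrt (2 * pi) * (fact (2 * k) / (2 ^ k * fact k)))"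
      unfolding f_def integral_mult_right_zero integral_complex_of_real mom ..
    also have "\<dots> = of_real (sqrt (2 * pi)) * ((fact (2 * k) / (4 ^ k * (fact k)\<^sup>2)) * \<beta> ^ k)"
    proof -
      have "(4 :: complex) ^ k = 2 ^ k * 2 ^ k" by (simp flip: power_mult_distrib)
      thus ?thesis by (simp add: c_def power2_eq_square field_simps)
    qed
    finally show ?thesis .
  qed
  have "(\<lambda>k. \<integral>t. f k t \<partial>lborel) sums (\<integral>t. (\<Sum>k. f k t) \<partial>lborel)"
  proof (rule sums_integral[OF f_int])
    show "summable (\<lambda>k. \<integral>t. norm (f k t) \<partial>lborel)"
      unfolding Inf by (rule summable_mult[OF S])
    have "summable (\<lambda>k. norm (f k t))" for t
    proof -
      have "summable (\<lambda>k. exp (- (1 / 2) * t\<^sup>2) * ((norm \<beta> * t\<^sup>2 / 2) ^ k /\<^sub>R fact k))"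
        by (intro summable_mult summable_exp_generic)
      moreover have "exp (- (1 / 2) * t\<^sup>2) * ((norm \<beta> * t\<^sup>2 / 2) ^ k /\<^sub>R fact k) = norm (f k t)" for k
        unfolding nf c_def
        by (simp add: norm_divide norm_mult norm_power power_mult_distrib power_divide field_simps)
          (simp add: power_mult[symmetric] mult.commute)
      ultimately show ?thesis by (simp only:)
    qed
    thus "AE t in lborel. summable (\<lambda>k. norm (f k t))" by simp
  qed
  moreover have "(\<lambda>t. \<Sum>k. f k t) = (\<lambda>t. exp (- (1 - \<beta>) * of_real (t\<^sup>2) / 2))"
    using pt by (auto simp: sums_iff)
  ultimately have "(\<lambda>k. \<integral>t. f k t \<partial>lborel) sums (\<integral>t. exp (- (1 - \<beta>) * of_real (t\<^sup>2) / 2) \<partial>lborel)" by simp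
  moreover have "(\<lambda>k. \<integral>t. f k t \<partial>lborel) sums (of_real (sqrt (2 * pi)) * (1 - \<beta>) powr (- 1 / 2))"
    unfolding If by (intro sums_mult binom \<beta>)
  ultimately have "(\<integral>t. exp (- (1 - \<beta>) * of_real (t\<^sup>2) / 2) \<partial>lborel) = of_real (sqrt (2 * pi)) * (1 - \<beta>) powr (- 1 / 2)"
    by (rule sums_unique2)
  moreover have "1 - \<beta> \<noteq> 0" using \<beta> by auto
  ultimately show ?thesis using csqrt_powr_minus_half[of "1 - \<beta>"] by (simp add: mult_ac)
qed

lemma complex_gaussian_integral:
  fixes \<beta> :: complex and n :: real
  assumes "norm \<beta> < 1" "n > 0"
  shows "of_real (sqrt (n / (2 * pi))) * csqrt (1 - \<beta>) * (\<integral>t. exp (- of_real n * (1 - \<beta>) * of_real (t\<^sup>2) / 2) \<partial>lborel) = 1"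
proof -
  have "(\<integral>t. exp (- (1 - \<beta>) * of_real (t\<^sup>2) / 2) \<partial>lborel)
     = \<bar>sqrt n\<bar> *\<^sub>R (\<integral>t. exp (- (1 - \<beta>) * of_real ((0 + sqrt n * t)\<^sup>2) / 2) \<partial>lborel)"
    by (rule lborel_integral_real_affine) (use assms in simp)
  also have "(\<lambda>t. exp (- (1 - \<beta>) * of_real ((0 + sqrt n * t)\<^sup>2) / 2)) = (\<lambda>t. exp (- of_real n * (1 - \<beta>) * of_real (t\<^sup>2) / 2))"
    using assms by (intro ext arg_cong[of _ _ exp]) (simp add: power_mult_distrib algebra_simps)
  finally have e: "(\<integral>t. exp (- (1 - \<beta>) * of_real (t\<^sup>2) / 2) \<partial>lborel) = of_real (sqrt n) * (\<integral>t. exp (- of_real n * (1 - \<beta>) * of_real (t\<^sup>2) / 2) \<partial>lborel)"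
    using assms by (simp add: scaleR_conv_of_real)
  have "of_real (sqrt (n / (2 * pi))) * csqrt (1 - \<beta>) * (\<integral>t. exp (- of_real n * (1 - \<beta>) * of_real (t\<^sup>2) / 2) \<partial>lborel)
     = (\<integral>t. exp (- (1 - \<beta>) * of_real (t\<^sup>2) / 2) \<partial>lborel) * csqrt (1 - \<beta>) / of_real (sqrt (2 * pi))"
    unfolding e by (simp add: real_sqrt_divide)
  also have "\<dots> = 1" unfolding complex_gaussian_integral_unit[OF assms(1)] by simp
  finally show ?thesis .
qed

section \<open>Laplace's method with a uniform error\<close>

text \<open>
  The maximum, instead of the usual exponential of $|\operatorname{Re} z|$, matters below:
  multiplied by a Gaussian, both alternatives are again Gaussian bounds.
\<close>

lemma norm_exp_minus_linear:
  fixes z :: complex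
  shows "norm (exp z - 1 - z) \<le> max 1 (exp (Re z)) * (norm z)\<^sup>2"
proof -
  have "norm (exp z - (\<Sum>i\<le>1. exp 0 * (z - 0) ^ i / fact i)) \<le> max 1 (exp (Re z)) * norm (z - 0) ^ Suc 1 / fact 1"
  proof (rule complex_Taylor[of "closed_segment 0 z" 1 "\<lambda>_. exp"])
    show "norm (exp x) \<le> max 1 (exp (Re z))" if x: "x \<in> closed_segment 0 z" for x
    proof -
      obtain u where u: "0 \<le> u" "u \<le> 1" "x = u *\<^sub>R z"
        using x by (auto simp: closed_segment_def)
      have "u * Re z \<le> max 0 (Re z)"
      proof (cases "Re z \<ge> 0")
        case True
        thus ?thesis using mult_right_mono[OF u(2) True] by simp
      next
        case False
        thus ?thesis using u by (simp add: mult_nonneg_nonpos)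
      qed
      hence "exp (Re x) \<le> exp (max 0 (Re z))" by (simp add: u)
      also have "\<dots> = max 1 (exp (Re z))" by (simp add: max_def)
      finally show ?thesis by simp
    qed
  qed (auto intro!: derivative_eq_intros)
  thus ?thesis by (simp add: algebra_simps power2_eq_square)
qed

text \<open>
  With $v=e^{it}$ this is $(1+\beta)v-\beta v^2/2-\log v$ minus its value at the saddle
  $v=1$.
\<close>

definition phase :: "complex \<Rightarrow> real \<Rightarrow> complex" where
  "phase \<beta> t = (cis t - 1) - \<beta> * (cis t - 1)\<^sup>2 / 2 - \<i> * of_real t"

lemma quadratic_le_one_minus_cos:
  assumes "\<bar>t\<bar> \<le> pi" shows "t\<^sup>2 / 12 \<le> 1 - cos t"
proof -
  have "norm (cis t - (\<Sum>k\<le>3. (\<i> * of_real t) ^ k / fact k)) \<le> \<bar>t\<bar> ^ 4 / 24"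
    using iexp_approx1[of t 3] by (simp add: cis_conv_exp fact_numeral)
  moreover have "Re (cis t - (\<Sum>k\<le>3. (\<i> * of_real t) ^ k / fact k)) = cos t - (1 - t\<^sup>2 / 2)"
    by (simp add: eval_nat_numeral fact_numeral power_mult_distrib)
  ultimately have "cos t - (1 - t\<^sup>2 / 2) \<le> t ^ 4 / 24"
    using abs_Re_le_cmod[of "cis t - (\<Sum>k\<le>3. (\<i> * of_real t) ^ k / fact k)"] by simp
  moreover have "t ^ 4 \<le> 10 * t\<^sup>2"
  proof -
    have "t\<^sup>2 \<le> pi\<^sup>2" using assms abs_le_square_iff[of t pi] by simp
    also have "\<dots> \<le> 3.15\<^sup>2" using pi_approx by (intro power_mono) auto
    also have "\<dots> \<le> 10" by (simp add: power2_eq_square)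
    finally have "t\<^sup>2 * t\<^sup>2 \<le> 10 * t\<^sup>2" by (intro mult_right_mono) auto
    thus ?thesis by (simp add: power2_eq_square power4_eq_xxxx mult.assoc)
  qed
  ultimately show ?thesis by simp
qed

text \<open>
  Since $|e^{it}-1|^2=2(1-\cos t)$, the quadratic term of the phase is at most $|\beta|$
  times the decay of the linear one. So the unit circle itself is a path of descent, for
  every $|\beta|<1$.
\<close>

lemma Re_phase_le: "Re (phase \<beta> t) \<le> - (1 - norm \<beta>) * (1 - cos t)"
proof -
  have n2: "(norm (cis t - 1))\<^sup>2 = 2 * (1 - cos t)"
  proof -
    have "(norm (cis t - 1))\<^sup>2 = (cos t)\<^sup>2 + (sin t)\<^sup>2 - 2 * cos t + 1"
      by (simp add: cmod_power2 power2_diff del: sin_cos_squared_add2 sin_cos_squared_add sin_cos_squared_add3)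
    thus ?thesis by simp
  qed
  have "- Re (\<beta> * (cis t - 1)\<^sup>2 / 2) \<le> norm (\<beta> * (cis t - 1)\<^sup>2 / 2)"
    using abs_Re_le_cmod[of "\<beta> * (cis t - 1)\<^sup>2 / 2"] by linarith
  also have "\<dots> = norm \<beta> * (1 - cos t)" by (simp add: norm_mult norm_divide norm_power n2)
  finally have "- Re (\<beta> * (cis t - 1)\<^sup>2 / 2) \<le> norm \<beta> * (1 - cos t)" .
  moreover have "Re (phase \<beta> t) = cos t - 1 - Re (\<beta> * (cis t - 1)\<^sup>2 / 2)"
    unfolding phase_def by simp
  ultimately show ?thesis by (simp add: algebra_simps)
qed

text \<open>
  The linear term vanishes (saddle point), the quadratic one is the Gaussian. The phase is a
  combination of $e^{it}$ and $e^{2it}$, so the Taylor bound for the exponential gives the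
  remainder on the whole line.
\<close>

lemma phase_Taylor:
  assumes "norm \<beta> \<le> 1"
  shows "norm (phase \<beta> t + (1 - \<beta>) * of_real (t\<^sup>2) / 2 - \<i> * (\<beta> / 2 - 1 / 6) * of_real (t ^ 3)) \<le> t ^ 4 / 2"
proof -
  define T where "T = (\<lambda>s::real. cis s - (\<Sum>k\<le>3. (\<i> * of_real s) ^ k / fact k))"
  have T: "norm (T s) \<le> s ^ 4 / 24" for s
    using iexp_approx1[of s 3] unfolding T_def by (simp add: cis_conv_exp fact_numeral)
  have cT: "cis s = T s + (1 + \<i> * of_real s - (of_real s)\<^sup>2 / 2 - \<i> * of_real s ^ 3 / 6)" for s
    unfolding T_def by (simp add: eval_nat_numeral fact_numeral power_mult_distrib algebra_simps)
  have c2: "(cis t)\<^sup>2 = cis (2 * t)" by (simp add: power2_eq_square cis_mult)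
  have ph: "phase \<beta> t = (1 + \<beta>) * cis t - \<beta> / 2 * cis (2 * t) - 1 - \<beta> / 2 - \<i> * of_real t"
    unfolding phase_def c2[symmetric] by (simp add: power2_eq_square algebra_simps diff_divide_distrib add_divide_distrib)
  have "phase \<beta> t + (1 - \<beta>) * of_real (t\<^sup>2) / 2 - \<i> * (\<beta> / 2 - 1 / 6) * of_real (t ^ 3)
     = (1 + \<beta>) * T t - \<beta> / 2 * T (2 * t)"
    unfolding ph cT[of t] cT[of "2 * t"]
    by (simp add: power2_eq_square power3_eq_cube field_simps)
  also have "norm \<dots> \<le> norm (1 + \<beta>) * norm (T t) + norm (\<beta> / 2) * norm (T (2 * t))"
    unfolding norm_mult[symmetric] by (rule norm_triangle_ineq4)
  also have "\<dots> \<le> 2 * (t ^ 4 / 24) + 1 / 2 * ((2 * t) ^ 4 / 24)"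
    using assms norm_triangle_ineq[of 1 \<beta>] by (intro add_mono mult_mono T) (auto simp: norm_divide)
  also have "\<dots> \<le> t ^ 4 / 2" by (simp add: power_mult_distrib)
  finally show ?thesis .
qed

text \<open>
  The integrand is compared with a Gaussian times the odd part of its first-order
  correction, which integrates to zero; what is left is of second order. Both $e^q$ and the
  integrand itself are bounded by the same Gaussian, because of the maximum in the bound for
  the remainder of the exponential.
\<close>

lemma laplace_pointwise:
  fixes n :: real and m :: nat
  assumes n: "n > 0" and b: "norm \<beta> \<le> b" "b < 1" and t: "\<bar>t\<bar> \<le> pi"
  defines "c \<equiv> (1 - b) / 12"
  defines "q \<equiv> - of_real n * (1 - \<beta>) * of_real (t\<^sup>2) / 2"
  shows "norm (exp (of_real n * phase \<beta> t + \<i> * of_nat m * of_real t)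
            - exp q * (1 + \<i> * of_nat m * of_real t + of_real n * \<i> * (\<beta> / 2 - 1 / 6) * of_real (t ^ 3)))
       \<le> exp (- (c * n) * t\<^sup>2) * (2 * (real m)\<^sup>2 * t\<^sup>2 + 18 * n\<^sup>2 * t ^ 6 + n * t ^ 4 / 2)"
proof -
  define r where "r = phase \<beta> t + (1 - \<beta>) * of_real (t\<^sup>2) / 2 - \<i> * (\<beta> / 2 - 1 / 6) * of_real (t ^ 3)"
  have b1: "norm \<beta> \<le> 1" using b by simp
  have r: "norm r \<le> t ^ 4 / 2" unfolding r_def by (rule phase_Taylor[OF b1])
  define E1 where "E1 = \<i> * of_nat m * of_real t + of_real n * \<i> * (\<beta> / 2 - 1 / 6) * of_real (t ^ 3)"
  define E where "E = E1 + of_real n * r"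
  define g where "g = of_real n * phase \<beta> t + \<i> * of_nat m * of_real t"
  have gqE: "g = q + E"
    unfolding g_def q_def E_def E1_def r_def by (simp add: field_simps)
  \<comment> \<open>the rate of decay of the integrand; the Gaussian decays faster, at rate
      (1 - Re beta)/2\<close>
  have quad: "(1 - norm \<beta>) * (1 - cos t) \<ge> c * t\<^sup>2"
  proof -
    have "(1 - b) * (t\<^sup>2 / 12) \<le> (1 - norm \<beta>) * (1 - cos t)"
      using b quadratic_le_one_minus_cos[OF t] by (intro mult_mono) auto
    thus ?thesis by (simp add: c_def)
  qed
  have eg: "exp (Re g) \<le> exp (- (c * n) * t\<^sup>2)"
  proof -
    have "Re g = n * Re (phase \<beta> t)" by (simp add: g_def)
    also have "\<dots> \<le> n * (- (c * t\<^sup>2))"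
      using n quad Re_phase_le[of \<beta> t] by (intro mult_left_mono) linarith+
    finally show ?thesis by (simp add: mult_ac)
  qed
  have eq: "exp (Re q) \<le> exp (- (c * n) * t\<^sup>2)"
  proof -
    have "c \<le> (1 - Re \<beta>) / 2" using b complex_Re_le_cmod[of \<beta>] unfolding c_def by simp
    hence "c * (n * t\<^sup>2) \<le> (1 - Re \<beta>) / 2 * (n * t\<^sup>2)" using n by (intro mult_right_mono) auto
    moreover have "Re q = - ((1 - Re \<beta>) / 2 * (n * t\<^sup>2))" unfolding q_def by (simp add: field_simps flip: of_real_power)
    ultimately show ?thesis by (simp add: mult_ac)
  qed
  have nE: "(norm E)\<^sup>2 \<le> 2 * (real m)\<^sup>2 * t\<^sup>2 + 18 * n\<^sup>2 * t ^ 6"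
  proof -
    have g1: "norm (\<beta> / 2 - 1 / 6) \<le> 1"
      using norm_triangle_ineq4[of "\<beta> / 2" "1 / 6"] b1 by (simp add: norm_divide)
    have "norm E \<le> norm (\<i> * of_nat m * of_real t) + norm (of_real n * \<i> * (\<beta> / 2 - 1 / 6) * of_real (t ^ 3)) + norm (of_real n * r)"
      unfolding E_def E1_def by (intro order_trans[OF norm_triangle_ineq] add_right_mono norm_triangle_ineq)
    also have "\<dots> = real m * \<bar>t\<bar> + n * norm (\<beta> / 2 - 1 / 6) * \<bar>t\<bar> ^ 3 + n * norm r"
      using n by (simp add: norm_mult norm_power)
    also have "\<dots> \<le> real m * \<bar>t\<bar> + n * 1 * \<bar>t\<bar> ^ 3 + n * (2 * \<bar>t\<bar> ^ 3)"
    proof -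
      have "t ^ 4 / 2 = \<bar>t\<bar> ^ 3 * (\<bar>t\<bar> / 2)"
        by (simp add: power3_eq_cube power4_eq_xxxx mult.assoc)
      also have "\<dots> \<le> \<bar>t\<bar> ^ 3 * 2" using t pi_less_4 by (intro mult_left_mono) auto
      finally have "norm r \<le> 2 * \<bar>t\<bar> ^ 3" using r by simp
      thus ?thesis using n g1 by (intro add_mono mult_left_mono mult_right_mono) auto
    qed
    also have "\<dots> = real m * \<bar>t\<bar> + 3 * n * \<bar>t\<bar> ^ 3" by simp
    finally have "(norm E)\<^sup>2 \<le> (real m * \<bar>t\<bar> + 3 * n * \<bar>t\<bar> ^ 3)\<^sup>2" by (intro power_mono) auto
    also have "\<dots> \<le> 2 * (real m * \<bar>t\<bar>)\<^sup>2 + 2 * (3 * n * \<bar>t\<bar> ^ 3)\<^sup>2"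
      using sum_squares_bound[of "real m * \<bar>t\<bar>" "3 * n * \<bar>t\<bar> ^ 3"] by (simp add: power2_sum)
    also have "\<dots> = 2 * (real m)\<^sup>2 * t\<^sup>2 + 18 * n\<^sup>2 * t ^ 6"
      by (simp add: power_mult_distrib flip: power_mult)
    finally show ?thesis .
  qed
  have "exp g - exp q * (1 + E1) = exp q * (exp E - 1 - E) + exp q * (of_real n * r)"
    unfolding gqE exp_add E_def by (simp add: algebra_simps)
  also have "norm \<dots> \<le> exp (Re q) * norm (exp E - 1 - E) + exp (Re q) * (n * norm r)"
    using n by (intro order_trans[OF norm_triangle_ineq]) (simp add: norm_mult)
  also have "\<dots> \<le> exp (- (c * n) * t\<^sup>2) * (norm E)\<^sup>2 + exp (- (c * n) * t\<^sup>2) * (n * (t ^ 4 / 2))"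
  proof (rule add_mono)
    have "exp (Re q) * norm (exp E - 1 - E) \<le> exp (Re q) * (max 1 (exp (Re E)) * (norm E)\<^sup>2)"
      by (intro mult_left_mono norm_exp_minus_linear) auto
    also have "\<dots> = max (exp (Re q)) (exp (Re g)) * (norm E)\<^sup>2"
      unfolding gqE by (simp add: exp_add max_def)
    also have "\<dots> \<le> exp (- (c * n) * t\<^sup>2) * (norm E)\<^sup>2"
      using eg eq by (intro mult_right_mono) auto
    finally show "exp (Re q) * norm (exp E - 1 - E) \<le> exp (- (c * n) * t\<^sup>2) * (norm E)\<^sup>2" .
    show "exp (Re q) * (n * norm r) \<le> exp (- (c * n) * t\<^sup>2) * (n * (t ^ 4 / 2))"
      using eq n r by (intro mult_mono) auto
  qed
  also have "\<dots> \<le> exp (- (c * n) * t\<^sup>2) * (2 * (real m)\<^sup>2 * t\<^sup>2 + 18 * n\<^sup>2 * t ^ 6 + n * t ^ 4 / 2)"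
    unfolding distrib_left[symmetric] using nE by (intro mult_left_mono) auto
  finally show ?thesis unfolding g_def E1_def by (simp add: add.assoc)
qed

definition laplace_integral :: "real \<Rightarrow> complex \<Rightarrow> nat \<Rightarrow> complex" where
  "laplace_integral n \<beta> m = (\<integral>t. indicator {-pi..pi} t *\<^sub>R exp (of_real n * phase \<beta> t + \<i> * of_nat m * of_real t) \<partial>lborel)"

lemma integrable_laplace:
  "integrable lborel (\<lambda>t. indicator {-pi..pi} t *\<^sub>R exp (of_real n * phase \<beta> t + \<i> * of_nat m * of_real t))"
  unfolding phase_def by (intro borel_integrable_compact continuous_intros) auto

text \<open>
  Integrate the pointwise bound. By scaling, each of the terms $m^2t^2$, $n^2t^6$ and $nt^4$
  integrates to at most $(1+m^2)n^{-3/2}$ times a constant, against the size $n^{-1/2}$ of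
  the main term.
\<close>

lemma laplace_asymptotics:
  assumes b: "0 \<le> b" "b < 1"
  shows "\<exists>C\<ge>0. \<forall>n>0. \<forall>\<beta>. \<forall>m. norm \<beta> \<le> b \<longrightarrow>
     norm (of_real (sqrt (n / (2 * pi))) * csqrt (1 - \<beta>) * laplace_integral n \<beta> m - 1) \<le> C * (1 + (real m)\<^sup>2) / n"
proof -
  define c where "c = (1 - b) / 12"
  have c: "c > 0" using b by (simp add: c_def)
  define C where "C = 2 * (1 / c + 135 / (4 * c ^ 3) + 3 / (8 * c\<^sup>2)) / sqrt c"
  have C0: "C \<ge> 0" unfolding C_def using c by simp
  have main: "norm (of_real (sqrt (n / (2 * pi))) * csqrt (1 - \<beta>) * laplace_integral n \<beta> m - 1) \<le> C * (1 + (real m)\<^sup>2) / n"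
    if n: "n > 0" and \<beta>: "norm \<beta> \<le> b" for n \<beta> m
  proof -
    define a where "a = c * n"
    have a: "a > 0" using c n by (simp add: a_def)
    define q where "q = (\<lambda>t::real. exp (- of_real n * (1 - \<beta>) * of_real (t\<^sup>2) / 2))"
    define odd where "odd = (\<lambda>t::real. \<i> * of_nat m * of_real t + of_real n * \<i> * (\<beta> / 2 - 1 / 6) * of_real (t ^ 3))"
    define G where "G = (\<lambda>t::real. exp (of_real n * phase \<beta> t + \<i> * of_nat m * of_real t))"
    let ?I = "indicator {-pi..pi} :: real \<Rightarrow> real"
    have nq: "norm (q t) \<le> exp (- a * t\<^sup>2)" for t
    proof -
      have "c \<le> (1 - Re \<beta>) / 2" using b \<beta> complex_Re_le_cmod[of \<beta>] unfolding c_def by simp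
      hence "c * (n * t\<^sup>2) \<le> (1 - Re \<beta>) / 2 * (n * t\<^sup>2)" using n by (intro mult_right_mono) auto
      moreover have "norm (q t) = exp (- ((1 - Re \<beta>) / 2 * (n * t\<^sup>2)))"
        unfolding q_def by (simp add: field_simps flip: of_real_power)
      ultimately show ?thesis by (simp add: a_def mult_ac)
    qed
    have iq: "integrable lborel q"
    proof (rule Bochner_Integration.integrable_bound)
      show "integrable lborel (\<lambda>t. exp (- a * t\<^sup>2) * t ^ 0)" by (rule integrable_monomial_gaussian[OF a])
      show "q \<in> borel_measurable lborel" unfolding q_def
        by (auto intro!: borel_measurable_continuous_onI continuous_intros)
      show "AE t in lborel. norm (q t) \<le> norm (exp (- a * t\<^sup>2) * t ^ 0)" using nq by simp
    qed
    have iqo: "integrable lborel (\<lambda>t. ?I t *\<^sub>R (q t * odd t))"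
      unfolding q_def odd_def by (intro borel_integrable_compact continuous_intros) auto
    have zero: "(\<integral>t. ?I t *\<^sub>R (q t * odd t) \<partial>lborel) = 0"
    proof -
      have "(\<integral>t. ?I t *\<^sub>R (q t * odd t) \<partial>lborel) = \<bar>- 1\<bar> *\<^sub>R (\<integral>t. ?I (0 + (- 1) * t) *\<^sub>R (q (0 + (- 1) * t) * odd (0 + (- 1) * t)) \<partial>lborel)"
        by (rule lborel_integral_real_affine) simp
      also have "\<dots> = (\<integral>t. - (?I t *\<^sub>R (q t * odd t)) \<partial>lborel)"
      proof -
        have "?I (0 + (- 1) * t) *\<^sub>R (q (0 + (- 1) * t) * odd (0 + (- 1) * t)) = - (?I t *\<^sub>R (q t * odd t))" for t
        proof -
          have "?I (- t) = ?I t" by (auto simp: indicator_def)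
          moreover have "q (- t) = q t" "odd (- t) = - odd t" by (simp_all add: q_def odd_def power3_eq_cube)
          ultimately show ?thesis by simp
        qed
        thus ?thesis by simp
      qed
      also have "\<dots> = - (\<integral>t. ?I t *\<^sub>R (q t * odd t) \<partial>lborel)" by (rule Bochner_Integration.integral_minus)
      finally show ?thesis by simp
    qed
    \<comment> \<open>The last summand pays for the part of the Gaussian outside [-pi, pi],
        where t^2 exceeds 1.\<close>
    define d where "d = (\<lambda>t. exp (- a * t\<^sup>2) * (2 * (real m)\<^sup>2 * t\<^sup>2 + 18 * n\<^sup>2 * t ^ 6 + n * t ^ 4 / 2 + t\<^sup>2))"
    have d_eq: "d = (\<lambda>t. (2 * (real m)\<^sup>2 + 1) * (exp (- a * t\<^sup>2) * t ^ (2 * 1)) + 18 * n\<^sup>2 * (exp (- a * t\<^sup>2) * t ^ (2 * 3)) + n / 2 * (exp (- a * t\<^sup>2) * t ^ (2 * 2)))"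
      by (auto simp: d_def algebra_simps power2_eq_square)
    have id: "integrable lborel d" unfolding d_eq
      by (intro Bochner_Integration.integrable_add integrable_mult_right integrable_monomial_gaussian[OF a])
    have Id: "(\<integral>t. d t \<partial>lborel) = sqrt (pi / a) * ((2 * (real m)\<^sup>2 + 1) / (2 * a) + 18 * n\<^sup>2 * 15 / (8 * a ^ 3) + n / 2 * 3 / (4 * a\<^sup>2))"
    proof -
      have "(\<integral>t. d t \<partial>lborel) = (2 * (real m)\<^sup>2 + 1) * (\<integral>t. exp (- a * t\<^sup>2) * t ^ (2 * 1) \<partial>lborel)
         + 18 * n\<^sup>2 * (\<integral>t. exp (- a * t\<^sup>2) * t ^ (2 * 3) \<partial>lborel) + n / 2 * (\<integral>t. exp (- a * t\<^sup>2) * t ^ (2 * 2) \<partial>lborel)"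
        unfolding d_eq
        by (subst Bochner_Integration.integral_add Bochner_Integration.integral_add integral_mult_right_zero;
            (intro Bochner_Integration.integrable_add integrable_mult_right integrable_monomial_gaussian[OF a])?)+ simp
      also have "\<dots> = sqrt (pi / a) * ((2 * (real m)\<^sup>2 + 1) / (2 * a) + 18 * n\<^sup>2 * 15 / (8 * a ^ 3) + n / 2 * 3 / (4 * a\<^sup>2))"
        unfolding integral_monomial_gaussian(1)[OF a] using a by (simp add: fact_numeral field_simps power_mult_distrib)
      finally show ?thesis .
    qed
    have pt: "norm (?I t *\<^sub>R G t - q t - ?I t *\<^sub>R (q t * odd t)) \<le> d t" for t
    proof (cases "t \<in> {-pi..pi}")
      case True
      hence "norm (?I t *\<^sub>R G t - q t - ?I t *\<^sub>R (q t * odd t)) = norm (G t - q t * (1 + odd t))"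
        by (simp add: algebra_simps)
      also have "\<dots> \<le> exp (- (c * n) * t\<^sup>2) * (2 * (real m)\<^sup>2 * t\<^sup>2 + 18 * n\<^sup>2 * t ^ 6 + n * t ^ 4 / 2)"
        using laplace_pointwise[OF n \<beta> b(2), of t m] True unfolding G_def q_def odd_def c_def
        by (simp add: add.assoc abs_le_iff)
      also have "\<dots> \<le> d t" unfolding d_def a_def by (intro mult_left_mono) auto
      finally show ?thesis .
    next
      case False
      have "1 \<le> \<bar>t\<bar>" using False pi_ge_two by auto
      hence "1 \<le> t\<^sup>2" using power_mono[of 1 "\<bar>t\<bar>" 2] by simp
      have "norm (?I t *\<^sub>R G t - q t - ?I t *\<^sub>R (q t * odd t)) = norm (q t)" using False by simp
      also have "\<dots> \<le> exp (- a * t\<^sup>2) * 1" using nq[of t] by simp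
      also have "\<dots> \<le> d t" unfolding d_def using \<open>1 \<le> t\<^sup>2\<close> n
        by (intro mult_left_mono) (auto intro!: add_increasing)
      finally show ?thesis .
    qed
    have iG: "integrable lborel (\<lambda>t. ?I t *\<^sub>R G t)" unfolding G_def by (rule integrable_laplace)
    have "norm (laplace_integral n \<beta> m - (\<integral>t. q t \<partial>lborel)) = norm (\<integral>t. ?I t *\<^sub>R G t - q t - ?I t *\<^sub>R (q t * odd t) \<partial>lborel)"
    proof -
      have "laplace_integral n \<beta> m = (\<integral>t. ?I t *\<^sub>R G t \<partial>lborel)" by (simp add: laplace_integral_def G_def)
      thus ?thesis using zero iq iqo iG by (simp add: Bochner_Integration.integral_diff)
    qed
    also have "\<dots> \<le> (\<integral>t. norm (?I t *\<^sub>R G t - q t - ?I t *\<^sub>R (q t * odd t)) \<partial>lborel)"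
      by (rule integral_norm_bound)
    also have "\<dots> \<le> (\<integral>t. d t \<partial>lborel)"
      by (rule integral_mono[OF _ id pt]) (intro integrable_norm Bochner_Integration.integrable_diff iq iqo iG)
    finally have diff: "norm (laplace_integral n \<beta> m - (\<integral>t. q t \<partial>lborel)) \<le> (\<integral>t. d t \<partial>lborel)" .
    have \<beta>1: "norm \<beta> < 1" using b \<beta> by simp
    let ?p = "of_real (sqrt (n / (2 * pi))) * csqrt (1 - \<beta>)"
    have np: "norm ?p \<le> sqrt (n / (2 * pi)) * sqrt 2"
    proof -
      have "norm (1 - \<beta>) \<le> 2" using norm_triangle_ineq4[of 1 \<beta>] \<beta>1 by simp
      thus ?thesis using n by (simp add: norm_mult norm_csqrt mult_left_mono)
    qed
    have "?p * laplace_integral n \<beta> m - 1 = ?p * (laplace_integral n \<beta> m - (\<integral>t. q t \<partial>lborel))"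
      using complex_gaussian_integral[OF \<beta>1 n] unfolding q_def by (simp add: algebra_simps)
    also have "norm \<dots> \<le> sqrt (n / (2 * pi)) * sqrt 2 * (\<integral>t. d t \<partial>lborel)"
      unfolding norm_mult[of ?p] using np diff n by (intro mult_mono) auto
    also have "\<dots> = (sqrt (n / pi) * sqrt (pi / a)) * ((2 * (real m)\<^sup>2 + 1) / (2 * a) + 18 * n\<^sup>2 * 15 / (8 * a ^ 3) + n / 2 * 3 / (4 * a\<^sup>2))"
      unfolding Id by (simp add: real_sqrt_divide real_sqrt_mult)
    also have "sqrt (n / pi) * sqrt (pi / a) = 1 / sqrt c"
      using n c unfolding a_def by (simp add: real_sqrt_divide real_sqrt_mult)
    also have "(2 * (real m)\<^sup>2 + 1) / (2 * a) + 18 * n\<^sup>2 * 15 / (8 * a ^ 3) + n / 2 * 3 / (4 * a\<^sup>2)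
      = ((2 * (real m)\<^sup>2 + 1) / (2 * c) + 135 / (4 * c ^ 3) + 3 / (8 * c\<^sup>2)) / n"
      using n c unfolding a_def by (simp add: field_simps power2_eq_square power3_eq_cube)
    also have "\<dots> \<le> ((1 / c + 135 / (4 * c ^ 3) + 3 / (8 * c\<^sup>2)) * (1 + (real m)\<^sup>2)) / n"
    proof (rule divide_right_mono)
      have "(2 * (real m)\<^sup>2 + 1) / (2 * c) \<le> 1 / c * (1 + (real m)\<^sup>2)" using c by (simp add: field_simps)
      moreover have le: "y \<le> y * (1 + (real m)\<^sup>2)" if "y \<ge> 0" for y :: real
        using that by (simp add: algebra_simps)
      moreover have "135 / (4 * c ^ 3) \<le> 135 / (4 * c ^ 3) * (1 + (real m)\<^sup>2)" by (rule le) (use c in simp)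
      moreover have "3 / (8 * c\<^sup>2) \<le> 3 / (8 * c\<^sup>2) * (1 + (real m)\<^sup>2)" by (rule le) (use c in simp)
      ultimately show "(2 * (real m)\<^sup>2 + 1) / (2 * c) + 135 / (4 * c ^ 3) + 3 / (8 * c\<^sup>2) \<le> (1 / c + 135 / (4 * c ^ 3) + 3 / (8 * c\<^sup>2)) * (1 + (real m)\<^sup>2)"
        unfolding distrib_right by linarith
    qed (use n in simp)
    finally have "norm (?p * laplace_integral n \<beta> m - 1) \<le> 1 / sqrt c * (((1 / c + 135 / (4 * c ^ 3) + 3 / (8 * c\<^sup>2)) * (1 + (real m)\<^sup>2)) / n)"
      using c by (simp add: mult_left_mono divide_right_mono)
    also have "\<dots> \<le> C * (1 + (real m)\<^sup>2) / n"
    proof -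
      have "1 / sqrt c * (1 / c + 135 / (4 * c ^ 3) + 3 / (8 * c\<^sup>2)) \<le> C" unfolding C_def using c by (simp add: field_simps)
      hence "1 / sqrt c * (1 / c + 135 / (4 * c ^ 3) + 3 / (8 * c\<^sup>2)) * ((1 + (real m)\<^sup>2) / n) \<le> C * ((1 + (real m)\<^sup>2) / n)"
        using n by (intro mult_right_mono) auto
      thus ?thesis by (simp add: mult.assoc)
    qed
    finally show ?thesis .
  qed
  show ?thesis by (rule exI[of _ C]) (use C0 main in auto)
qed

section \<open>Generating function coefficients of the Hermite polynomials\<close>

text \<open>
  The coefficients of $v^j$ in $\exp(n((1+\beta)v-\beta v^2/2))$; the recursion is the
  differential equation of this function.
\<close>

fun coef :: "real \<Rightarrow> complex \<Rightarrow> nat \<Rightarrow> complex" where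
  "coef n \<beta> 0 = 1"
| "coef n \<beta> (Suc 0) = of_real n * (1 + \<beta>)"
| "coef n \<beta> (Suc (Suc j)) =
     (of_real n * (1 + \<beta>) * coef n \<beta> (Suc j) - of_real n * \<beta> * coef n \<beta> j) / of_nat (Suc (Suc j))"

text \<open>
  Cauchy's formula is available on the arc from $0$ to $2\pi$. Applied to $F(-v)$ and
  shifted by $\pi$, it gives the interval that is symmetric about the saddle.
\<close>

lemma mean_value_circle:
  assumes F: "F holomorphic_on UNIV" and x: "x > 0"
  shows "((\<lambda>t. F (of_real x * cis t)) has_integral (2 * of_real pi * F 0)) {-pi..pi}"
proof -
  have "(\<lambda>v. F (- v)) holomorphic_on cball 0 x"
    by (rule holomorphic_on_compose_gen[of uminus _ F UNIV, unfolded comp_def])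
       (auto intro!: holomorphic_intros F)
  hence "((\<lambda>u. F (- u) / (u - 0)) has_contour_integral (2 * of_real pi * \<i> * F (- 0))) (circlepath 0 x)"
    by (rule Cauchy_integral_circlepath_simple) (use x in simp)
  hence "((\<lambda>t. F (- (0 + of_real x * cis t)) / (0 + of_real x * cis t - 0) * of_real x * \<i> * cis t) has_integral
      (2 * of_real pi * \<i> * F (- 0))) {0..2 * pi}"
    unfolding circlepath_def by (subst (asm) has_contour_integral_part_circlepath_iff) auto
  also have "(\<lambda>t. F (- (0 + of_real x * cis t)) / (0 + of_real x * cis t - 0) * of_real x * \<i> * cis t)
     = (\<lambda>t. \<i> * F (- (of_real x * cis t)))"
    using x by (auto simp: fun_eq_iff)
  finally have "((\<lambda>t. - \<i> * (\<i> * F (- (of_real x * cis t)))) has_integral (- \<i> * (2 * of_real pi * \<i> * F (- 0)))) {0..2 * pi}"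
    by (rule has_integral_mult_right)
  also have "(\<lambda>t. - \<i> * (\<i> * F (- (of_real x * cis t)))) = (\<lambda>t. F (of_real x * cis t)) \<circ> ((+) (- pi))"
  proof
    fix t
    have "cis (- pi + t) = - cis t" by (simp add: complex_eq_iff cos_add sin_add)
    thus "- \<i> * (\<i> * F (- (of_real x * cis t))) = ((\<lambda>t. F (of_real x * cis t)) \<circ> ((+) (- pi))) t" by simp
  qed
  finally have "((\<lambda>t. F (of_real x * cis t)) has_integral (- \<i> * (2 * of_real pi * \<i> * F (- 0)))) {-pi..pi}"
    unfolding has_integral_shift_Icc_real by simp
  moreover have "- \<i> * (2 * of_real pi * \<i> * F (- 0)) = 2 * of_real pi * F 0" by simp
  ultimately show ?thesis by (simp only:)
qed

text \<open>
  Both sides satisfy the same recursion: integrating the derivative of $G(v)v^{-j}$ around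
  the circle gives zero. The mean value property supplies the first two values.
\<close>

lemma coef_integral:
  assumes x: "x > 0"
  shows "((\<lambda>t. exp (of_real n * ((1 + \<beta>) * (of_real x * cis t) - \<beta> * (of_real x * cis t)\<^sup>2 / 2)) / (of_real x * cis t) ^ j)
           has_integral (2 * of_real pi * coef n \<beta> j)) {-pi..pi}"
proof -
  define G where "G = (\<lambda>v. exp (of_real n * ((1 + \<beta>) * v - \<beta> * v\<^sup>2 / 2)))"
  define v where "v = (\<lambda>t. of_real x * cis t)"
  have vnz: "v t \<noteq> 0" for t using x by (simp add: v_def)
  have parts: "((\<lambda>t. of_real n * (1 + \<beta>) * (G (v t) * v t / v t ^ j) - of_real n * \<beta> * (G (v t) * (v t)\<^sup>2 / v t ^ j) - of_nat j * (G (v t) / v t ^ j)) has_integral 0) {-pi..pi}" for j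
  proof -
    define f where "f = (\<lambda>s. - \<i> * (G (of_real x * exp (\<i> * s)) / (of_real x * exp (\<i> * s)) ^ j))"
    define f' where "f' = (\<lambda>t. of_real n * (1 + \<beta>) * (G (v t) * v t / v t ^ j) - of_real n * \<beta> * (G (v t) * (v t)\<^sup>2 / v t ^ j) - of_nat j * (G (v t) / v t ^ j))"
    have ve: "of_real x * exp (\<i> * of_real t) = v t" for t by (simp add: v_def cis_conv_exp)
    have dG: "(G has_field_derivative of_real n * ((1 + \<beta>) - \<beta> * w) * G w) (at w)" for w
      unfolding G_def by (rule derivative_eq_intros | simp)+
    have df: "(f has_field_derivative f' t) (at (of_real t))" for t
    proof -
      have "((\<lambda>s. G (of_real x * exp (\<i> * s))) has_field_derivative
          of_real n * ((1 + \<beta>) - \<beta> * v t) * G (v t) * (\<i> * v t)) (at (of_real t))"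
        by (rule DERIV_chain'[of "\<lambda>s. of_real x * exp (\<i> * s)" _ _ _ G])
           (auto intro!: derivative_eq_intros dG[THEN DERIV_cong] simp: ve mult_ac)
      moreover have "((\<lambda>s. (of_real x * exp (\<i> * s)) ^ j) has_field_derivative of_nat j * \<i> * v t ^ j) (at (of_real t))"
      proof -
        have "((\<lambda>s. of_real x * exp (\<i> * s)) has_field_derivative \<i> * v t) (at (of_real t))"
          by (auto intro!: derivative_eq_intros simp: ve mult_ac)
        from DERIV_power[OF this, of j] show ?thesis
          unfolding ve by (rule DERIV_cong) (cases j; simp add: mult_ac)
      qed
      ultimately have "(f has_field_derivative - \<i> * ((of_real n * ((1 + \<beta>) - \<beta> * v t) * G (v t) * (\<i> * v t) * v t ^ j
          - G (v t) * (of_nat j * \<i> * v t ^ j)) / (v t ^ j * v t ^ j))) (at (of_real t))"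
        unfolding f_def using vnz[of t]
        by (intro DERIV_cmult DERIV_divide[THEN DERIV_cong]) (auto simp: ve)
      moreover have "- \<i> * ((of_real n * ((1 + \<beta>) - \<beta> * v t) * G (v t) * (\<i> * v t) * v t ^ j
          - G (v t) * (of_nat j * \<i> * v t ^ j)) / (v t ^ j * v t ^ j)) = f' t"
        unfolding f'_def using vnz[of t] by (simp add: field_simps power2_eq_square)
      ultimately show ?thesis by simp
    qed
    have "(f' has_integral (f (of_real pi) - f (of_real (- pi)))) {-pi..pi}"
    proof (rule fundamental_theorem_of_calculus)
      show "((\<lambda>t. f (of_real t)) has_vector_derivative f' t) (at t within {-pi..pi})" for t
        by (rule has_vector_derivative_real_field[OF df])
    qed simp
    moreover have "f (of_real pi) - f (of_real (- pi)) = 0"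
    proof -
      have "cis (- pi) = cis pi" by (simp add: complex_eq_iff)
      thus ?thesis unfolding f_def ve by (simp add: v_def)
    qed
    ultimately show ?thesis unfolding f'_def by simp
  qed
  have holG: "G holomorphic_on UNIV" unfolding G_def by (intro holomorphic_intros) auto
  have "((\<lambda>t. G (v t) / v t ^ j) has_integral (2 * of_real pi * coef n \<beta> j)) {-pi..pi}"
  proof (induction j rule: induct_nat_012)
    case 0
    show ?case using mean_value_circle[OF holG x] by (simp add: v_def G_def)
  next
    case 1
    have "(\<lambda>w. w * G w) holomorphic_on UNIV" by (intro holomorphic_intros holG)
    from mean_value_circle[OF this x] have z: "((\<lambda>t. G (v t) * v t) has_integral 0) {-pi..pi}" by (simp add: v_def mult.commute)
    have o: "((\<lambda>t. G (v t)) has_integral 2 * of_real pi) {-pi..pi}" using mean_value_circle[OF holG x] by (simp add: v_def G_def)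
    have "((\<lambda>t. of_real n * (1 + \<beta>) * G (v t) - of_real n * \<beta> * (G (v t) * v t) -
       (of_real n * (1 + \<beta>) * (G (v t) * v t / v t ^ 1) - of_real n * \<beta> * (G (v t) * (v t)\<^sup>2 / v t ^ 1) - of_nat 1 * (G (v t) / v t ^ 1)))
       has_integral (of_real n * (1 + \<beta>) * (2 * of_real pi) - of_real n * \<beta> * 0 - 0)) {-pi..pi}"
      by (intro has_integral_diff has_integral_mult_right o z parts)
    moreover have "of_real n * (1 + \<beta>) * G (v t) - of_real n * \<beta> * (G (v t) * v t) -
       (of_real n * (1 + \<beta>) * (G (v t) * v t / v t ^ 1) - of_real n * \<beta> * (G (v t) * (v t)\<^sup>2 / v t ^ 1) - of_nat 1 * (G (v t) / v t ^ 1))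
       = G (v t) / v t ^ Suc 0" for t
      using vnz[of t] by (simp add: field_simps power2_eq_square)
    ultimately have "((\<lambda>t. G (v t) / v t ^ Suc 0) has_integral
        (of_real n * (1 + \<beta>) * (2 * of_real pi) - of_real n * \<beta> * 0 - 0)) {-pi..pi}" by (simp only:)
    moreover have "of_real n * (1 + \<beta>) * (2 * of_real pi) - of_real n * \<beta> * 0 - 0 = 2 * of_real pi * coef n \<beta> (Suc 0)"
      by simp
    ultimately show ?case by (simp only:)
  next
    case (ge2 j)
    let ?j = "Suc (Suc j)"
    have "((\<lambda>t. of_real n * (1 + \<beta>) * (G (v t) / v t ^ Suc j) - of_real n * \<beta> * (G (v t) / v t ^ j) -
       (of_real n * (1 + \<beta>) * (G (v t) * v t / v t ^ ?j) - of_real n * \<beta> * (G (v t) * (v t)\<^sup>2 / v t ^ ?j) - of_nat ?j * (G (v t) / v t ^ ?j)))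
       has_integral (of_real n * (1 + \<beta>) * (2 * of_real pi * coef n \<beta> (Suc j)) - of_real n * \<beta> * (2 * of_real pi * coef n \<beta> j) - 0)) {-pi..pi}"
      by (intro has_integral_diff has_integral_mult_right ge2 parts)
    moreover have "of_real n * (1 + \<beta>) * (G (v t) / v t ^ Suc j) - of_real n * \<beta> * (G (v t) / v t ^ j) -
       (of_real n * (1 + \<beta>) * (G (v t) * v t / v t ^ ?j) - of_real n * \<beta> * (G (v t) * (v t)\<^sup>2 / v t ^ ?j) - of_nat ?j * (G (v t) / v t ^ ?j))
       = of_nat ?j * (G (v t) / v t ^ ?j)" for t
      using vnz[of t] by (simp add: power2_eq_square del: of_nat_Suc)
    ultimately have "((\<lambda>t. of_nat ?j * (G (v t) / v t ^ ?j)) has_integral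
       (of_real n * (1 + \<beta>) * (2 * of_real pi * coef n \<beta> (Suc j)) - of_real n * \<beta> * (2 * of_real pi * coef n \<beta> j) - 0)) {-pi..pi}"
      by (simp only:)
    hence "((\<lambda>t. inverse (of_nat ?j) * (of_nat ?j * (G (v t) / v t ^ ?j))) has_integral
       (inverse (of_nat ?j) * (of_real n * (1 + \<beta>) * (2 * of_real pi * coef n \<beta> (Suc j)) - of_real n * \<beta> * (2 * of_real pi * coef n \<beta> j) - 0))) {-pi..pi}"
      by (rule has_integral_mult_right)
    moreover have "inverse (of_nat ?j) * (of_nat ?j * (G (v t) / v t ^ ?j)) = G (v t) / v t ^ ?j" for t
      by (simp add: mult.assoc[symmetric] del: of_nat_Suc power_Suc)
    moreover have "inverse (of_nat ?j) * (of_real n * (1 + \<beta>) * (2 * of_real pi * coef n \<beta> (Suc j)) - of_real n * \<beta> * (2 * of_real pi * coef n \<beta> j) - 0)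
       = 2 * of_real pi * coef n \<beta> ?j"
      by (simp add: divide_inverse algebra_simps del: of_nat_Suc)
    ultimately show ?case by (simp only:)
  qed
  thus ?thesis by (simp add: G_def v_def)
qed

text \<open>
  Completing squares, $\operatorname{Re}((1+\beta)v-\beta
  v^2/2)=\operatorname{Re}v+\operatorname{Re}\beta/2-\operatorname{Re}(\beta(1-v)^2)/2$, and
  for $|\beta|\le1$ the last term is at most $|1-v|^2/2$. The radius is free and will be
  adapted to the index.
\<close>

lemma norm_coef_le:
  assumes x: "x > 0" and n: "n > 0" and \<beta>: "norm \<beta> \<le> 1"
  shows "norm (coef n \<beta> j) \<le> exp (n * ((1 + x\<^sup>2) / 2 + Re \<beta> / 2)) / x ^ j"
proof -
  let ?B = "exp (n * ((1 + x\<^sup>2) / 2 + Re \<beta> / 2)) / x ^ j"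
  have "norm (exp (of_real n * ((1 + \<beta>) * (of_real x * cis t) - \<beta> * (of_real x * cis t)\<^sup>2 / 2)) / (of_real x * cis t) ^ j) \<le> ?B" for t
  proof -
    let ?v = "of_real x * cis t"
    have "(1 + \<beta>) * ?v - \<beta> * ?v\<^sup>2 / 2 = ?v + \<beta> / 2 - \<beta> * (1 - ?v)\<^sup>2 / 2"
      by (simp add: power2_eq_square field_simps)
    hence e1: "Re ((1 + \<beta>) * ?v - \<beta> * ?v\<^sup>2 / 2) = Re ?v + Re \<beta> / 2 - Re (\<beta> * (1 - ?v)\<^sup>2 / 2)"
      by (simp only: minus_complex.sel plus_complex.sel Re_divide_numeral)
    have e2: "- Re (\<beta> * (1 - ?v)\<^sup>2 / 2) \<le> (norm (1 - ?v))\<^sup>2 / 2"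
    proof -
      have "- Re (\<beta> * (1 - ?v)\<^sup>2 / 2) \<le> norm (\<beta> * (1 - ?v)\<^sup>2 / 2)"
        using abs_Re_le_cmod[of "\<beta> * (1 - ?v)\<^sup>2 / 2"] by linarith
      also have "\<dots> \<le> 1 * (norm (1 - ?v))\<^sup>2 / 2"
        using \<beta> mult_right_mono[OF \<beta>, of "(norm (1 - ?v))\<^sup>2"] by (simp add: norm_divide norm_mult norm_power)
      finally show ?thesis by simp
    qed
    have e3: "(norm (1 - ?v))\<^sup>2 = 1 - 2 * Re ?v + x\<^sup>2"
    proof -
      have "(norm (1 - ?v))\<^sup>2 = (1 - x * cos t)\<^sup>2 + (x * sin t)\<^sup>2" by (simp add: cmod_power2)
      also have "\<dots> = 1 - 2 * (x * cos t) + x\<^sup>2 * ((sin t)\<^sup>2 + (cos t)\<^sup>2)"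
      proof -
        have "(1 - x * a)\<^sup>2 + (x * b)\<^sup>2 = 1 - 2 * (x * a) + x\<^sup>2 * (b\<^sup>2 + a\<^sup>2)" for a b
          by (simp add: power2_eq_square algebra_simps)
        thus ?thesis .
      qed
      also have "x\<^sup>2 * ((sin t)\<^sup>2 + (cos t)\<^sup>2) = x\<^sup>2" by (simp only: sin_cos_squared_add mult_1_right)
      moreover have "Re ?v = x * cos t" by simp
      ultimately show ?thesis by (simp only:)
    qed
    have "Re ((1 + \<beta>) * ?v - \<beta> * ?v\<^sup>2 / 2) \<le> (1 + x\<^sup>2) / 2 + Re \<beta> / 2"
    proof -
      have arith: "b + d / 2 - a \<le> (1 + c) / 2 + d / 2" if "- a \<le> (1 - 2 * b + c) / 2" for a b c d :: real
        using that by (simp add: field_simps)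
      show ?thesis using e2 unfolding e1 e3 by (rule arith)
    qed
    hence "n * Re ((1 + \<beta>) * ?v - \<beta> * ?v\<^sup>2 / 2) \<le> n * ((1 + x\<^sup>2) / 2 + Re \<beta> / 2)" using n by (intro mult_left_mono) auto
    thus ?thesis using x by (simp add: norm_divide norm_mult norm_power divide_right_mono)
  qed
  from has_integral_bound_real[OF _ finite.emptyI coef_integral[OF x, of n \<beta> j] this]
  have "norm (2 * of_real pi * coef n \<beta> j) \<le> ?B * (pi - (- pi))" using x by simp
  hence "2 * pi * norm (coef n \<beta> j) \<le> 2 * pi * ?B" by (simp add: norm_mult mult_ac)
  thus ?thesis by (subst (asm) mult_le_cancel_left_pos) auto
qed

lemma coef_laplace:
  assumes m: "m \<le> d"
  shows "coef (real d) \<beta> (d - m) = exp (of_nat d * (1 + \<beta> / 2)) / (2 * of_real pi) * laplace_integral (real d) \<beta> m"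
proof -
  let ?g = "\<lambda>t. exp (of_real (real d) * phase \<beta> t + \<i> * of_nat m * of_real t)"
  have "set_integrable lborel {-pi..pi} ?g" unfolding set_integrable_def by (rule integrable_laplace)
  from set_borel_integral_eq_integral[OF this]
  have g: "(?g has_integral laplace_integral (real d) \<beta> m) {-pi..pi}"
    unfolding laplace_integral_def set_lebesgue_integral_def by (simp add: has_integral_integral)
  have "((\<lambda>t. exp (of_nat d * (1 + \<beta> / 2)) * ?g t) has_integral exp (of_nat d * (1 + \<beta> / 2)) * laplace_integral (real d) \<beta> m) {-pi..pi}"
    by (rule has_integral_mult_right[OF g])
  moreover have "exp (of_nat d * (1 + \<beta> / 2)) * ?g t
     = exp (of_real (real d) * ((1 + \<beta>) * (of_real 1 * cis t) - \<beta> * (of_real 1 * cis t)\<^sup>2 / 2)) / (of_real 1 * cis t) ^ (d - m)" for t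
  proof -
    have p: "(of_real 1 * cis t) ^ (d - m) = exp (of_nat (d - m) * (\<i> * of_real t))"
      by (simp add: cis_conv_exp exp_of_nat_mult)
    have "of_nat d * (1 + \<beta> / 2) + (of_real (real d) * phase \<beta> t + \<i> * of_nat m * of_real t)
       = of_real (real d) * ((1 + \<beta>) * (of_real 1 * cis t) - \<beta> * (of_real 1 * cis t)\<^sup>2 / 2) - of_nat (d - m) * (\<i> * of_real t)"
      unfolding phase_def of_nat_diff[OF m] by (simp add: power2_eq_square field_simps)
    thus ?thesis unfolding p exp_add[symmetric] exp_diff[symmetric] by simp
  qed
  ultimately have "((\<lambda>t. exp (of_real (real d) * ((1 + \<beta>) * (of_real 1 * cis t) - \<beta> * (of_real 1 * cis t)\<^sup>2 / 2)) / (of_real 1 * cis t) ^ (d - m))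
     has_integral exp (of_nat d * (1 + \<beta> / 2)) * laplace_integral (real d) \<beta> m) {-pi..pi}" by simp
  from has_integral_unique[OF coef_integral[of 1 "real d" \<beta> "d - m"] this]
  have "2 * of_real pi * coef (real d) \<beta> (d - m) = exp (of_nat d * (1 + \<beta> / 2)) * laplace_integral (real d) \<beta> m" by simp
  thus ?thesis by (simp add: field_simps)
qed

text \<open>
  The coefficient with index $d-m$ divided by its leading asymptotics, so that it tends to
  1. It is a holomorphic function of $\beta$ in the unit disc.
\<close>

definition scaled_coef :: "nat \<Rightarrow> nat \<Rightarrow> complex \<Rightarrow> complex" where
  "scaled_coef d m \<beta> = of_real (sqrt (2 * pi * real d)) * csqrt (1 - \<beta>) * exp (- of_nat d * (1 + \<beta> / 2)) * coef (real d) \<beta> (d - m)"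

lemma coef_eq_scaled_coef:
  assumes "d > 0" "\<beta> \<noteq> 1"
  shows "coef (real d) \<beta> (d - m) = exp (of_nat d * (1 + \<beta> / 2)) / (of_real (sqrt (2 * pi * real d)) * csqrt (1 - \<beta>)) * scaled_coef d m \<beta>"
proof -
  have "exp (of_nat d * (1 + \<beta> / 2)) * exp (- of_nat d * (1 + \<beta> / 2)) = 1"
    by (simp add: exp_add[symmetric])
  moreover have "of_real (sqrt (2 * pi * real d)) * csqrt (1 - \<beta>) \<noteq> 0" using assms by simp
  ultimately show ?thesis unfolding scaled_coef_def by (simp add: field_simps)
qed

lemma scaled_coef_laplace:
  assumes "d > 0" "m \<le> d"
  shows "scaled_coef d m \<beta> = of_real (sqrt (real d / (2 * pi))) * csqrt (1 - \<beta>) * laplace_integral (real d) \<beta> m"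
proof -
  have "sqrt (2 * pi * real d) = 2 * pi * sqrt (real d / (2 * pi))"
  proof -
    have "2 * pi * real d = (2 * pi)\<^sup>2 * (real d / (2 * pi))" by (simp add: power2_eq_square)
    hence "sqrt (2 * pi * real d) = sqrt ((2 * pi)\<^sup>2) * sqrt (real d / (2 * pi))" by (simp only: real_sqrt_mult)
    moreover have "sqrt ((2 * pi)\<^sup>2) = 2 * pi" by (rule real_sqrt_unique) simp_all
    ultimately show ?thesis by simp
  qed
  moreover have "exp (- of_nat d * (1 + \<beta> / 2)) * exp (of_nat d * (1 + \<beta> / 2)) = 1"
    by (simp add: exp_add[symmetric])
  ultimately show ?thesis unfolding scaled_coef_def coef_laplace[OF assms(2)] by (simp add: field_simps)
qed

lemma scaled_coef_asymptotics:
  assumes b: "0 \<le> b" "b < 1"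
  obtains C where "C \<ge> 0"
    "\<And>d m \<beta>. d > 0 \<Longrightarrow> m \<le> d \<Longrightarrow> norm \<beta> \<le> b \<Longrightarrow> norm (scaled_coef d m \<beta> - 1) \<le> C * (1 + (real m)\<^sup>2) / real d"
proof -
  obtain C where C: "C \<ge> 0" "\<And>n \<beta> m. n > 0 \<Longrightarrow> norm \<beta> \<le> b \<Longrightarrow>
     norm (of_real (sqrt (n / (2 * pi))) * csqrt (1 - \<beta>) * laplace_integral n \<beta> m - 1) \<le> C * (1 + (real m)\<^sup>2) / n"
    using laplace_asymptotics[OF b] by blast
  show ?thesis
    by (rule that[OF C(1)]) (use C(2) in \<open>simp add: scaled_coef_laplace\<close>)
qed

lemma coef_holomorphic [holomorphic_intros]: "(\<lambda>\<beta>. coef n \<beta> j) holomorphic_on A"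
  by (induction j rule: induct_nat_012) (auto intro!: holomorphic_intros simp del: of_nat_Suc)

lemma cnj_coef: "cnj (coef n \<beta> j) = coef n (cnj \<beta>) j"
  by (induction j rule: induct_nat_012) simp_all

lemma cnj_csqrt_disc:
  assumes "norm \<beta> < 1"
  shows "cnj (csqrt (1 - \<beta>)) = csqrt (1 - cnj \<beta>)"
proof -
  have "1 - \<beta> \<notin> \<real>\<^sub>\<le>\<^sub>0"
    using assms complex_Re_le_cmod[of \<beta>] by (auto elim!: nonpos_Reals_cases simp: complex_eq_iff)
  thus ?thesis by (simp add: cnj_csqrt)
qed

lemma cnj_scaled_coef:
  assumes "norm \<beta> < 1"
  shows "cnj (scaled_coef d m \<beta>) = scaled_coef d m (cnj \<beta>)"
  unfolding scaled_coef_def using cnj_csqrt_disc[OF assms] by (simp add: cnj_coef exp_cnj)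

lemma scaled_coef_holomorphic: "scaled_coef d m holomorphic_on ball 0 1"
proof -
  have "1 - \<beta> \<notin> \<real>\<^sub>\<le>\<^sub>0" if "norm \<beta> < 1" for \<beta> :: complex
    using that complex_Re_le_cmod[of \<beta>] by (auto elim!: nonpos_Reals_cases simp: complex_eq_iff)
  thus ?thesis unfolding scaled_coef_def by (auto intro!: holomorphic_intros)
qed

section \<open>Uniform control of the normalised coefficients\<close>

text \<open>
  A crude form of Stirling's upper bound; the induction step is $e\le(1+1/k)^{k+1}$.
\<close>

lemma fact_exp_le: "1 \<le> k \<Longrightarrow> fact k * exp (real k) \<le> exp 1 * real k ^ (k + 1)"
proof (induction k rule: nat_induct_at_least)
  case (Suc k)
  have k: "real k > 0" using Suc by simp
  have e1: "exp 1 \<le> (1 + 1 / real k) ^ (k + 1)"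
  proof -
    have "- ln (1 + 1 / real k) = ln (1 / (1 + 1 / real k))" using k by (simp add: ln_div)
    also have "\<dots> \<le> 1 / (1 + 1 / real k) - 1" using k by (intro ln_le_minus_one) (auto simp: field_simps add_pos_pos)
    also have "\<dots> = - 1 / (real k + 1)" using k by (simp add: field_simps)
    finally have "1 / (real k + 1) \<le> ln (1 + 1 / real k)" by simp
    hence "(real k + 1) * (1 / (real k + 1)) \<le> (real k + 1) * ln (1 + 1 / real k)" by (intro mult_left_mono) auto
    hence "1 \<le> (real k + 1) * ln (1 + 1 / real k)" by simp
    hence "exp 1 \<le> exp ((real k + 1) * ln (1 + 1 / real k))" by simp
    also have "\<dots> = exp (ln (1 + 1 / real k)) ^ (k + 1)" using exp_of_nat_mult[of "k + 1" "ln (1 + 1 / real k)"] by (simp only: of_nat_add of_nat_1)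
    also have "\<dots> = (1 + 1 / real k) ^ (k + 1)" using k by (subst exp_ln) (auto simp: add_pos_pos)
    finally show ?thesis .
  qed
  have "fact (Suc k) * exp (real (Suc k)) = (real k + 1) * exp 1 * (fact k * exp (real k))"
    by (simp add: exp_add algebra_simps)
  also have "\<dots> \<le> (real k + 1) * (1 + 1 / real k) ^ (k + 1) * (exp 1 * real k ^ (k + 1))"
    by (rule mult_mono[OF mult_left_mono[OF e1] Suc.IH]) auto
  also have "\<dots> = (real k + 1) * (exp 1 * ((1 + 1 / real k) * real k) ^ (k + 1))"
    by (simp only: power_mult_distrib mult_ac)
  also have "(1 + 1 / real k) * real k = real k + 1" using k by (simp add: field_simps)
  also have "(real k + 1) * (exp 1 * (real k + 1) ^ (k + 1)) = exp 1 * real (Suc k) ^ (Suc k + 1)"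
    by (simp add: add.commute mult_ac)
  finally show ?case .
qed simp

text \<open>
  The double factorial $(2k)!!/(2N)^k=k!/N^k$, and below $(2k-1)!!/(2N)^k$. Up to common
  factors, these are the coefficients of the skew-orthogonal polynomials.
\<close>

definition even_weight :: "nat \<Rightarrow> nat \<Rightarrow> real" where
  "even_weight N k = (\<Prod>i<k. real (2 * i + 2) / real (2 * N))"

definition odd_weight :: "nat \<Rightarrow> nat \<Rightarrow> real" where
  "odd_weight N k = (\<Prod>i<k. real (2 * i + 1) / real (2 * N))"

lemma even_weight_pos: "N > 0 \<Longrightarrow> even_weight N k > 0"
  and odd_weight_pos: "N > 0 \<Longrightarrow> odd_weight N k > 0"
  unfolding even_weight_def odd_weight_def by (intro prod_pos; simp)+

lemma even_weight_eq: "N > 0 \<Longrightarrow> even_weight N k = fact k / real N ^ k"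
  unfolding even_weight_def by (induction k) (auto simp: field_simps)

lemma weight_product: "N > 0 \<Longrightarrow> even_weight N k * odd_weight N k = fact (2 * k) / real (2 * N) ^ (2 * k)"
proof (induction k)
  case (Suc k)
  have "even_weight N (Suc k) * odd_weight N (Suc k) = even_weight N k * odd_weight N k * (real (2 * k + 2) * real (2 * k + 1) / (real (2 * N))\<^sup>2)"
    by (simp add: even_weight_def odd_weight_def power2_eq_square)
  also have "\<dots> = fact (2 * Suc k) / real (2 * N) ^ (2 * Suc k)"
    unfolding Suc.IH[OF Suc.prems] using Suc.prems by (simp add: power2_eq_square field_simps)
  finally show ?case .
qed (simp add: even_weight_def odd_weight_def)

lemma exp_le_even_weight:
  assumes "N > 0" shows "exp (- real N) \<le> even_weight N (N - 1)"
proof -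
  have "real N ^ N / fact N \<le> exp (real N)"
  proof -
    have s: "(\<lambda>n. real N ^ n /\<^sub>R fact n) sums exp (real N)" by (rule exp_converges)
    have "(\<Sum>n\<in>{N}. real N ^ n /\<^sub>R fact n) \<le> (\<Sum>n. real N ^ n /\<^sub>R fact n)"
      by (rule sum_le_suminf[OF sums_summable[OF s]]) auto
    also have "\<dots> = exp (real N)" using sums_unique[OF s] by simp
    finally have "real N ^ N /\<^sub>R fact N \<le> exp (real N)" by simp
    thus ?thesis by (simp add: divide_inverse mult.commute)
  qed
  hence "exp (- real N) \<le> fact N / real N ^ N"
    using assms by (simp add: exp_minus field_simps)
  also have "fact N / real N ^ N = even_weight N (N - 1)"
    unfolding even_weight_eq[OF assms] using assms by (cases N) (simp_all del: of_nat_Suc)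
  finally show ?thesis .
qed

lemma odd_weight_le_even_weight: "odd_weight N k \<le> even_weight N k"
  unfolding odd_weight_def even_weight_def by (intro prod_mono) (auto intro!: divide_right_mono)

lemma even_weight_le_odd_weight: "N > 0 \<Longrightarrow> even_weight N k \<le> real (2 * N) * odd_weight N (Suc k)"
proof (induction k)
  case 0
  thus ?case by (simp add: odd_weight_def even_weight_def)
next
  case (Suc k)
  have "even_weight N (Suc k) = even_weight N k * (real (2 * k + 2) / real (2 * N))" by (simp add: even_weight_def)
  also have "\<dots> \<le> real (2 * N) * odd_weight N (Suc k) * (real (2 * Suc k + 1) / real (2 * N))"
    using Suc odd_weight_pos[of N "Suc k"] by (intro mult_mono divide_right_mono) auto
  also have "real (2 * N) * odd_weight N (Suc k) * (real (2 * Suc k + 1) / real (2 * N)) = real (2 * N) * odd_weight N (Suc (Suc k))"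
    unfolding odd_weight_def prod.lessThan_Suc[of _ "Suc k"] by (simp only: mult.assoc)
  finally show ?case .
qed

lemma exp_le_odd_weight:
  assumes "N > 0" shows "exp (- real N) \<le> real (2 * N) * odd_weight N (N - 1)"
proof (cases "N - 1")
  case 0
  have "exp (- real N) \<le> 1" by simp
  also have "\<dots> \<le> real (2 * N) * odd_weight N (N - 1)" using assms unfolding 0 by (simp add: odd_weight_def)
  finally show ?thesis .
next
  case (Suc k)
  have "even_weight N (Suc k) = even_weight N k * (real (2 * k + 2) / real (2 * N))" by (simp add: even_weight_def)
  also have "\<dots> \<le> even_weight N k * 1"
    using even_weight_pos[OF assms, of k] Suc by (intro mult_left_mono) auto
  also have "\<dots> \<le> real (2 * N) * odd_weight N (Suc k)" using even_weight_le_odd_weight[OF assms] by simp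
  finally show ?thesis using exp_le_even_weight[OF assms] Suc by simp
qed

text \<open>
  Each of the $a$ factors of $1/q$ is at least $1-(2a+1)/2N$, and Bernoulli's inequality
  bounds their product. The assumption on $f$ covers both double factorials.
\<close>

lemma weight_ratio_bounds:
  fixes f :: "nat \<Rightarrow> real"
  assumes f: "\<And>i. i < N \<Longrightarrow> real (2 * i + 1) / real (2 * N) \<le> f i" "\<And>i. i < N \<Longrightarrow> f i \<le> 1"
    and a: "a < N"
  defines "q \<equiv> (\<Prod>i<N - 1 - a. f i) / (\<Prod>i<N - 1. f i)"
  shows "1 \<le> q" "1 - 4 * (1 + real a)\<^sup>2 / real N \<le> 1 / q" "0 < 1 / q"
proof -
  have N: "N > 0" using a by simp
  have fpos: "f i > 0" if "i < N" for i
  proof -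
    have "0 < real (2 * i + 1) / real (2 * N)" using N by simp
    thus ?thesis using f(1)[OF that] by (rule less_le_trans)
  qed
  have ppos: "(\<Prod>i<N - 1 - a. f i) > 0" by (intro prod_pos) (auto intro: fpos)
  have split: "(\<Prod>i<N - 1. f i) = (\<Prod>i<N - 1 - a. f i) * (\<Prod>i\<in>{N - 1 - a..<N - 1}. f i)"
    using prod.atLeastLessThan_concat[of 0 "N - 1 - a" "N - 1" f] by (simp add: atLeast0LessThan)
  have q: "1 / q = (\<Prod>i\<in>{N - 1 - a..<N - 1}. f i)"
  proof -
    have cancel: "1 / (x / (x * y)) = y" if "x > 0" for x y :: real using that by simp
    show ?thesis unfolding q_def split by (rule cancel[OF ppos])
  qed
  have pos: "(\<Prod>i\<in>{N - 1 - a..<N - 1}. f i) > 0" by (intro prod_pos) (auto intro: fpos)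
  thus "0 < 1 / q" using q by simp
  have "(\<Prod>i\<in>{N - 1 - a..<N - 1}. f i) \<le> 1" by (intro prod_le_1) (auto intro!: f(2) less_imp_le[OF fpos])
  hence "1 / q \<le> 1" using q by simp
  thus "1 \<le> q" using \<open>0 < 1 / q\<close> by (simp add: field_simps)
  define y where "y = (2 * real a + 1) / (2 * real N)"
  have y: "0 \<le> y" "y \<le> 1" unfolding y_def using a N by (auto simp: field_simps)
  have "1 - 4 * (1 + real a)\<^sup>2 / real N \<le> 1 + of_nat a * (- y)"
  proof -
    have "real a * (2 * real a + 1) \<le> 8 * (1 + real a)\<^sup>2" by (simp add: power2_eq_square algebra_simps)
    hence "real a * (2 * real a + 1) / (2 * real N) \<le> 8 * (1 + real a)\<^sup>2 / (2 * real N)" by (intro divide_right_mono) auto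
    thus ?thesis by (simp add: y_def)
  qed
  also have "\<dots> \<le> (1 + (- y)) ^ a" by (rule Bernoulli_inequality) (use y in simp)
  also have "\<dots> = (\<Prod>i\<in>{N - 1 - a..<N - 1}. 1 - y)" using a by simp
  also have "\<dots> \<le> (\<Prod>i\<in>{N - 1 - a..<N - 1}. f i)"
  proof (rule prod_mono)
    fix i assume i: "i \<in> {N - 1 - a..<N - 1}"
    have "N \<le> i + a + 1" using i by auto
    hence "real N \<le> real (i + a + 1)" by (simp only: of_nat_le_iff)
    hence "real N \<le> real i + real a + 1" by simp
    hence "(2 * real N - 2 * real a - 1) / (2 * real N) \<le> real (2 * i + 1) / real (2 * N)"
      by (simp add: divide_right_mono)
    moreover have "1 - y = (2 * real N - 2 * real a - 1) / (2 * real N)" unfolding y_def using N by (simp add: field_simps)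
    ultimately have "1 - y \<le> real (2 * i + 1) / real (2 * N)" by simp
    also have "\<dots> \<le> f i" by (rule f(1)) (use i in auto)
    finally show "0 \<le> 1 - y \<and> 1 - y \<le> f i" using y by simp
  qed
  finally show "1 - 4 * (1 + real a)\<^sup>2 / real N \<le> 1 / q" unfolding q .
qed

text \<open>
  The bound on the circle of radius $x$ with $x^2=(k+1)/N$, which is nearly optimal for an
  index near $2k$.
\<close>

lemma norm_scaled_coef_le:
  assumes N: "N > 0" and k: "k < N" and d: "2 * N - m = 2 * k \<or> 2 * N - m = 2 * k + 1" and \<beta>: "norm \<beta> \<le> 1"
  shows "norm (scaled_coef (2 * N) m \<beta>) \<le> sqrt (8 * pi * real N) * exp (- real N) * (real N / real (k + 1)) ^ (k + 1) * exp (real (k + 1))"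
proof -
  \<comment> \<open>k + 1 instead of k keeps the radius positive for k = 0\<close>
  define x where "x = sqrt (real (k + 1) / real N)"
  have x: "x > 0" "x\<^sup>2 = real (k + 1) / real N" "x \<le> 1"
    using N k by (auto simp: x_def)
  let ?j = "2 * N - m"
  have "norm (coef (real (2 * N)) \<beta> ?j) \<le> exp (real (2 * N) * ((1 + x\<^sup>2) / 2 + Re \<beta> / 2)) / x ^ ?j"
    by (rule norm_coef_le) (use N x \<beta> in auto)
  also have "\<dots> \<le> exp (real (2 * N) * ((1 + x\<^sup>2) / 2 + Re \<beta> / 2)) / x ^ (2 * (k + 1))"
  proof (intro divide_left_mono)
    show "x ^ (2 * (k + 1)) \<le> x ^ ?j" using d x by (intro power_decreasing) auto
  qed (use x in auto)
  also have "x ^ (2 * (k + 1)) = (real (k + 1) / real N) ^ (k + 1)" unfolding power_mult x(2) ..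
  also have "real (2 * N) * ((1 + x\<^sup>2) / 2 + Re \<beta> / 2) = real N + real (k + 1) + real N * Re \<beta>"
    unfolding x(2) using N by (simp add: field_simps)
  finally have c: "norm (coef (real (2 * N)) \<beta> ?j) \<le> exp (real N + real (k + 1) + real N * Re \<beta>) * (real N / real (k + 1)) ^ (k + 1)"
    by (simp add: power_divide)
  have s: "sqrt (2 * pi * real (2 * N)) * sqrt (norm (1 - \<beta>)) \<le> sqrt (8 * pi * real N)"
  proof -
    have "norm (1 - \<beta>) \<le> 2" using norm_triangle_ineq4[of 1 \<beta>] \<beta> by simp
    hence "2 * pi * real (2 * N) * norm (1 - \<beta>) \<le> 2 * pi * real (2 * N) * 2" by (intro mult_left_mono) auto
    thus ?thesis unfolding real_sqrt_mult[symmetric] by (intro real_sqrt_le_mono) simp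
  qed
  have "norm (scaled_coef (2 * N) m \<beta>) = (sqrt (2 * pi * real (2 * N)) * sqrt (norm (1 - \<beta>))) * exp (- real (2 * N) * (1 + Re \<beta> / 2)) * norm (coef (real (2 * N)) \<beta> ?j)"
    unfolding scaled_coef_def norm_mult by (simp add: norm_csqrt)
  also have "\<dots> \<le> sqrt (8 * pi * real N) * exp (- real (2 * N) * (1 + Re \<beta> / 2)) * (exp (real N + real (k + 1) + real N * Re \<beta>) * (real N / real (k + 1)) ^ (k + 1))"
    by (intro mult_mono s c) auto
  also have "\<dots> = sqrt (8 * pi * real N) * (exp (- real (2 * N) * (1 + Re \<beta> / 2)) * exp (real N + real (k + 1) + real N * Re \<beta>)) * (real N / real (k + 1)) ^ (k + 1)"
    by (simp only: mult_ac)
  also have "exp (- real (2 * N) * (1 + Re \<beta> / 2)) * exp (real N + real (k + 1) + real N * Re \<beta>) = exp (- real N) * exp (real (k + 1))"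
    unfolding exp_add[symmetric] by (simp add: algebra_simps)
  finally show ?thesis by (simp add: mult_ac)
qed

text \<open>
  For indices far from the top the weight grows exponentially, while the coefficient decays
  by cancellation in its integral. The optimal radius shows that the exponential factors
  cancel exactly, leaving a power of $N$.
\<close>

lemma norm_weighted_coef_le:
  assumes N: "N > 0" and a: "a < N" and m: "m = 2 * a + 1 \<or> m = 2 * a + 2" and \<beta>: "norm \<beta> \<le> 1"
    and q: "0 \<le> q" "q \<le> real (2 * N) * exp (real N) * even_weight N (N - 1 - a)"
  shows "norm (of_real q * scaled_coef (2 * N) m \<beta>) \<le> 2 * exp 1 * sqrt (8 * pi) * real N ^ 3"
proof -
  define k where "k = N - 1 - a"
  have k: "k < N" "2 * N - m = 2 * k \<or> 2 * N - m = 2 * k + 1" using a m by (auto simp: k_def)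
  let ?K = "real (k + 1)"
  have "norm (of_real q * scaled_coef (2 * N) m \<beta>) = q * norm (scaled_coef (2 * N) m \<beta>)" using q by (simp add: norm_mult)
  also have "\<dots> \<le> (real (2 * N) * exp (real N) * even_weight N k) *
     (sqrt (8 * pi * real N) * exp (- real N) * (real N / ?K) ^ (k + 1) * exp ?K)"
    using q(2) unfolding k_def[symmetric]
    by (intro mult_mono norm_scaled_coef_le[OF N k \<beta>]) (use N even_weight_pos[OF N, of k] in \<open>auto intro!: mult_nonneg_nonneg less_imp_le\<close>)
  also have "\<dots> = 2 * (real N)\<^sup>2 * sqrt (8 * pi * real N) * (fact (k + 1) * exp ?K / ?K ^ (k + 2))"
  proof -
    have e: "exp (real N) * exp (- real N) = 1" by (simp add: exp_add[symmetric])
    have f: "fact (k + 1) = ?K * fact k" by simp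
    have "(real (2 * N) * exp (real N) * even_weight N k) * (sqrt (8 * pi * real N) * exp (- real N) * (real N / ?K) ^ (k + 1) * exp ?K)
       = (exp (real N) * exp (- real N)) * (2 * real N * (fact k / real N ^ k) * sqrt (8 * pi * real N) * (real N ^ (k + 1) / ?K ^ (k + 1)) * exp ?K)"
      unfolding even_weight_eq[OF N] power_divide by (simp add: mult_ac)
    also have "\<dots> = 2 * (real N)\<^sup>2 * sqrt (8 * pi * real N) * (fact k * exp ?K / ?K ^ (k + 1))"
      unfolding e using N by (simp add: power2_eq_square)
    also have "fact k * exp ?K / ?K ^ (k + 1) = fact (k + 1) * exp ?K / ?K ^ (k + 2)"
      unfolding f by (simp add: power_add) 
    finally show ?thesis .
  qed
  also have "\<dots> \<le> 2 * (real N)\<^sup>2 * sqrt (8 * pi * real N) * exp 1"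
  proof (rule mult_left_mono)
    have "fact (k + 1) * exp ?K \<le> exp 1 * ?K ^ (k + 1 + 1)" by (rule fact_exp_le) simp
    thus "fact (k + 1) * exp ?K / ?K ^ (k + 2) \<le> exp 1" by (simp add: pos_divide_le_eq)
  qed simp
  also have "sqrt (8 * pi * real N) \<le> sqrt (8 * pi) * real N"
  proof -
    have "sqrt (real N) \<le> real N" using N by (intro real_le_lsqrt) (auto simp: power2_eq_square)
    thus ?thesis by (simp add: real_sqrt_mult)
  qed
  hence "2 * (real N)\<^sup>2 * sqrt (8 * pi * real N) * exp 1 \<le> 2 * (real N)\<^sup>2 * (sqrt (8 * pi) * real N) * exp 1"
    by (intro mult_right_mono mult_left_mono) auto
  also have "2 * (real N)\<^sup>2 * (sqrt (8 * pi) * real N) * exp 1 = 2 * exp 1 * sqrt (8 * pi) * real N ^ 3"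
    by (simp add: power2_eq_square power3_eq_cube mult_ac)
  finally show ?thesis .
qed

text \<open>
  If $8(1+a)^2\le N$, both factors are close to 1. Otherwise $N$ itself is at most
  $8(1+a)^2$, and the polynomial bound $N^3$ can be traded for $(1+a)^8/N$: this is where
  the exponent 8 and the constant $4096=8^4$ come from.
\<close>

lemma weighted_coef_close_to_1:
  fixes q N C D :: real and K :: complex and a m :: nat
  assumes N: "N \<ge> 1" and C: "C \<ge> 0" and D: "D \<ge> 0" and q: "1 \<le> q" "1 - 4 * (1 + real a)\<^sup>2 / N \<le> 1 / q"
    and m: "real m \<le> 2 * (1 + real a)" and K: "norm (K - 1) \<le> C * (1 + (real m)\<^sup>2) / (2 * N)"
    and crude: "norm (of_real q * K) \<le> D * N ^ 3"
  shows "norm (of_real q * K - 1) \<le> (5 * C + 8 + 4096 * (D + 1)) * (1 + real a) ^ 8 / N"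
proof -
  define s where "s = (1 + real a)\<^sup>2"
  have s1: "s \<ge> 1" unfolding s_def by (simp add: power2_eq_square algebra_simps)
  have s4: "(1 + real a) ^ 8 = s ^ 4" unfolding s_def by (simp flip: power_mult)
  have ss4: "s \<le> s ^ 4" using power_increasing[of 1 4 s] s1 by simp
  show ?thesis
  proof (cases "8 * s \<le> N")
    case True
    have "4 * s / N \<le> 1 / 2" using True N by (simp add: field_simps)
    hence "1 / 2 \<le> 1 / q" using q(2) unfolding s_def[symmetric] by simp
    hence q2: "q \<le> 2" using q(1) by (simp add: field_simps)
    have "q - 1 = q * (1 - 1 / q)" using q(1) by (simp add: field_simps)
    also have "\<dots> \<le> 2 * (4 * s / N)" using q q2 s1 N unfolding s_def[symmetric] by (intro mult_mono) auto
    finally have q1: "q - 1 \<le> 8 * s / N" by simp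
    have m2: "1 + (real m)\<^sup>2 \<le> 5 * s"
    proof -
      have "(real m)\<^sup>2 \<le> (2 * (1 + real a))\<^sup>2" using m by (intro power_mono) auto
      also have "\<dots> = 4 * s" unfolding s_def by (simp only: power_mult_distrib) simp
      finally show ?thesis using s1 by simp
    qed
    have "of_real q * K - 1 = of_real q * (K - 1) + of_real (q - 1)" by (simp add: algebra_simps)
    also have "norm \<dots> \<le> norm (of_real q * (K - 1)) + norm (complex_of_real (q - 1))"
      by (rule norm_triangle_ineq)
    also have "\<dots> = q * norm (K - 1) + (q - 1)"
      using q(1) by (simp only: norm_mult norm_of_real)
    also have "\<dots> \<le> 2 * (C * (5 * s) / (2 * N)) + 8 * s / N"
    proof (intro add_mono mult_mono q1 q2)
      have "C * (1 + (real m)\<^sup>2) \<le> C * (5 * s)" using m2 C by (intro mult_left_mono) auto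
      hence "C * (1 + (real m)\<^sup>2) / (2 * N) \<le> C * (5 * s) / (2 * N)" using N by (intro divide_right_mono) auto
      thus "norm (K - 1) \<le> C * (5 * s) / (2 * N)" using K by linarith
    qed auto
    also have "\<dots> = (5 * C + 8) * s / N" using N by (simp add: field_simps)
    also have "\<dots> \<le> (5 * C + 8 + 4096 * (D + 1)) * s ^ 4 / N"
      using N C D ss4 s1 by (intro divide_right_mono mult_mono) auto
    finally show ?thesis unfolding s4 .
  next
    case False
    hence Ns: "N \<le> 8 * s" by simp
    have "norm (of_real q * K - 1) \<le> D * N ^ 3 + 1"
      using crude norm_triangle_ineq4[of "of_real q * K" 1] by simp
    also have "\<dots> \<le> (D + 1) * N ^ 3" using N by (simp add: algebra_simps)
    also have "\<dots> = (D + 1) * N ^ 4 / N" using N by (simp add: power3_eq_cube power4_eq_xxxx)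
    also have "\<dots> \<le> (D + 1) * (8 * s) ^ 4 / N"
      using N D Ns by (intro divide_right_mono mult_left_mono power_mono) auto
    also have "\<dots> = (4096 * (D + 1)) * s ^ 4 / N" by (simp add: power_mult_distrib mult_ac)
    also have "\<dots> \<le> (5 * C + 8 + 4096 * (D + 1)) * s ^ 4 / N"
      using N C s1 by (intro divide_right_mono mult_right_mono) auto
    finally show ?thesis unfolding s4 .
  qed
qed

text \<open>
  The factors that multiply the geometric terms, indexed by the distance $a$ from the top
  degree: the odd Hermite polynomial of degree $2(N-1-a)+1=2N-(2a+1)$ and the even one of
  degree $2N-(2a+2)$, each with the weight in front of it divided by the weight of the top
  degree.
\<close>

definition odd_profile :: "nat \<Rightarrow> nat \<Rightarrow> complex \<Rightarrow> complex" where
  "odd_profile N a \<beta> = of_real (even_weight N (N - 1 - a) / even_weight N (N - 1)) * scaled_coef (2 * N) (2 * a + 1) \<beta>"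

definition even_profile :: "nat \<Rightarrow> nat \<Rightarrow> complex \<Rightarrow> complex" where
  "even_profile N a \<beta> = of_real (odd_weight N (N - 1 - a) / odd_weight N (N - 1)) * scaled_coef (2 * N) (2 * a + 2) \<beta>"

lemma profile_bounds:
  assumes b: "0 \<le> b" "b < 1"
  obtains C where "C \<ge> 0"
    "\<And>N a \<beta>. a < N \<Longrightarrow> norm \<beta> \<le> b \<Longrightarrow> norm (odd_profile N a \<beta> - 1) \<le> C * (1 + real a) ^ 8 / real N"
    "\<And>N a \<beta>. a < N \<Longrightarrow> norm \<beta> \<le> b \<Longrightarrow> norm (even_profile N a \<beta> - 1) \<le> C * (1 + real a) ^ 8 / real N"
proof -
  obtain C where C: "C \<ge> 0"
    "\<And>d m \<beta>. d > 0 \<Longrightarrow> m \<le> d \<Longrightarrow> norm \<beta> \<le> b \<Longrightarrow> norm (scaled_coef d m \<beta> - 1) \<le> C * (1 + (real m)\<^sup>2) / real d"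
    using scaled_coef_asymptotics[OF b] by blast
  define D where "D = 2 * exp 1 * sqrt (8 * pi)"
  have D: "D \<ge> 0" by (simp add: D_def)
  let ?C = "5 * C + 8 + 4096 * (D + 1)"
  show ?thesis
  proof (rule that[of ?C])
    show "?C \<ge> 0" using C D by simp
    fix N a :: nat and \<beta> :: complex
    assume a: "a < N" and \<beta>: "norm \<beta> \<le> b"
    have N: "N > 0" using a by simp
    have \<beta>1: "norm \<beta> \<le> 1" using \<beta> b by simp
    let ?q = "even_weight N (N - 1 - a) / even_weight N (N - 1)"
    have q: "1 \<le> ?q" "1 - 4 * (1 + real a)\<^sup>2 / real N \<le> 1 / ?q"
      unfolding even_weight_def by (rule weight_ratio_bounds[OF _ _ a]; auto intro!: divide_right_mono)+
    have "even_weight N (N - 1 - a) * 1 \<le> even_weight N (N - 1 - a) * (real (2 * N) * exp (real N) * even_weight N (N - 1))"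
    proof (rule mult_left_mono)
      have "1 \<le> exp (real N) * even_weight N (N - 1)"
        using mult_left_mono[OF exp_le_even_weight[OF N], of "exp (real N)"] by (simp add: exp_add[symmetric] flip: exp_add)
      also have "\<dots> \<le> real (2 * N) * (exp (real N) * even_weight N (N - 1))"
        using N even_weight_pos[OF N, of "N - 1"] mult_right_mono[of 1 "real (2 * N)" "exp (real N) * even_weight N (N - 1)"] by simp
      finally show "1 \<le> real (2 * N) * exp (real N) * even_weight N (N - 1)" by (simp add: mult.assoc)
    qed (use even_weight_pos[OF N] less_imp_le in blast)
    hence q': "?q \<le> real (2 * N) * exp (real N) * even_weight N (N - 1 - a)"
      using even_weight_pos[OF N, of "N - 1"] by (simp add: pos_divide_le_eq mult_ac)
    show "norm (odd_profile N a \<beta> - 1) \<le> ?C * (1 + real a) ^ 8 / real N"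
      unfolding odd_profile_def
    proof (rule weighted_coef_close_to_1[OF _ C(1) D q])
      show "norm (scaled_coef (2 * N) (2 * a + 1) \<beta> - 1) \<le> C * (1 + (real (2 * a + 1))\<^sup>2) / (2 * real N)"
        using C(2)[of "2 * N" "2 * a + 1" \<beta>] a \<beta> by simp
      show "norm (of_real ?q * scaled_coef (2 * N) (2 * a + 1) \<beta>) \<le> D * real N ^ 3"
        unfolding D_def by (rule norm_weighted_coef_le[OF N a _ \<beta>1 _ q']) (use q in auto)
    qed (use N in auto)
    let ?q = "odd_weight N (N - 1 - a) / odd_weight N (N - 1)"
    have q: "1 \<le> ?q" "1 - 4 * (1 + real a)\<^sup>2 / real N \<le> 1 / ?q"
      unfolding odd_weight_def by (rule weight_ratio_bounds[OF _ _ a]; auto intro!: divide_right_mono)+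
    have "odd_weight N (N - 1 - a) * 1 \<le> even_weight N (N - 1 - a) * (real (2 * N) * exp (real N) * odd_weight N (N - 1))"
    proof (rule mult_mono)
      have "1 \<le> exp (real N) * (real (2 * N) * odd_weight N (N - 1))"
        using mult_left_mono[OF exp_le_odd_weight[OF N], of "exp (real N)"] by (simp add: exp_add[symmetric] flip: exp_add)
      thus "1 \<le> real (2 * N) * exp (real N) * odd_weight N (N - 1)" by (simp add: mult_ac)
    qed (use even_weight_pos[OF N] less_imp_le odd_weight_le_even_weight in auto)
    hence q': "?q \<le> real (2 * N) * exp (real N) * even_weight N (N - 1 - a)"
      using odd_weight_pos[OF N, of "N - 1"] by (simp add: pos_divide_le_eq mult_ac)
    show "norm (even_profile N a \<beta> - 1) \<le> ?C * (1 + real a) ^ 8 / real N"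
      unfolding even_profile_def
    proof (rule weighted_coef_close_to_1[OF _ C(1) D q])
      show "norm (scaled_coef (2 * N) (2 * a + 2) \<beta> - 1) \<le> C * (1 + (real (2 * a + 2))\<^sup>2) / (2 * real N)"
        using C(2)[of "2 * N" "2 * a + 2" \<beta>] a \<beta> by simp
      show "norm (of_real ?q * scaled_coef (2 * N) (2 * a + 2) \<beta>) \<le> D * real N ^ 3"
        unfolding D_def by (rule norm_weighted_coef_le[OF N a _ \<beta>1 _ q']) (use q in auto)
    qed (use N in auto)
  qed
qed

text \<open>
  Compare $f(\beta)$ with the real number $f(\operatorname{Re}\beta)$ and bound the
  derivative by Cauchy's estimate on discs of radius $(1-b)/2$.
\<close>

lemma abs_Im_le_of_real_on_reals:
  fixes f :: "complex \<Rightarrow> complex"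
  assumes hol: "f holomorphic_on ball 0 1" and sym: "\<And>\<beta>. norm \<beta> < 1 \<Longrightarrow> cnj (f \<beta>) = f (cnj \<beta>)"
    and b: "0 \<le> b" "b < 1" and bd: "\<And>\<beta>. norm \<beta> \<le> (1 + b) / 2 \<Longrightarrow> norm (f \<beta> - 1) \<le> B"
    and \<beta>: "norm \<beta> \<le> b"
  shows "\<bar>Im (f \<beta>)\<bar> \<le> 2 / (1 - b) * B * \<bar>Im \<beta>\<bar>"
proof -
  let ?r = "(1 - b) / 2"
  have r: "?r > 0" using b by simp
  have der: "norm (deriv f \<xi>) \<le> 2 / (1 - b) * B" if \<xi>: "norm \<xi> \<le> b" for \<xi>
  proof -
    have sub: "cball \<xi> ?r \<subseteq> ball 0 1"
    proof
      fix w assume "w \<in> cball \<xi> ?r"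
      hence "norm (w - \<xi>) \<le> ?r" by (simp add: dist_norm norm_minus_commute)
      moreover have "norm w \<le> norm \<xi> + norm (w - \<xi>)" using norm_triangle_ineq[of \<xi> "w - \<xi>"] by simp
      ultimately have "norm w \<le> norm \<xi> + ?r" by linarith
      thus "w \<in> ball 0 1" using \<xi> b by (simp add: field_simps)
    qed
    have hol': "(\<lambda>w. f w - 1) holomorphic_on ball 0 1" by (intro holomorphic_intros hol)
    have "norm ((deriv ^^ 1) (\<lambda>w. f w - 1) \<xi>) \<le> fact 1 * B / ?r ^ 1"
    proof (rule Cauchy_inequality)
      show "(\<lambda>w. f w - 1) holomorphic_on ball \<xi> ?r" using hol' sub ball_subset_cball by (meson holomorphic_on_subset)
      show "continuous_on (cball \<xi> ?r) (\<lambda>w. f w - 1)" using hol' sub by (meson holomorphic_on_imp_continuous_on holomorphic_on_subset)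
      show "norm (f x - 1) \<le> B" if "norm (\<xi> - x) = ?r" for x
      proof (rule bd)
        have "norm x \<le> norm \<xi> + norm (\<xi> - x)" using norm_triangle_ineq4[of \<xi> "\<xi> - x"] by simp
        thus "norm x \<le> (1 + b) / 2" using that \<xi> by (simp add: field_simps)
      qed
    qed (rule r)
    moreover have "deriv (\<lambda>w. f w - 1) \<xi> = deriv f \<xi>"
    proof (rule DERIV_imp_deriv)
      have "(f has_field_derivative deriv f \<xi>) (at \<xi>)"
        by (rule holomorphic_derivI[OF hol]) (use \<xi> b in auto)
      thus "((\<lambda>w. f w - 1) has_field_derivative deriv f \<xi>) (at \<xi>)" by (auto intro!: derivative_eq_intros)
    qed
    ultimately show ?thesis by (simp add: field_simps)
  qed
  let ?x = "complex_of_real (Re \<beta>)"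
  have x: "norm ?x \<le> b" using \<beta> abs_Re_le_cmod[of \<beta>] by simp
  have "norm (f \<beta> - f ?x) \<le> 2 / (1 - b) * B * norm (\<beta> - ?x)"
  proof (rule field_differentiable_bound[of "cball 0 b"])
    show "(f has_field_derivative deriv f z) (at z within cball 0 b)" if "z \<in> cball 0 b" for z
      by (rule has_field_derivative_at_within[OF holomorphic_derivI[OF hol]]) (use that b in auto)
  qed (use x \<beta> der in auto)
  moreover have "norm (\<beta> - ?x) = \<bar>Im \<beta>\<bar>" by (simp add: cmod_def)
  moreover have "Im (f ?x) = 0"
  proof -
    have "cnj (f ?x) = f ?x" using sym[of ?x] x b by simp
    thus ?thesis by (simp add: complex_eq_iff)
  qed
  moreover have "\<bar>Im (f \<beta> - f ?x)\<bar> \<le> norm (f \<beta> - f ?x)" by (rule abs_Im_le_cmod)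
  ultimately show ?thesis by simp
qed

lemma profile_bounds_Im:
  assumes b: "0 \<le> b" "b < 1"
  obtains C where "C \<ge> 0"
    "\<And>N a \<beta>. a < N \<Longrightarrow> norm \<beta> \<le> b \<Longrightarrow> norm (odd_profile N a \<beta> - 1) \<le> C * (1 + real a) ^ 8 / real N"
    "\<And>N a \<beta>. a < N \<Longrightarrow> norm \<beta> \<le> b \<Longrightarrow> norm (even_profile N a \<beta> - 1) \<le> C * (1 + real a) ^ 8 / real N"
    "\<And>N a \<beta>. a < N \<Longrightarrow> norm \<beta> \<le> b \<Longrightarrow> \<bar>Im (odd_profile N a \<beta>)\<bar> \<le> C * (1 + real a) ^ 8 / real N * \<bar>Im \<beta>\<bar>"
    "\<And>N a \<beta>. a < N \<Longrightarrow> norm \<beta> \<le> b \<Longrightarrow> \<bar>Im (even_profile N a \<beta>)\<bar> \<le> C * (1 + real a) ^ 8 / real N * \<bar>Im \<beta>\<bar>"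
proof -
  have b': "0 \<le> (1 + b) / 2" "(1 + b) / 2 < 1" using b by auto
  obtain C where C: "C \<ge> 0"
    "\<And>N a \<beta>. a < N \<Longrightarrow> norm \<beta> \<le> (1 + b) / 2 \<Longrightarrow> norm (odd_profile N a \<beta> - 1) \<le> C * (1 + real a) ^ 8 / real N"
    "\<And>N a \<beta>. a < N \<Longrightarrow> norm \<beta> \<le> (1 + b) / 2 \<Longrightarrow> norm (even_profile N a \<beta> - 1) \<le> C * (1 + real a) ^ 8 / real N"
    using profile_bounds[OF b'] by metis
  have hol: "odd_profile N a holomorphic_on ball 0 1" "even_profile N a holomorphic_on ball 0 1" for N a
    unfolding odd_profile_def even_profile_def by (intro holomorphic_intros scaled_coef_holomorphic)+
  have sym: "cnj (odd_profile N a \<beta>) = odd_profile N a (cnj \<beta>)" "cnj (even_profile N a \<beta>) = even_profile N a (cnj \<beta>)"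
    if "norm \<beta> < 1" for N a \<beta>
    unfolding odd_profile_def even_profile_def using cnj_scaled_coef[OF that] by auto
  define C' where "C' = 2 / (1 - b) * C"
  have CC: "C \<le> C'"
  proof -
    have "1 * C \<le> 2 / (1 - b) * C" using b C(1) by (intro mult_right_mono) (auto simp: field_simps)
    thus ?thesis by (simp add: C'_def)
  qed
  have up: "C * (1 + real a) ^ 8 / real N \<le> C' * (1 + real a) ^ 8 / real N" for a N
    using CC by (intro divide_right_mono mult_right_mono) auto
  show ?thesis
  proof (rule that[of C'])
    show "C' \<ge> 0" using C(1) CC by linarith
    fix N a :: nat and \<beta> :: complex assume a: "a < N" and \<beta>: "norm \<beta> \<le> b"
    have \<beta>': "norm \<beta> \<le> (1 + b) / 2" using \<beta> b by simp
    show "norm (odd_profile N a \<beta> - 1) \<le> C' * (1 + real a) ^ 8 / real N"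
      "norm (even_profile N a \<beta> - 1) \<le> C' * (1 + real a) ^ 8 / real N"
      using C(2,3)[OF a \<beta>'] up[of a N] by linarith+
    have "\<bar>Im (odd_profile N a \<beta>)\<bar> \<le> 2 / (1 - b) * (C * (1 + real a) ^ 8 / real N) * \<bar>Im \<beta>\<bar>"
      by (rule abs_Im_le_of_real_on_reals[OF hol(1) sym(1) b C(2)[OF a] \<beta>])
    thus "\<bar>Im (odd_profile N a \<beta>)\<bar> \<le> C' * (1 + real a) ^ 8 / real N * \<bar>Im \<beta>\<bar>" by (simp add: C'_def)
    have "\<bar>Im (even_profile N a \<beta>)\<bar> \<le> 2 / (1 - b) * (C * (1 + real a) ^ 8 / real N) * \<bar>Im \<beta>\<bar>"
      by (rule abs_Im_le_of_real_on_reals[OF hol(2) sym(2) b C(3)[OF a] \<beta>])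
    thus "\<bar>Im (even_profile N a \<beta>)\<bar> \<le> C' * (1 + real a) ^ 8 / real N * \<bar>Im \<beta>\<bar>" by (simp add: C'_def)
  qed
qed

section \<open>The dominant double geometric sum\<close>

text \<open>
  Differentiating a power series raises the power of $n$ by one.
\<close>

lemma summable_power_times_geometric:
  fixes x :: real
  assumes "\<bar>x\<bar> < 1"
  shows "summable (\<lambda>n. (1 + real n) ^ k * x ^ n)"
proof -
  have shift: "summable (\<lambda>n. real n ^ k * x ^ n)"
    if "\<And>x::real. \<bar>x\<bar> < 1 \<Longrightarrow> summable (\<lambda>n. (1 + real n) ^ k * x ^ n)" "\<bar>x\<bar> < 1" for x k
  proof -
    have "summable (\<lambda>n. x * ((1 + real n) ^ k * x ^ n))" by (intro summable_mult that)
    hence "summable (\<lambda>n. real (Suc n) ^ k * x ^ Suc n)" by (simp add: mult_ac)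
    thus ?thesis by (subst (asm) summable_Suc_iff)
  qed
  have "\<And>x::real. \<bar>x\<bar> < 1 \<Longrightarrow> summable (\<lambda>n. (1 + real n) ^ k * x ^ n)"
  proof (induction k)
    case 0
    thus ?case by (simp add: summable_geometric)
  next
    case (Suc k)
    have "summable (\<lambda>n. diffs (\<lambda>n. real n ^ k) n * x ^ n)"
      by (rule termdiff_converges[of x 1]) (use Suc shift in auto)
    thus ?case by (simp add: diffs_def algebra_simps)
  qed
  thus ?thesis using assms by blast
qed

lemma double_geometric_sums:
  fixes u :: complex
  assumes u: "norm u < 1"
  shows "(\<lambda>b. \<Sum>a\<le>b. u ^ a * cnj u ^ b) sums (1 / ((1 - cnj u) * (1 - u * cnj u)))"
proof -
  have u1: "u \<noteq> 1" "cnj u \<noteq> 1" using u by auto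
  have uu: "norm (u * cnj u) < 1"
    using u by (simp add: norm_mult) (metis mult_le_one norm_ge_zero less_le mult_less_cancel_left2 order_less_le_trans mult_le_cancel_left2 not_le)
  have uu1: "u * cnj u \<noteq> 1" using uu by auto
  have "(\<lambda>b. (cnj u ^ b - u * (u * cnj u) ^ b) / (1 - u)) sums ((1 / (1 - cnj u) - u * (1 / (1 - u * cnj u))) / (1 - u))"
    using u uu by (intro sums_divide sums_diff sums_mult geometric_sums) auto
  moreover have "(cnj u ^ b - u * (u * cnj u) ^ b) / (1 - u) = (\<Sum>a\<le>b. u ^ a * cnj u ^ b)" for b
  proof -
    have "(\<Sum>a\<le>b. u ^ a * cnj u ^ b) = (\<Sum>a\<le>b. u ^ a) * cnj u ^ b" by (simp add: sum_distrib_right)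
    also have "(\<Sum>a\<le>b. u ^ a) = (1 - u ^ Suc b) / (1 - u)" using u1 by (simp add: sum_gp0)
    finally show ?thesis by (simp add: power_mult_distrib algebra_simps)
  qed
  moreover have "(1 / (1 - cnj u) - u * (1 / (1 - u * cnj u))) / (1 - u) = 1 / ((1 - cnj u) * (1 - u * cnj u))"
    using u1 uu1 by (simp add: divide_simps) (simp add: algebra_simps)
  ultimately show ?thesis by simp
qed

text \<open>
  Up to the factor $|\psi|^4/2$, the quotient of the claimed formula divided by
  $|\psi^2-1|^2$: the value of $\sum_{a\le b}\operatorname{Im}(\psi u^a\bar u^b)$ for
  $u=\psi^{-2}$.
\<close>

definition limit_sum :: "complex \<Rightarrow> real" where
  "limit_sum \<psi> = (norm \<psi>) ^ 6 / ((norm \<psi>)\<^sup>2 - 1) * Im \<psi> / (norm (\<psi>\<^sup>2 - 1))\<^sup>2"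

lemma limit_sum_eq:
  assumes r: "norm \<psi> > 1"
  defines "u \<equiv> 1 / \<psi>\<^sup>2"
  shows "Im (\<psi> * (1 / ((1 - cnj u) * (1 - u * cnj u)))) = limit_sum \<psi>"
proof -
  let ?r = "norm \<psi>"
  have nz: "\<psi> \<noteq> 0" using r by auto
  have "norm (\<psi>\<^sup>2) > 1" using r by (simp add: norm_power one_less_power)
  hence p1: "\<psi>\<^sup>2 - 1 \<noteq> 0" by auto
  hence p2: "(cnj \<psi>)\<^sup>2 - 1 \<noteq> 0" by (metis complex_cnj_cnj complex_cnj_diff complex_cnj_one complex_cnj_power complex_cnj_zero)
  have rr: "?r\<^sup>2 > 1" "?r ^ 4 > 1" using r by (simp_all add: one_less_power)
  have pc: "\<psi> * cnj \<psi> = of_real (?r\<^sup>2)" by (simp only: complex_norm_square)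
  have uu: "u * cnj u = of_real (1 / ?r ^ 4)"
  proof -
    have "u * cnj u = 1 / (\<psi> * cnj \<psi>)\<^sup>2" by (simp add: u_def power_mult_distrib)
    thus ?thesis unfolding pc by (simp flip: power_mult)
  qed
  have "1 - cnj u = ((cnj \<psi>)\<^sup>2 - 1) / (cnj \<psi>)\<^sup>2" using nz by (simp add: u_def diff_divide_distrib)
  hence "\<psi> * (1 / ((1 - cnj u) * (1 - u * cnj u))) = (\<psi> * (cnj \<psi>)\<^sup>2 / ((cnj \<psi>)\<^sup>2 - 1)) * of_real (1 / (1 - 1 / ?r ^ 4))"
    unfolding uu by simp
  also have "\<psi> * (cnj \<psi>)\<^sup>2 / ((cnj \<psi>)\<^sup>2 - 1) = (\<psi> * (cnj \<psi>)\<^sup>2 * (\<psi>\<^sup>2 - 1)) / of_real ((norm (\<psi>\<^sup>2 - 1))\<^sup>2)"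
    unfolding complex_norm_square using p1 p2 by simp
  also have "\<psi> * (cnj \<psi>)\<^sup>2 * (\<psi>\<^sup>2 - 1) = (\<psi> * cnj \<psi>) * ((\<psi> * cnj \<psi>) * \<psi> - cnj \<psi>)"
    by (simp add: power2_eq_square algebra_simps)
  also have "\<dots> = of_real (?r\<^sup>2) * (of_real (?r\<^sup>2) * \<psi> - cnj \<psi>)" unfolding pc ..
  finally have e: "\<psi> * (1 / ((1 - cnj u) * (1 - u * cnj u)))
     = of_real (?r\<^sup>2 * (1 / (norm (\<psi>\<^sup>2 - 1))\<^sup>2) * (1 / (1 - 1 / ?r ^ 4))) * (of_real (?r\<^sup>2) * \<psi> - cnj \<psi>)"
    by (simp add: field_simps)
  have "Im (\<psi> * (1 / ((1 - cnj u) * (1 - u * cnj u)))) = ?r\<^sup>2 * (1 / (norm (\<psi>\<^sup>2 - 1))\<^sup>2) * (1 / (1 - 1 / ?r ^ 4)) * ((?r\<^sup>2 + 1) * Im \<psi>)"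
  proof -
    have "Im (of_real x * w) = x * Im w" for x w by simp
    thus ?thesis unfolding e by (simp only:) (simp add: algebra_simps)
  qed
  also have "1 / (1 - 1 / ?r ^ 4) = ?r ^ 4 / ((?r\<^sup>2 - 1) * (?r\<^sup>2 + 1))"
  proof -
    have "(?r\<^sup>2 - 1) * (?r\<^sup>2 + 1) = ?r ^ 4 - 1" by (simp add: algebra_simps flip: power_add)
    thus ?thesis using rr nz by (simp add: field_simps)
  qed
  also have "?r\<^sup>2 * (1 / (norm (\<psi>\<^sup>2 - 1))\<^sup>2) * (?r ^ 4 / ((?r\<^sup>2 - 1) * (?r\<^sup>2 + 1))) * ((?r\<^sup>2 + 1) * Im \<psi>)
     = (?r\<^sup>2 * ?r ^ 4) / (?r\<^sup>2 - 1) * Im \<psi> / (norm (\<psi>\<^sup>2 - 1))\<^sup>2 * ((?r\<^sup>2 + 1) / (?r\<^sup>2 + 1))"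
    by simp
  also have "(?r\<^sup>2 + 1) / (?r\<^sup>2 + 1) = 1" using rr by simp
  also have "?r\<^sup>2 * ?r ^ 4 = ?r ^ 6" by (simp flip: power_add)
  finally show ?thesis unfolding limit_sum_def by simp
qed

text \<open>
  This turns errors relative to $|\operatorname{Im}\psi|$ into errors relative to the limit;
  the constant is uniform because the powers of $|\psi|$ balance at infinity.
\<close>

lemma limit_sum_lower_bound:
  assumes r: "norm \<psi> > 1"
  shows "\<bar>Im \<psi>\<bar> \<le> 4 * \<bar>limit_sum \<psi>\<bar>"
proof -
  let ?r = "norm \<psi>"
  have rr: "?r\<^sup>2 > 1" using r by (simp add: one_less_power)
  have "norm (\<psi>\<^sup>2) > 1" using r by (simp add: norm_power one_less_power)
  hence p: "norm (\<psi>\<^sup>2 - 1) > 0" by auto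
  have "norm (\<psi>\<^sup>2 - 1) \<le> 2 * ?r\<^sup>2" using norm_triangle_ineq4[of "\<psi>\<^sup>2" 1] rr by (simp add: norm_power)
  hence "(norm (\<psi>\<^sup>2 - 1))\<^sup>2 \<le> (2 * ?r\<^sup>2)\<^sup>2" by (intro power_mono) auto
  hence "(?r\<^sup>2 - 1) * (norm (\<psi>\<^sup>2 - 1))\<^sup>2 \<le> ?r\<^sup>2 * (2 * ?r\<^sup>2)\<^sup>2" using rr by (intro mult_mono) auto
  also have "\<dots> = 4 * ?r ^ 6" by (simp add: power_mult_distrib flip: power_mult power_add)
  finally have "1 \<le> 4 * (?r ^ 6 / ((?r\<^sup>2 - 1) * (norm (\<psi>\<^sup>2 - 1))\<^sup>2))"
    using rr p by (simp add: field_simps)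
  hence "1 * \<bar>Im \<psi>\<bar> \<le> 4 * (?r ^ 6 / ((?r\<^sup>2 - 1) * (norm (\<psi>\<^sup>2 - 1))\<^sup>2)) * \<bar>Im \<psi>\<bar>" by (intro mult_right_mono) auto
  also have "\<dots> = 4 * \<bar>limit_sum \<psi>\<bar>" unfolding limit_sum_def using rr by (simp add: abs_mult)
  finally show ?thesis by simp
qed

lemma abs_Im_mult_le: "\<bar>Im (x * y)\<bar> \<le> \<bar>Im x\<bar> * norm y + norm x * \<bar>Im y\<bar>"
proof -
  have "\<bar>Im (x * y)\<bar> \<le> \<bar>Re x * Im y\<bar> + \<bar>Im x * Re y\<bar>" by simp
  also have "\<dots> \<le> norm x * \<bar>Im y\<bar> + \<bar>Im x\<bar> * norm y"
    unfolding abs_mult by (intro add_mono mult_mono abs_Re_le_cmod) auto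
  finally show ?thesis by simp
qed

text \<open>
  The power $|u|^a$ is kept, so that the bound is summable; near the real axis, $c$ is of
  the order of $|\operatorname{Im}\psi|$.
\<close>

lemma abs_Im_power_le:
  assumes "\<bar>Im u\<bar> \<le> c * norm u"
  shows "\<bar>Im (u ^ a)\<bar> \<le> real a * norm u ^ a * c"
proof (induction a)
  case (Suc a)
  have "\<bar>Im (u ^ Suc a)\<bar> \<le> \<bar>Im u\<bar> * norm (u ^ a) + norm u * \<bar>Im (u ^ a)\<bar>" using abs_Im_mult_le[of u "u ^ a"] by simp
  also have "\<dots> \<le> (c * norm u) * norm u ^ a + norm u * (real a * norm u ^ a * c)"
    unfolding norm_power using assms Suc by (intro add_mono mult_right_mono mult_left_mono) auto
  finally show ?case by (simp add: algebra_simps)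
qed simp

lemma profile_product_bounds:
  fixes A B :: complex
  assumes e: "0 \<le> \<epsilon>" "0 \<le> \<delta>" and eps: "\<epsilon> \<le> C * M" "\<delta> \<le> C * M'" and C: "C \<ge> 0" "M \<ge> 1" "M' \<ge> 1"
    and A: "norm (A - 1) \<le> \<epsilon>" "\<bar>Im A\<bar> \<le> \<epsilon> * v" and B: "norm (B - 1) \<le> \<delta>" "\<bar>Im B\<bar> \<le> \<delta> * v"
  shows "norm (A * cnj B - 1) \<le> (1 + C) * (\<epsilon> * M' + \<delta> * M)" "\<bar>Im (A * cnj B)\<bar> \<le> (1 + C) * (\<epsilon> * M' + \<delta> * M) * v"
proof -
  have nA: "norm A \<le> (1 + C) * M"
  proof -
    have "norm A \<le> 1 + \<epsilon>" using A(1) norm_triangle_ineq[of 1 "A - 1"] by simp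
    also have "\<dots> \<le> (1 + C) * M" using eps(1) C by (simp add: algebra_simps)
    finally show ?thesis .
  qed
  have nB: "norm B \<le> (1 + C) * M'"
  proof -
    have "norm B \<le> 1 + \<delta>" using B(1) norm_triangle_ineq[of 1 "B - 1"] by simp
    also have "\<dots> \<le> (1 + C) * M'" using eps(2) C by (simp add: algebra_simps)
    finally show ?thesis .
  qed
  have C1: "1 + C \<ge> 0" using C by simp
  have cB: "norm (cnj B - 1) \<le> \<delta>" using B(1) by (metis complex_cnj_diff complex_cnj_one complex_mod_cnj)
  have "A * cnj B - 1 = (A - 1) * cnj B + (cnj B - 1)" by (simp add: algebra_simps)
  also have "norm \<dots> \<le> norm (A - 1) * norm B + norm (cnj B - 1)"
    by (rule order_trans[OF norm_triangle_ineq]) (simp add: norm_mult)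
  also have "\<dots> \<le> \<epsilon> * ((1 + C) * M') + (1 + C) * (\<delta> * M)"
  proof (intro add_mono mult_mono A nB)
    have "\<delta> * 1 \<le> \<delta> * M" using C e by (intro mult_left_mono) auto
    also have "1 * (\<delta> * M) \<le> (1 + C) * (\<delta> * M)" using C e by (intro mult_right_mono) auto
    finally show "norm (cnj B - 1) \<le> (1 + C) * (\<delta> * M)" using cB by simp
  qed (use e in auto)
  finally show "norm (A * cnj B - 1) \<le> (1 + C) * (\<epsilon> * M' + \<delta> * M)" by (simp add: algebra_simps)
  have "\<bar>Im (A * cnj B)\<bar> \<le> \<bar>Im A\<bar> * norm B + norm A * \<bar>Im B\<bar>" using abs_Im_mult_le[of A "cnj B"] by simp
  also have "\<dots> \<le> (\<epsilon> * v) * ((1 + C) * M') + ((1 + C) * M) * (\<delta> * v)"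
    using A(2) B(2) nA nB C by (intro add_mono mult_mono) auto
  finally show "\<bar>Im (A * cnj B)\<bar> \<le> (1 + C) * (\<epsilon> * M' + \<delta> * M) * v" by (simp add: algebra_simps)
qed

text \<open>
  Subtract the limit term by term. For $b<N$, a geometric term $c$ and the product $X$ of
  its two factors, use
  $|\operatorname{Im}(cX)-\operatorname{Im}c|\le|\operatorname{Im}c||X-1|+|c||\operatorname{Im}X|$;
  every summand carries a factor $|\operatorname{Im}\psi|$. The missing terms with $b\ge N$
  are small because $1\le(1+b)/N$. Two factors of degree 8, one from $\operatorname{Im}c$
  and one from the number of $a\le b$ give the exponent 18.
\<close>

lemma dominant_sum_error:
  assumes r0: "r0 > (1 :: real)" and C: "C \<ge> 0"
  obtains D where "D \<ge> 0"
    "\<And>(N :: nat) \<psi> A B. N \<ge> 1 \<Longrightarrow> norm \<psi> \<ge> r0 \<Longrightarrow>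
      (\<And>a. a < N \<Longrightarrow> norm (A a - 1) \<le> C * (1 + real a) ^ 8 / real N) \<Longrightarrow>
      (\<And>a. a < N \<Longrightarrow> norm (B a - 1) \<le> C * (1 + real a) ^ 8 / real N) \<Longrightarrow>
      (\<And>a. a < N \<Longrightarrow> \<bar>Im (A a)\<bar> \<le> C * (1 + real a) ^ 8 / real N * \<bar>Im (1 / \<psi>\<^sup>2)\<bar>) \<Longrightarrow>
      (\<And>a. a < N \<Longrightarrow> \<bar>Im (B a)\<bar> \<le> C * (1 + real a) ^ 8 / real N * \<bar>Im (1 / \<psi>\<^sup>2)\<bar>) \<Longrightarrow>
      \<bar>(\<Sum>b<N. \<Sum>a\<le>b. Im (\<psi> * (1 / \<psi>\<^sup>2) ^ a * cnj (1 / \<psi>\<^sup>2) ^ b * (A a * cnj (B b)))) - limit_sum \<psi>\<bar>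
        \<le> D * \<bar>Im \<psi>\<bar> / real N"
proof -
  define \<rho> where "\<rho> = 1 / r0\<^sup>2"
  have rho: "0 < \<rho>" "\<rho> < 1" using r0 by (auto simp: \<rho>_def one_less_power)
  define L where "L = 12 * C * (1 + C) + 4"
  have L: "L \<ge> 4" unfolding L_def using C by simp
  have sm: "summable (\<lambda>b. (1 + real b) ^ 18 * \<rho> ^ b)" using rho by (intro summable_power_times_geometric) auto
  define D where "D = L * (\<Sum>b. (1 + real b) ^ 18 * \<rho> ^ b)"
  have D: "D \<ge> 0" unfolding D_def using L rho by (intro mult_nonneg_nonneg suminf_nonneg sm) auto
  have main: "\<bar>(\<Sum>b<N. \<Sum>a\<le>b. Im (\<psi> * (1 / \<psi>\<^sup>2) ^ a * cnj (1 / \<psi>\<^sup>2) ^ b * (A a * cnj (B b)))) - limit_sum \<psi>\<bar>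
        \<le> D * \<bar>Im \<psi>\<bar> / real N"
    if N: "N \<ge> 1" and \<psi>: "norm \<psi> \<ge> r0"
      and A: "\<And>a. a < N \<Longrightarrow> norm (A a - 1) \<le> C * (1 + real a) ^ 8 / real N"
        "\<And>a. a < N \<Longrightarrow> \<bar>Im (A a)\<bar> \<le> C * (1 + real a) ^ 8 / real N * \<bar>Im (1 / \<psi>\<^sup>2)\<bar>"
      and B: "\<And>a. a < N \<Longrightarrow> norm (B a - 1) \<le> C * (1 + real a) ^ 8 / real N"
        "\<And>a. a < N \<Longrightarrow> \<bar>Im (B a)\<bar> \<le> C * (1 + real a) ^ 8 / real N * \<bar>Im (1 / \<psi>\<^sup>2)\<bar>"
    for N :: nat and \<psi> A B
  proof -
    define r where "r = norm \<psi>"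
    define u where "u = 1 / \<psi>\<^sup>2"
    define I where "I = \<bar>Im \<psi>\<bar>"
    have r1: "r > 1" using \<psi> r0 by (simp add: r_def)
    have nz: "\<psi> \<noteq> 0" using r1 by (auto simp: r_def)
    have nu: "norm u = 1 / r\<^sup>2" by (simp add: u_def r_def norm_divide norm_power)
    have nu\<rho>: "norm u \<le> \<rho>" unfolding nu \<rho>_def using \<psi> r0 by (intro frac_le power_mono) (auto simp: r_def)
    have nu1: "norm u < 1" "norm u \<ge> 0" using nu\<rho> rho by auto
    have Imu: "\<bar>Im u\<bar> \<le> 2 * I / r * norm u"
    proof -
      have "u = (cnj \<psi>)\<^sup>2 * of_real (1 / r ^ 4)"
      proof -
        have "of_real (r ^ 4) = (\<psi> * cnj \<psi>)\<^sup>2" unfolding complex_norm_square[symmetric] r_def by (simp flip: power_mult)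
        thus ?thesis unfolding u_def using nz by (simp add: power_mult_distrib)
      qed
      hence "Im u = Im ((cnj \<psi>)\<^sup>2) / r ^ 4" by simp
      also have "Im ((cnj \<psi>)\<^sup>2) = - 2 * Re \<psi> * Im \<psi>" by (simp add: power2_eq_square)
      finally have "\<bar>Im u\<bar> = 2 * \<bar>Re \<psi>\<bar> * I / r ^ 4" by (simp add: I_def abs_mult)
      also have "\<dots> \<le> 2 * r * I / r ^ 4" unfolding r_def I_def
        by (intro divide_right_mono mult_right_mono mult_left_mono abs_Re_le_cmod) auto
      also have "\<dots> = 2 * I / r * norm u" unfolding nu using r1 by (simp add: field_simps power2_eq_square power4_eq_xxxx)
      finally show ?thesis .
    qed
    have I0: "I \<ge> 0" by (simp add: I_def)
    define c where "c = (\<lambda>a b. \<psi> * u ^ a * cnj u ^ b)"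
    have nc: "norm (c a b) \<le> r * norm u ^ b" for a b
    proof -
      have "norm (c a b) = r * norm u ^ a * norm u ^ b" by (simp add: c_def norm_mult norm_power r_def)
      also have "\<dots> \<le> r * 1 * norm u ^ b" using nu1 r1 by (intro mult_right_mono mult_left_mono power_le_one) auto
      finally show ?thesis by simp
    qed
    have Imc: "\<bar>Im (c a b)\<bar> \<le> 4 * I * norm u ^ b * (1 + real b)" if "a \<le> b" for a b
    proof -
      have p: "\<bar>Im (u ^ a)\<bar> \<le> real a * norm u ^ a * (2 * I / r)" by (rule abs_Im_power_le[OF Imu])
      have p': "\<bar>Im (cnj u ^ b)\<bar> \<le> real b * norm u ^ b * (2 * I / r)"
        using abs_Im_power_le[OF Imu, of b] by (simp flip: complex_cnj_power)
      have "\<bar>Im (c a b)\<bar> \<le> (\<bar>Im \<psi>\<bar> * norm (u ^ a) + norm \<psi> * \<bar>Im (u ^ a)\<bar>) * norm (cnj u ^ b) + norm (\<psi> * u ^ a) * \<bar>Im (cnj u ^ b)\<bar>"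
        unfolding c_def by (rule order_trans[OF abs_Im_mult_le add_right_mono[OF mult_right_mono[OF abs_Im_mult_le]]]) auto
      also have "\<dots> \<le> (I * norm u ^ a + r * (real a * norm u ^ a * (2 * I / r))) * norm u ^ b + (r * norm u ^ a) * (real b * norm u ^ b * (2 * I / r))"
        unfolding norm_mult norm_power complex_mod_cnj r_def[symmetric] I_def[symmetric]
        using p p' r1 I0 by (intro add_mono mult_right_mono mult_left_mono) auto
      also have "\<dots> = (norm u ^ a) * (I * norm u ^ b * (1 + 2 * real a + 2 * real b))"
        using r1 by (simp add: field_simps)
      also have "\<dots> \<le> 1 * (I * norm u ^ b * (4 * (1 + real b)))"
        using nu1 I0 that by (intro mult_mono power_le_one mult_left_mono) auto
      finally show ?thesis by (simp add: algebra_simps)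
    qed
    define t where "t = (\<lambda>b. \<Sum>a\<le>b. Im (c a b))"
    have tsum: "t sums limit_sum \<psi>"
    proof -
      have "(\<lambda>b. \<psi> * (\<Sum>a\<le>b. u ^ a * cnj u ^ b)) sums (\<psi> * (1 / ((1 - cnj u) * (1 - u * cnj u))))"
        by (intro sums_mult double_geometric_sums nu1)
      hence "(\<lambda>b. Im (\<psi> * (\<Sum>a\<le>b. u ^ a * cnj u ^ b))) sums Im (\<psi> * (1 / ((1 - cnj u) * (1 - u * cnj u))))"
        by (rule sums_Im)
      moreover have "Im (\<psi> * (\<Sum>a\<le>b. u ^ a * cnj u ^ b)) = t b" for b
        unfolding t_def c_def sum_distrib_left Im_sum by (simp only: mult.assoc)
      moreover have "Im (\<psi> * (1 / ((1 - cnj u) * (1 - u * cnj u)))) = limit_sum \<psi>"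
        unfolding u_def by (rule limit_sum_eq) (use r1 in \<open>simp add: r_def\<close>)
      ultimately show ?thesis by (simp only:)
    qed
    define s where "s = (\<lambda>b. if b < N then \<Sum>a\<le>b. Im (c a b * (A a * cnj (B b))) else 0)"
    have ssum: "s sums (\<Sum>b<N. \<Sum>a\<le>b. Im (c a b * (A a * cnj (B b))))"
      unfolding s_def using sums_If_finite_set[of "{..<N}" "\<lambda>b. \<Sum>a\<le>b. Im (c a b * (A a * cnj (B b)))"] by simp
    have termwise: "\<bar>Im (c a b * (A a * cnj (B b))) - Im (c a b)\<bar> \<le> L * I / real N * norm u ^ b * (1 + real b) ^ 17"
      if ab: "a \<le> b" "b < N" for a b
    proof -
      define M where "M = (1 + real b) ^ 8"
      define X where "X = A a * cnj (B b)"
      have M1: "M \<ge> 1" unfolding M_def by (intro one_le_power) simp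
      have Ma: "(1 + real a) ^ 8 \<le> M" unfolding M_def using ab by (intro power_mono) auto
      have le: "C * (1 + real a) ^ 8 / real N \<le> C * M / real N" using C Ma by (intro divide_right_mono mult_left_mono) auto
      have sm': "C * M / real N \<le> C * M" 
      proof -
        have "C * M / real N \<le> C * M / 1" using N C M1 by (intro divide_left_mono mult_nonneg_nonneg) auto
        thus ?thesis by simp
      qed
      have e0: "0 \<le> C * M / real N" using C M1 by simp
      have A1: "norm (A a - 1) \<le> C * M / real N" using A(1)[of a] ab le by simp
      have A2: "\<bar>Im (A a)\<bar> \<le> C * M / real N * \<bar>Im u\<bar>"
        using A(2)[of a] ab mult_right_mono[OF le, of "\<bar>Im u\<bar>"] unfolding u_def by simp
      have B1: "norm (B b - 1) \<le> C * M / real N" using B(1)[of b] ab by (simp add: M_def)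
      have B2: "\<bar>Im (B b)\<bar> \<le> C * M / real N * \<bar>Im u\<bar>" using B(2)[of b] ab unfolding u_def by (simp add: M_def)
      have pb: "norm (X - 1) \<le> (1 + C) * (C * M / real N * M + C * M / real N * M)"
        "\<bar>Im X\<bar> \<le> (1 + C) * (C * M / real N * M + C * M / real N * M) * \<bar>Im u\<bar>"
        unfolding X_def
        by (rule profile_product_bounds[OF e0 e0 sm' sm' C M1 M1 A1 A2 B1 B2])+
      define K where "K = 2 * C * (1 + C) * M\<^sup>2 / real N"
      have K0: "K \<ge> 0" using C by (simp add: K_def)
      have Ke: "(1 + C) * (C * M / real N * M + C * M / real N * M) = K"
        by (simp add: K_def power2_eq_square field_simps)
      have X: "norm (X - 1) \<le> K" "\<bar>Im X\<bar> \<le> K * \<bar>Im u\<bar>" using pb unfolding Ke by auto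
      have "Im (c a b * X) - Im (c a b) = Im (c a b * (X - 1))" by (simp add: algebra_simps)
      also have "\<bar>\<dots>\<bar> \<le> \<bar>Im (c a b)\<bar> * norm (X - 1) + norm (c a b) * \<bar>Im (X - 1)\<bar>" by (rule abs_Im_mult_le)
      also have "\<dots> \<le> (4 * I * norm u ^ b * (1 + real b)) * K + (r * norm u ^ b) * (K * (2 * I / r * norm u))"
      proof (intro add_mono mult_mono Imc ab X nc)
        have "\<bar>Im (X - 1)\<bar> = \<bar>Im X\<bar>" by simp
        also have "\<dots> \<le> K * \<bar>Im u\<bar>" by (rule X(2))
        also have "\<dots> \<le> K * (2 * I / r * norm u)" by (intro mult_left_mono Imu K0)
        finally show "\<bar>Im (X - 1)\<bar> \<le> K * (2 * I / r * norm u)" .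
      qed (use I0 K0 r1 nu1 in auto)
      also have "(r * norm u ^ b) * (K * (2 * I / r * norm u)) = 2 * I * norm u ^ b * K * norm u" using r1 by simp
      also have "(4 * I * norm u ^ b * (1 + real b)) * K + 2 * I * norm u ^ b * K * norm u
         \<le> (4 * I * norm u ^ b * (1 + real b)) * K + 2 * I * norm u ^ b * K * (1 + real b)"
        using nu1 I0 K0 by (intro add_left_mono mult_left_mono) auto
      also have "\<dots> = 6 * I * norm u ^ b * (1 + real b) * K" by (simp add: algebra_simps)
      also have "\<dots> = (12 * C * (1 + C)) * I / real N * norm u ^ b * ((1 + real b) * M\<^sup>2)"
        unfolding K_def by (simp add: mult_ac)
      also have "(1 + real b) * M\<^sup>2 = (1 + real b) ^ 17"
        unfolding M_def by (simp flip: power_mult power_Suc)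
      also have "(12 * C * (1 + C)) * I / real N * norm u ^ b * (1 + real b) ^ 17 \<le> L * I / real N * norm u ^ b * (1 + real b) ^ 17"
        unfolding L_def using I0 nu1 by (intro mult_right_mono divide_right_mono) auto
      finally show ?thesis unfolding X_def .
    qed
    have st: "norm (s b - t b) \<le> L * I / real N * ((1 + real b) ^ 18 * \<rho> ^ b)" for b
    proof -
      have up: "L * I / real N * norm u ^ b * (1 + real b) ^ 17 * (1 + real b) \<le> L * I / real N * ((1 + real b) ^ 18 * \<rho> ^ b)"
      proof -
        have e: "(1 + real b) ^ 18 = (1 + real b) ^ 17 * (1 + real b)" by (simp flip: power_Suc2)
        have "L * I / real N * ((1 + real b) ^ 18 * norm u ^ b) \<le> L * I / real N * ((1 + real b) ^ 18 * \<rho> ^ b)"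
          using nu\<rho> nu1 L I0 by (intro mult_left_mono power_mono) auto
        thus ?thesis unfolding e by (simp only: mult_ac)
      qed
      show ?thesis
      proof (cases "b < N")
        case True
        have "s b - t b = (\<Sum>a\<le>b. Im (c a b * (A a * cnj (B b))) - Im (c a b))"
          using True by (simp add: s_def t_def sum_subtractf)
        also have "norm \<dots> \<le> (\<Sum>a\<le>b. L * I / real N * norm u ^ b * (1 + real b) ^ 17)"
          by (rule sum_norm_le) (use termwise True in auto)
        also have "\<dots> = L * I / real N * norm u ^ b * (1 + real b) ^ 17 * (1 + real b)" by simp
        also note up
        finally show ?thesis .
      next
        case False
        have "norm (s b - t b) = norm (t b)" using False by (simp add: s_def)
        also have "\<dots> \<le> (\<Sum>a\<le>b. 4 * I * norm u ^ b * (1 + real b))"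
          unfolding t_def by (rule sum_norm_le) (use Imc in auto)
        also have "\<dots> = 4 * I * norm u ^ b * ((1 + real b)\<^sup>2 * 1)" by (simp add: power2_eq_square)
        also have "\<dots> \<le> 4 * I * norm u ^ b * ((1 + real b)\<^sup>2 * ((1 + real b) / real N))"
          using False N I0 nu1 by (intro mult_left_mono) auto
        also have "\<dots> = 4 * I / real N * norm u ^ b * (1 + real b) ^ 3" by (simp add: power2_eq_square power3_eq_cube)
        also have "\<dots> \<le> L * I / real N * norm u ^ b * (1 + real b) ^ 18"
          using L I0 nu1 by (intro mult_mono divide_right_mono mult_right_mono power_increasing) auto
        also have "\<dots> = L * I / real N * norm u ^ b * (1 + real b) ^ 17 * (1 + real b)" by (simp flip: power_Suc2)
        also note up
        finally show ?thesis .
      qed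
    qed
    have gs: "(\<lambda>b. L * I / real N * ((1 + real b) ^ 18 * \<rho> ^ b)) sums (L * I / real N * (\<Sum>b. (1 + real b) ^ 18 * \<rho> ^ b))"
      by (intro sums_mult summable_sums sm)
    have "norm ((\<Sum>b<N. \<Sum>a\<le>b. Im (c a b * (A a * cnj (B b)))) - limit_sum \<psi>) \<le> L * I / real N * (\<Sum>b. (1 + real b) ^ 18 * \<rho> ^ b)"
      by (rule norm_sums_le[OF sums_diff[OF ssum tsum] gs st])
    also have "\<dots> = D * I / real N" unfolding D_def by (simp only: times_divide_eq_left times_divide_eq_right mult_ac)
    finally show ?thesis by (simp only: c_def u_def I_def real_norm_def)
  qed
  show ?thesis by (rule that[OF D]) (use main in blast)
qed

section \<open>The conformal map of the exterior of the ellipse\<close>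

text \<open>
  The two roots of $\psi^2-z\psi+\tau=0$ have product $\tau$, and the chosen branch is the
  larger one because the principal root has non-negative real part. If $|\psi|=r$ with
  $\tau\le r^2\le1$, then $r+\tau/r\le1+\tau$ and $r-\tau/r\le1-\tau$, so $z$ lies in the
  ellipse.
\<close>

lemma psi_outside_ellipse:
  assumes \<tau>: "0 \<le> \<tau>" "\<tau> < 1" and z: "z \<notin> ellipseE \<tau>"
  shows "norm (psi \<tau> z) > 1" "z = psi \<tau> z + of_real \<tau> / psi \<tau> z"
proof -
  define \<psi> where "\<psi> = psi \<tau> z"
  define s where "s = sqrt_branch \<tau> z"
  have z0: "z \<noteq> 0" using z by (auto simp: ellipseE_def)
  have s2: "s\<^sup>2 = z\<^sup>2 - 4 * of_real \<tau>" unfolding s_def using z0 by (intro sqrt_branch_square) auto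
  have \<psi>: "\<psi> = (z + s) / 2" by (simp add: \<psi>_def psi_def s_def)
  have prod: "\<psi> * ((z - s) / 2) = of_real \<tau>"
  proof -
    have "\<psi> * ((z - s) / 2) = (z\<^sup>2 - s\<^sup>2) / 4" unfolding \<psi> by (simp add: power2_eq_square field_simps)
    thus ?thesis unfolding s2 by simp
  qed
  define c where "c = csqrt (1 - 4 * of_real \<tau> / z\<^sup>2)"
  have s: "s = z * c" by (simp add: s_def sqrt_branch_def c_def)
  have Rec: "Re c \<ge> 0" unfolding c_def using csqrt_principal[of "1 - 4 * of_real \<tau> / z\<^sup>2"] by linarith
  have le: "norm (1 - c) \<le> norm (1 + c)"
    unfolding cmod_def using Rec by (intro real_sqrt_le_mono) (simp add: power2_eq_square algebra_simps)
  hence "norm (z - s) \<le> norm (z + s)"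
  proof -
    have "z - s = z * (1 - c)" "z + s = z * (1 + c)" by (simp_all add: s algebra_simps)
    thus ?thesis using le by (simp add: norm_mult mult_left_mono)
  qed
  hence le2: "norm ((z - s) / 2) \<le> norm \<psi>" unfolding \<psi> by (simp add: norm_divide)
  have nz: "\<psi> \<noteq> 0"
  proof
    assume "\<psi> = 0"
    hence "(z - s) / 2 = 0" "(z + s) / 2 = 0" using le2 \<psi> by auto
    hence "z = 0" by simp
    thus False using z0 by simp
  qed
  have other: "(z - s) / 2 = of_real \<tau> / \<psi>" using prod nz by (simp add: field_simps)
  have "z = (z + s) / 2 + (z - s) / 2" by (simp add: field_simps)
  hence zeq: "z = \<psi> + of_real \<tau> / \<psi>" unfolding other \<psi>[symmetric] .
  thus "z = psi \<tau> z + of_real \<tau> / psi \<tau> z" by (simp add: \<psi>_def)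
  have r2: "\<tau> \<le> (norm \<psi>)\<^sup>2"
  proof -
    have "\<tau> = norm (\<psi> * ((z - s) / 2))" unfolding prod using \<tau> by simp
    also have "\<dots> \<le> norm \<psi> * norm \<psi>" unfolding norm_mult using le2 by (intro mult_left_mono) auto
    finally show ?thesis by (simp add: power2_eq_square)
  qed
  show "norm (psi \<tau> z) > 1"
  proof (rule ccontr)
    define r where "r = norm \<psi>"
    assume "\<not> norm (psi \<tau> z) > 1"
    hence r1: "r \<le> 1" by (simp add: r_def \<psi>_def)
    have r0: "r > 0" using nz by (simp add: r_def)
    have rt: "\<tau> \<le> r\<^sup>2" using r2 by (simp add: r_def)
    have "r * r \<le> r * 1" using r1 r0 by (intro mult_left_mono) auto
    hence "\<tau> \<le> r" using rt by (simp add: power2_eq_square)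
    have tp: "of_real \<tau> / \<psi> = of_real (\<tau> / r\<^sup>2) * cnj \<psi>"
    proof -
      have "of_real (r\<^sup>2) = \<psi> * cnj \<psi>" unfolding r_def by (rule complex_norm_square)
      thus ?thesis unfolding of_real_divide using nz by simp
    qed
    have R: "Re z = (1 + \<tau> / r\<^sup>2) * Re \<psi>" "Im z = (1 - \<tau> / r\<^sup>2) * Im \<psi>"
      by (subst zeq, simp only: tp, simp add: algebra_simps)+
    have a: "(1 + \<tau> / r\<^sup>2) * r \<le> 1 + \<tau>"
    proof -
      have "0 \<le> (1 - r) * (r - \<tau>)" using r1 \<open>\<tau> \<le> r\<close> by simp
      hence "r\<^sup>2 + \<tau> \<le> (1 + \<tau>) * r" by (simp add: power2_eq_square algebra_simps)
      hence "(r\<^sup>2 + \<tau>) / r \<le> 1 + \<tau>" using r0 by (simp add: pos_divide_le_eq)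
      moreover have "(1 + \<tau> / r\<^sup>2) * r = (r\<^sup>2 + \<tau>) / r" using r0 by (simp add: field_simps power2_eq_square)
      ultimately show ?thesis by simp
    qed
    have b: "(1 - \<tau> / r\<^sup>2) * r \<le> 1 - \<tau>" "0 \<le> 1 - \<tau> / r\<^sup>2"
    proof -
      have "0 \<le> (1 - r) * (r + \<tau>)" using r1 r0 \<tau> by simp
      hence "r\<^sup>2 - \<tau> \<le> (1 - \<tau>) * r" by (simp add: power2_eq_square algebra_simps)
      hence "(r\<^sup>2 - \<tau>) / r \<le> 1 - \<tau>" using r0 by (simp add: pos_divide_le_eq)
      moreover have "(1 - \<tau> / r\<^sup>2) * r = (r\<^sup>2 - \<tau>) / r" using r0 by (simp add: field_simps power2_eq_square)
      ultimately show "(1 - \<tau> / r\<^sup>2) * r \<le> 1 - \<tau>" by simp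
      show "0 \<le> 1 - \<tau> / r\<^sup>2" using rt r0 by simp
    qed
    have "\<bar>Re z\<bar> / (1 + \<tau>) \<le> \<bar>Re \<psi>\<bar> / r"
    proof -
      have "\<bar>Re z\<bar> * r = ((1 + \<tau> / r\<^sup>2) * r) * \<bar>Re \<psi>\<bar>" unfolding R using \<tau> by (simp add: abs_mult)
      also have "\<dots> \<le> (1 + \<tau>) * \<bar>Re \<psi>\<bar>" by (intro mult_right_mono a) auto
      finally show ?thesis using r0 \<tau> by (simp add: field_simps)
    qed
    hence x: "(Re z / (1 + \<tau>))\<^sup>2 \<le> (Re \<psi> / r)\<^sup>2"
      using power_mono[of "\<bar>Re z\<bar> / (1 + \<tau>)" "\<bar>Re \<psi>\<bar> / r" 2] \<tau> by (simp add: power_divide)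
    have "\<bar>Im z\<bar> / (1 - \<tau>) \<le> \<bar>Im \<psi>\<bar> / r"
    proof -
      have "\<bar>Im z\<bar> * r = ((1 - \<tau> / r\<^sup>2) * r) * \<bar>Im \<psi>\<bar>" unfolding R using b(2) by (simp add: abs_mult)
      also have "\<dots> \<le> (1 - \<tau>) * \<bar>Im \<psi>\<bar>" by (intro mult_right_mono b) auto
      finally show ?thesis using r0 \<tau> by (simp add: field_simps)
    qed
    hence y: "(Im z / (1 - \<tau>))\<^sup>2 \<le> (Im \<psi> / r)\<^sup>2"
      using power_mono[of "\<bar>Im z\<bar> / (1 - \<tau>)" "\<bar>Im \<psi>\<bar> / r" 2] \<tau> by (simp add: power_divide)
    have "(Re \<psi> / r)\<^sup>2 + (Im \<psi> / r)\<^sup>2 = ((Re \<psi>)\<^sup>2 + (Im \<psi>)\<^sup>2) / r\<^sup>2" by (simp add: power_divide add_divide_distrib)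
    also have "\<dots> = 1" unfolding cmod_power2[symmetric] r_def[symmetric] using r0 by simp
    finally have "z \<in> ellipseE \<tau>" using x y by (simp add: ellipseE_def)
    thus False using z by simp
  qed
qed

lemma Re_Im_joukowski:
  fixes \<psi> :: complex
  assumes "\<psi> \<noteq> 0"
  shows "Re (\<psi> + of_real \<tau> / \<psi>) = (1 + \<tau> / (norm \<psi>)\<^sup>2) * Re \<psi>" "Im (\<psi> + of_real \<tau> / \<psi>) = (1 - \<tau> / (norm \<psi>)\<^sup>2) * Im \<psi>"
proof -
  have "of_real \<tau> / \<psi> = of_real (\<tau> / (norm \<psi>)\<^sup>2) * cnj \<psi>"
    unfolding of_real_divide complex_norm_square using assms by simp
  thus "Re (\<psi> + of_real \<tau> / \<psi>) = (1 + \<tau> / (norm \<psi>)\<^sup>2) * Re \<psi>" "Im (\<psi> + of_real \<tau> / \<psi>) = (1 - \<tau> / (norm \<psi>)\<^sup>2) * Im \<psi>"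
    by (simp_all add: algebra_simps)
qed

text \<open>
  Dividing $\psi$ by its modulus gives a point of the unit circle, which the Joukowski map
  sends to the boundary of the ellipse, at distance at most $2(|\psi|-1)$ from $z$.
\<close>

lemma psi_bounded_away:
  assumes \<tau>: "0 \<le> \<tau>" "\<tau> < 1" and z: "z \<notin> ellipseE \<tau>" and d: "\<And>w. w \<in> ellipseE \<tau> \<Longrightarrow> \<delta> \<le> dist z w"
  shows "1 + \<delta> / 2 \<le> norm (psi \<tau> z)"
proof -
  define \<psi> where "\<psi> = psi \<tau> z"
  define r where "r = norm \<psi>"
  define u where "u = \<psi> / of_real r"
  have r1: "r > 1" and zeq: "z = \<psi> + of_real \<tau> / \<psi>"
    using psi_outside_ellipse[OF \<tau> z] unfolding r_def \<psi>_def by auto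
  have nz: "\<psi> \<noteq> 0"
  proof
    assume "\<psi> = 0"
    hence "r = 0" unfolding r_def by (simp only: norm_zero)
    thus False using r1 by simp
  qed
  have nu: "norm u = 1" unfolding u_def norm_divide using r1 nz by (simp add: r_def)
  hence u0: "u \<noteq> 0" by auto
  have "u + of_real \<tau> / u \<in> ellipseE \<tau>"
  proof -
    have "(Re u)\<^sup>2 + (Im u)\<^sup>2 = 1" using nu cmod_power2[of u] by simp
    thus ?thesis unfolding ellipseE_def mem_Collect_eq Re_Im_joukowski[OF u0] nu using \<tau> by simp
  qed
  hence "\<delta> \<le> dist z (u + of_real \<tau> / u)" by (rule d)
  also have "\<dots> = norm ((r - 1) *\<^sub>R (u - of_real (\<tau> / r) / u))"
  proof -
    have pu: "\<psi> = of_real r * u" using r1 by (simp add: u_def)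
    have "z - (u + of_real \<tau> / u) = (r - 1) *\<^sub>R (u - of_real (\<tau> / r) / u)"
      unfolding zeq pu scaleR_conv_of_real using r1 u0 by (simp add: field_simps)
    thus ?thesis by (simp only: dist_norm)
  qed
  also have "\<dots> \<le> (r - 1) * (norm u + norm (of_real (\<tau> / r) / u))"
    unfolding norm_scaleR using r1 by (intro mult_mono norm_triangle_ineq4) auto
  also have "\<dots> \<le> (r - 1) * 2"
  proof (rule mult_left_mono)
    have "\<tau> / r \<le> 1" using \<tau> r1 by (simp add: divide_le_eq)
    moreover have "norm (complex_of_real (\<tau> / r) / u) = \<tau> / r"
      unfolding norm_divide[of "complex_of_real (\<tau> / r)"] norm_of_real nu using \<tau> r1 by simp
    ultimately show "norm u + norm (of_real (\<tau> / r) / u) \<le> 2" using nu by (simp only:)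
  qed (use r1 in simp)
  finally show ?thesis by (simp add: r_def \<psi>_def)
qed

lemma closed_ellipseE: "closed (ellipseE \<tau>)"
  unfolding ellipseE_def divide_inverse by (intro closed_Collect_le continuous_intros)

lemma psi_holomorphic:
  assumes \<tau>: "0 \<le> \<tau>" "\<tau> < 1"
  shows "psi \<tau> holomorphic_on - ellipseE \<tau>"
proof -
  let ?S = "closed_segment (- complex_of_real (2 * sqrt \<tau>)) (complex_of_real (2 * sqrt \<tau>))"
  have "?S \<subseteq> ellipseE \<tau>"
  proof
    fix z assume "z \<in> ?S"
    then obtain x where x: "x \<in> closed_segment (- (2 * sqrt \<tau>)) (2 * sqrt \<tau>)" "z = of_real x"
      using closed_segment_of_real[of "- (2 * sqrt \<tau>)" "2 * sqrt \<tau>"] by auto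
    have "\<bar>x\<bar> \<le> 2 * sqrt \<tau>" using x(1) \<tau> by (auto simp: closed_segment_eq_real_ivl abs_le_iff)
    also have "\<dots> \<le> 1 + \<tau>"
      using arith_geo_mean_sqrt[of 1 \<tau>] \<tau> by simp
    finally have "\<bar>x\<bar> / (1 + \<tau>) \<le> 1" using \<tau> by simp
    hence "(\<bar>x\<bar> / (1 + \<tau>))\<^sup>2 \<le> 1" using \<tau> by (intro power_le_one) auto
    thus "z \<in> ellipseE \<tau>" by (simp add: x ellipseE_def power_divide)
  qed
  hence "sqrt_branch \<tau> holomorphic_on - ellipseE \<tau>"
    using sqrt_branch_holomorphic[OF \<tau>(1)] by (rule_tac holomorphic_on_subset) auto
  thus ?thesis unfolding psi_def by (intro holomorphic_intros) auto
qed

lemma norm_deriv_psi: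
  assumes \<tau>: "0 \<le> \<tau>" "\<tau> < 1" and z: "z \<notin> ellipseE \<tau>"
  shows "norm (deriv (psi \<tau>) z) = 1 / norm (1 - of_real \<tau> / (psi \<tau> z)\<^sup>2)"
proof -
  have op: "open (- ellipseE \<tau>)" using closed_ellipseE by auto
  have nz: "psi \<tau> z \<noteq> 0" using psi_outside_ellipse(1)[OF \<tau> z] by auto
  have d: "(psi \<tau> has_field_derivative deriv (psi \<tau>) z) (at z)"
    by (rule holomorphic_derivI[OF psi_holomorphic[OF \<tau>] op]) (use z in auto)
  have "((\<lambda>w. psi \<tau> w + of_real \<tau> / psi \<tau> w) has_field_derivative deriv (psi \<tau>) z * (1 - of_real \<tau> / (psi \<tau> z)\<^sup>2)) (at z)"
    using d nz by (auto intro!: derivative_eq_intros simp: field_simps power2_eq_square)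
  moreover have "((\<lambda>w. psi \<tau> w + of_real \<tau> / psi \<tau> w) has_field_derivative 1) (at z)"
    by (rule has_field_derivative_transform_within_open[OF DERIV_ident op])
       (use z psi_outside_ellipse(2)[OF \<tau>] in auto)
  ultimately have "deriv (psi \<tau>) z * (1 - of_real \<tau> / (psi \<tau> z)\<^sup>2) = 1" by (rule DERIV_unique)
  hence "norm (deriv (psi \<tau>) z) * norm (1 - of_real \<tau> / (psi \<tau> z)\<^sup>2) = 1" by (metis norm_mult norm_one)
  thus ?thesis by (metis nonzero_eq_divide_eq mult_zero_right zero_neq_one)
qed

text \<open>
  Off the imaginary axis $\operatorname{Re}\psi\ne0$ cancels from the quotient. The
  remaining expression is continuous, so it is the limit on the axis as well.
\<close>

lemma psi_quotient_eq:
  assumes \<tau>: "0 \<le> \<tau>" "\<tau> < 1" and z: "z \<notin> ellipseE \<tau>"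
  shows "psi_quotient \<tau> z = 2 * (norm (psi \<tau> z))\<^sup>2 * Im (psi \<tau> z) / ((norm (psi \<tau> z))\<^sup>2 - 1)"
proof -
  define Q where "Q = (\<lambda>w. 2 * (norm (psi \<tau> w))\<^sup>2 * Im (psi \<tau> w) / ((norm (psi \<tau> w))\<^sup>2 - 1))"
  define q where "q = (\<lambda>w. Im ((psi \<tau> w)\<^sup>2) / Re (psi \<tau> w - inverse (psi \<tau> w)))"
  have qQ: "q w = Q w" if w: "w \<notin> ellipseE \<tau>" "Re w \<noteq> 0" for w
  proof -
    define \<psi> where "\<psi> = psi \<tau> w"
    have r: "norm \<psi> > 1" and weq: "w = \<psi> + of_real \<tau> / \<psi>"
      using psi_outside_ellipse[OF \<tau> w(1)] unfolding \<psi>_def by auto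
    have nz: "\<psi> \<noteq> 0" using r by auto
    have r2: "(norm \<psi>)\<^sup>2 > 1" using r by (simp add: one_less_power)
    have "Re w = (1 + \<tau> / (norm \<psi>)\<^sup>2) * Re \<psi>" using Re_Im_joukowski(1)[OF nz, of \<tau>] weq by simp
    hence Re0: "Re \<psi> \<noteq> 0" using w(2) by auto
    have "Re (\<psi> - inverse \<psi>) = (1 - 1 / (norm \<psi>)\<^sup>2) * Re \<psi>"
      using Re_Im_joukowski(1)[OF nz, of "-1"] by (simp add: divide_inverse)
    moreover have "Im (\<psi>\<^sup>2) = 2 * Re \<psi> * Im \<psi>" by (simp add: power2_eq_square)
    moreover have "2 * x * y / ((1 - 1 / s) * x) = 2 * s * y / (s - 1)" if "x \<noteq> 0" "s > 1" for x y s :: real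
      using that by (simp add: divide_simps)
    ultimately show ?thesis unfolding q_def Q_def \<psi>_def[symmetric] using Re0 r2 by simp
  qed
  show ?thesis
  proof (cases "Re z = 0")
    case False
    thus ?thesis using qQ[OF z False] by (simp add: psi_quotient_def q_def Q_def Let_def)
  next
    case True
    have op: "open (- ellipseE \<tau>)" using closed_ellipseE by auto
    have "continuous_on (- ellipseE \<tau>) (psi \<tau>)" using psi_holomorphic[OF \<tau>] by (rule holomorphic_on_imp_continuous_on)
    hence cp: "isCont (psi \<tau>) z" using op z by (simp add: continuous_on_eq_continuous_at)
    have "(norm (psi \<tau> z))\<^sup>2 \<noteq> 1" using psi_outside_ellipse(1)[OF \<tau> z] by (simp add: power2_eq_1_iff) 
    moreover have "isCont (\<lambda>w. Im (psi \<tau> w)) z" by (intro continuous_Im cp)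
    ultimately have "isCont Q z" unfolding Q_def by (intro continuous_intros cp) auto
    hence "(Q \<longlongrightarrow> Q z) (at z within {w. Re w \<noteq> 0})" by (auto simp: isCont_def intro: tendsto_within_subset)
    moreover have "\<forall>\<^sub>F w in at z within {w. Re w \<noteq> 0}. Q w = q w"
    proof -
      have "\<forall>\<^sub>F w in at z within {w. Re w \<noteq> 0}. w \<in> - ellipseE \<tau>"
        by (rule eventually_at_in_open'[OF op, THEN filter_leD[OF at_le, rotated]]) (use z in auto)
      moreover have "\<forall>\<^sub>F w in at z within {w. Re w \<noteq> 0}. w \<in> {w. Re w \<noteq> 0}"
        by (auto simp: eventually_at_filter)
      ultimately show ?thesis by eventually_elim (use qQ in auto)
    qed
    ultimately have lim: "(q \<longlongrightarrow> Q z) (at z within {w. Re w \<noteq> 0})" by (simp add: tendsto_cong)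
    have "z islimpt {w. Re w \<noteq> 0}"
      unfolding islimpt_approachable
    proof (intro allI impI)
      fix e :: real assume e: "e > 0"
      show "\<exists>x'\<in>{w. Re w \<noteq> 0}. x' \<noteq> z \<and> dist x' z < e"
        by (rule bexI[of _ "z + of_real (e / 2)"]) (use e True in \<open>auto simp: dist_norm\<close>)
    qed
    hence "at z within {w. Re w \<noteq> 0} \<noteq> bot" by (simp add: trivial_limit_within)
    from tendsto_Lim[OF this lim] show ?thesis
      using True by (simp add: psi_quotient_def q_def Q_def Let_def)
  qed
qed

section \<open>The one-point function in the conformal coordinate\<close>

text \<open>
  Counting both indices from the top reverses the triangle and exchanges the roles of the
  indices.
\<close>

lemma sum_triangle_reverse:
  fixes F :: "nat \<Rightarrow> nat \<Rightarrow> 'a :: comm_monoid_add"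
  shows "(\<Sum>k<N. \<Sum>j\<le>k. F k j) = (\<Sum>b<N. \<Sum>a\<le>b. F (N - 1 - a) (N - 1 - b))"
proof -
  have 1: "(\<Sum>k<N. \<Sum>j\<le>k. F k j) = (\<Sum>(k, j)\<in>Sigma {..<N} (\<lambda>k. {..k}). F k j)"
    by (simp add: sum.Sigma)
  have 2: "(\<Sum>b<N. \<Sum>a\<le>b. F (N - 1 - a) (N - 1 - b)) = (\<Sum>(b, a)\<in>Sigma {..<N} (\<lambda>k. {..k}). F (N - 1 - a) (N - 1 - b))"
    by (simp add: sum.Sigma)
  show ?thesis unfolding 1 2
    by (rule sum.reindex_bij_witness[of _ "\<lambda>(b, a). (N - 1 - a, N - 1 - b)" "\<lambda>(k, j). (N - 1 - j, N - 1 - k)"]) auto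
qed

context elliptic_weight
begin

text \<open>
  In the coordinate $\psi$ the three-term recursion of the Hermite polynomials becomes the
  recursion of the coefficients, which depends on $\psi$ only through $\tau/\psi^2$.
\<close>

lemma poly_herm_joukowski:
  assumes \<psi>: "\<psi> \<noteq> 0"
  shows "poly (herm j) (\<psi> + of_real \<tau> / \<psi>) = of_real (fact j / n ^ j) * (\<psi> ^ j * coef n (of_real \<tau> / \<psi>\<^sup>2) j)"
proof (induction j rule: induct_nat_012)
  case 1
  show ?case using \<psi> n_pos by (simp add: herm.simps(2) pderiv_1 power2_eq_square field_simps)
next
  case (ge2 j)
  let ?z = "\<psi> + of_real \<tau> / \<psi>" and ?b = "of_real \<tau> / \<psi>\<^sup>2"
  have nn: "complex_of_real n \<noteq> 0" using n_pos by simp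
  have "poly (herm (Suc (Suc j))) ?z = ?z * poly (herm (Suc j)) ?z - of_real (\<tau> / n) * of_nat (Suc j) * poly (herm j) ?z"
    unfolding herm.simps(2)[of "Suc j"] pderiv_herm by simp
  also have "\<dots> = ?z * (of_real (fact (Suc j) / n ^ Suc j) * (\<psi> ^ Suc j * coef n ?b (Suc j))) - of_real (\<tau> / n) * of_nat (Suc j) * (of_real (fact j / n ^ j) * (\<psi> ^ j * coef n ?b j))"
    unfolding ge2 ..
  also have "\<dots> = of_real (fact (Suc j) / n ^ Suc (Suc j)) * (\<psi> ^ Suc (Suc j) * (of_real n * (1 + ?b) * coef n ?b (Suc j) - of_real n * ?b * coef n ?b j))"
    using \<psi> nn by (simp add: power2_eq_square field_simps)
  also have "\<dots> = of_real (fact (Suc (Suc j)) / n ^ Suc (Suc j)) * (\<psi> ^ Suc (Suc j) * coef n ?b (Suc (Suc j)))"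
  proof -
    have "of_nat (Suc (Suc j)) * coef n ?b (Suc (Suc j)) = of_real n * (1 + ?b) * coef n ?b (Suc j) - of_real n * ?b * coef n ?b j"
      by (simp del: of_nat_Suc)
    moreover have "complex_of_real (fact (Suc (Suc j)) / n ^ Suc (Suc j)) = of_real (fact (Suc j) / n ^ Suc (Suc j)) * of_nat (Suc (Suc j))"
      by (simp only: fact_Suc[of "Suc j"] of_real_mult of_real_divide of_real_of_nat_eq) simp
    moreover have "F * (P * X) = F' * (P * Y)" if "m * Y = X" "F' = F * m" for F P X F' Y m :: complex
      unfolding that(2) that(1)[symmetric] by (simp only: mult_ac)
    ultimately show ?thesis by blast
  qed
  finally show ?case .
qed simp

lemma poly_even_skew_joukowski:
  assumes \<psi>: "\<psi> \<noteq> 0" and n: "n = 2 * real N" and N: "N > 0"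
  shows "poly (even_skew k) (\<psi> + of_real \<tau> / \<psi>) =
     of_real (even_weight N k) * (\<Sum>j\<le>k. of_real (odd_weight N j) * (\<psi> ^ (2 * j) * coef n (of_real \<tau> / \<psi>\<^sup>2) (2 * j)))"
proof (induction k)
  case 0
  show ?case by (simp add: even_weight_def odd_weight_def)
next
  case (Suc k)
  let ?c = "\<lambda>j. \<psi> ^ (2 * j) * coef n (of_real \<tau> / \<psi>\<^sup>2) (2 * j)"
  have h: "poly (herm (2 * Suc k)) (\<psi> + of_real \<tau> / \<psi>) = of_real (even_weight N (Suc k)) * (of_real (odd_weight N (Suc k)) * ?c (Suc k))"
  proof -
    have "fact (2 * Suc k) / n ^ (2 * Suc k) = even_weight N (Suc k) * odd_weight N (Suc k)"
      unfolding weight_product[OF N] n by simp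
    thus ?thesis unfolding poly_herm_joukowski[OF \<psi>] by (simp only: of_real_mult mult.assoc)
  qed
  have w: "even_weight N (Suc k) = 2 * real (Suc k) / n * even_weight N k"
    unfolding even_weight_def n by (simp add: field_simps)
  have "poly (even_skew (Suc k)) (\<psi> + of_real \<tau> / \<psi>) = of_real (even_weight N (Suc k)) * (of_real (odd_weight N (Suc k)) * ?c (Suc k))
     + of_real (2 * real (Suc k) / n) * (of_real (even_weight N k) * (\<Sum>j\<le>k. of_real (odd_weight N j) * ?c j))"
    unfolding even_skew.simps poly_add poly_smult h Suc ..
  also have "of_real (2 * real (Suc k) / n) * (of_real (even_weight N k) * (\<Sum>j\<le>k. of_real (odd_weight N j) * ?c j))
     = of_real (even_weight N (Suc k)) * (\<Sum>j\<le>k. of_real (odd_weight N j) * ?c j)"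
    unfolding w of_real_mult by (simp only: mult.assoc)
  finally show ?case unfolding sum.atMost_Suc by (simp only: distrib_left add.commute)
qed

text \<open>
  Everything that does not depend on the summation indices is pulled out: the top weights,
  the leading asymptotics of the coefficients and the power $|\psi|^{4N-4}$. The remaining
  sum is the geometric one with factors close to 1.
\<close>

lemma density_sum_joukowski:
  fixes \<psi> :: complex
  assumes n: "n = 2 * real N" and N: "N > 0" and r: "norm \<psi> > 1"
  defines "\<beta> \<equiv> of_real \<tau> / \<psi>\<^sup>2" and "z \<equiv> \<psi> + of_real \<tau> / \<psi>"
  shows "density_sum N z = 2 * Im z * weight z * (n / ((1 - \<tau>) * pi * sqrt (1 - \<tau>\<^sup>2)))
     * (even_weight N (N - 1) * odd_weight N (N - 1)) * (exp (n * (2 + Re \<beta>)) / (2 * pi * n * norm (1 - \<beta>)))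
     * norm \<psi> ^ (4 * N - 4)
     * (\<Sum>b<N. \<Sum>a\<le>b. Im (\<psi> * (1 / \<psi>\<^sup>2) ^ a * cnj (1 / \<psi>\<^sup>2) ^ b * (odd_profile N a \<beta> * cnj (even_profile N b \<beta>))))"
proof -
  have \<psi>: "\<psi> \<noteq> 0" using r by auto
  have nr: "n = real (2 * N)" using n by simp
  have n\<beta>: "norm \<beta> < 1"
  proof -
    have "norm \<beta> = \<tau> / (norm \<psi>)\<^sup>2" using tau_nonneg by (simp add: \<beta>_def norm_divide norm_power)
    also have "\<dots> \<le> \<tau> / 1" using r tau_nonneg by (intro divide_left_mono) (auto simp: one_less_power less_imp_le)
    finally show ?thesis using tau_less_1 by simp
  qed
  hence \<beta>1: "\<beta> \<noteq> 1" by auto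
  define X where "X = n / ((1 - \<tau>) * pi * sqrt (1 - \<tau>\<^sup>2))"
  define \<Phi> where "\<Phi> = exp (of_nat (2 * N) * (1 + \<beta> / 2)) / (of_real (sqrt (2 * pi * real (2 * N))) * csqrt (1 - \<beta>))"
  let ?E = "even_weight N (N - 1)" and ?O = "odd_weight N (N - 1)"
  have E0: "?E > 0" "?O > 0" using even_weight_pos[OF N] odd_weight_pos[OF N] by auto
  have n\<Phi>: "(norm \<Phi>)\<^sup>2 = exp (n * (2 + Re \<beta>)) / (2 * pi * n * norm (1 - \<beta>))"
  proof -
    have "norm \<Phi> = exp (n * (1 + Re \<beta> / 2)) / (sqrt (2 * pi * n) * sqrt (norm (1 - \<beta>)))"
      unfolding \<Phi>_def nr by (simp add: norm_divide norm_mult norm_csqrt)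
    hence "(norm \<Phi>)\<^sup>2 = (exp (n * (1 + Re \<beta> / 2)))\<^sup>2 / ((sqrt (2 * pi * n))\<^sup>2 * (sqrt (norm (1 - \<beta>)))\<^sup>2)"
      by (simp only: power_divide power_mult_distrib)
    also have "(exp (n * (1 + Re \<beta> / 2)))\<^sup>2 = exp (n * (2 + Re \<beta>))"
      by (simp add: power2_eq_square exp_add[symmetric] algebra_simps)
    finally show ?thesis using n_pos by simp
  qed
  have odd: "of_real (even_weight N (N - 1 - a)) * coef n \<beta> (Suc (2 * (N - 1 - a))) = of_real ?E * (\<Phi> * odd_profile N a \<beta>)" if a: "a < N" for a
  proof -
    have i: "Suc (2 * (N - 1 - a)) = 2 * N - (2 * a + 1)" using a by simp
    have "coef n \<beta> (Suc (2 * (N - 1 - a))) = \<Phi> * scaled_coef (2 * N) (2 * a + 1) \<beta>"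
      unfolding i nr \<Phi>_def by (rule coef_eq_scaled_coef) (use N \<beta>1 in auto)
    thus ?thesis unfolding odd_profile_def using E0 by (simp add: field_simps)
  qed
  have even: "of_real (odd_weight N (N - 1 - b)) * coef n \<beta> (2 * (N - 1 - b)) = of_real ?O * (\<Phi> * even_profile N b \<beta>)" if b: "b < N" for b
  proof -
    have i: "2 * (N - 1 - b) = 2 * N - (2 * b + 2)" using b by simp
    have "coef n \<beta> (2 * (N - 1 - b)) = \<Phi> * scaled_coef (2 * N) (2 * b + 2) \<beta>"
      unfolding i nr \<Phi>_def by (rule coef_eq_scaled_coef) (use N \<beta>1 in auto)
    thus ?thesis unfolding even_profile_def using E0 by (simp add: field_simps)
  qed
  define F where "F = (\<lambda>k j. Im ((of_real (even_weight N k) * (\<psi> ^ Suc (2 * k) * coef n \<beta> (Suc (2 * k)))) * cnj (of_real (odd_weight N j) * (\<psi> ^ (2 * j) * coef n \<beta> (2 * j)))))"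
  have termk: "Im (poly (herm (Suc (2 * k))) z * cnj (poly (even_skew k) z)) / skew_norm (2 * k) = X * (\<Sum>j\<le>k. F k j)" for k
  proof -
    let ?c = "\<psi> ^ Suc (2 * k) * coef n \<beta> (Suc (2 * k))"
    let ?S = "\<Sum>j\<le>k. of_real (odd_weight N j) * (\<psi> ^ (2 * j) * coef n \<beta> (2 * j))"
    have "poly (herm (Suc (2 * k))) z * cnj (poly (even_skew k) z)
       = of_real (fact (Suc (2 * k)) / n ^ Suc (2 * k)) * ((of_real (even_weight N k) * ?c) * cnj ?S)"
      unfolding z_def poly_herm_joukowski[OF \<psi>] poly_even_skew_joukowski[OF \<psi> n N] \<beta>_def[symmetric]
      by (simp only: complex_cnj_mult complex_cnj_complex_of_real mult_ac)
    also have "(of_real (even_weight N k) * ?c) * cnj ?S = (\<Sum>j\<le>k. (of_real (even_weight N k) * ?c) * cnj (of_real (odd_weight N j) * (\<psi> ^ (2 * j) * coef n \<beta> (2 * j))))"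
      unfolding cnj_sum sum_distrib_left ..
    finally have "Im (poly (herm (Suc (2 * k))) z * cnj (poly (even_skew k) z)) = (fact (Suc (2 * k)) / n ^ Suc (2 * k)) * (\<Sum>j\<le>k. F k j)"
    proof -
      assume e: "poly (herm (Suc (2 * k))) z * cnj (poly (even_skew k) z) = of_real (fact (Suc (2 * k)) / n ^ Suc (2 * k)) * (\<Sum>j\<le>k. (of_real (even_weight N k) * ?c) * cnj (of_real (odd_weight N j) * (\<psi> ^ (2 * j) * coef n \<beta> (2 * j))))"
      have "Im (of_real x * w) = x * Im w" for x w by simp
      thus ?thesis unfolding e F_def by (simp only: Im_sum)
    qed
    moreover have "(fact (Suc (2 * k)) / n ^ Suc (2 * k)) / skew_norm (2 * k) = X"
    proof -
      have "\<tau>\<^sup>2 < 1" using tau_nonneg tau_less_1 by (simp add: power_less_one_iff abs_square_less_1)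
      moreover have "x / ((1 - \<tau>) * (pi * s / n * x)) = n / ((1 - \<tau>) * pi * s)" if "x > 0" "s > 0" for x s
        using that n_pos tau_less_1 by (simp add: field_simps)
      moreover have "fact (Suc (2 * k)) / n ^ Suc (2 * k) > 0" using n_pos by simp
      moreover have "norm_sq (Suc (2 * k)) = pi * sqrt (1 - \<tau>\<^sup>2) / n * (fact (Suc (2 * k)) / n ^ Suc (2 * k))" unfolding norm_sq_def by (simp only: times_divide_eq_right)
      ultimately show ?thesis unfolding skew_norm_def X_def by (simp del: fact_Suc power_Suc)
    qed
    ultimately show ?thesis by (metis times_divide_eq_left)
  qed
  have FN: "F (N - 1 - a) (N - 1 - b) = ?E * ?O * (norm \<Phi>)\<^sup>2 * norm \<psi> ^ (4 * N - 4) * Im (\<psi> * (1 / \<psi>\<^sup>2) ^ a * cnj (1 / \<psi>\<^sup>2) ^ b * (odd_profile N a \<beta> * cnj (even_profile N b \<beta>)))"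
    if ab: "a < N" "b < N" for a b
  proof -
    let ?k = "N - 1 - a" and ?j = "N - 1 - b"
    have p1: "\<psi> ^ Suc (2 * ?k) = \<psi> ^ (2 * (N - 1)) * (\<psi> * (1 / \<psi>\<^sup>2) ^ a)"
    proof -
      have "2 * (N - 1) = 2 * ?k + 2 * a" using ab by simp
      hence "\<psi> ^ (2 * (N - 1)) = \<psi> ^ (2 * ?k) * (\<psi>\<^sup>2) ^ a" by (simp only: power_add power_mult)
      thus ?thesis using \<psi> by (simp add: power_divide)
    qed
    have p2: "\<psi> ^ (2 * ?j) = \<psi> ^ (2 * (N - 1)) * (1 / \<psi>\<^sup>2) ^ b"
    proof -
      have "2 * (N - 1) = 2 * ?j + 2 * b" using ab by simp
      hence "\<psi> ^ (2 * (N - 1)) = \<psi> ^ (2 * ?j) * (\<psi>\<^sup>2) ^ b" by (simp only: power_add power_mult)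
      thus ?thesis using \<psi> by (simp add: power_divide)
    qed
    have pp: "\<psi> ^ (2 * (N - 1)) * cnj (\<psi> ^ (2 * (N - 1))) = of_real (norm \<psi> ^ (4 * N - 4))"
    proof -
      have e: "(2 * (N - 1)) * 2 = 4 * N - 4" by simp
      have "\<psi> ^ (2 * (N - 1)) * cnj (\<psi> ^ (2 * (N - 1))) = of_real ((norm (\<psi> ^ (2 * (N - 1))))\<^sup>2)"
        by (simp only: complex_norm_square)
      also have "(norm (\<psi> ^ (2 * (N - 1))))\<^sup>2 = norm \<psi> ^ (4 * N - 4)"
        unfolding norm_power power_mult[symmetric] e ..
      finally show ?thesis .
    qed
    have "(of_real (even_weight N ?k) * (\<psi> ^ Suc (2 * ?k) * coef n \<beta> (Suc (2 * ?k)))) * cnj (of_real (odd_weight N ?j) * (\<psi> ^ (2 * ?j) * coef n \<beta> (2 * ?j)))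
      = (\<psi> ^ Suc (2 * ?k) * (of_real (even_weight N ?k) * coef n \<beta> (Suc (2 * ?k)))) * cnj (\<psi> ^ (2 * ?j) * (of_real (odd_weight N ?j) * coef n \<beta> (2 * ?j)))"
      by (simp only: mult_ac)
    also have "\<dots> = (\<psi> ^ (2 * (N - 1)) * cnj (\<psi> ^ (2 * (N - 1)))) * (of_real ?E * of_real ?O) * (\<Phi> * cnj \<Phi>)
       * (\<psi> * (1 / \<psi>\<^sup>2) ^ a * cnj (1 / \<psi>\<^sup>2) ^ b * (odd_profile N a \<beta> * cnj (even_profile N b \<beta>)))"
      unfolding odd[OF ab(1)] even[OF ab(2)] p1 p2
      by (simp only: complex_cnj_mult complex_cnj_complex_of_real complex_cnj_power mult_ac)
    also have "\<dots> = of_real (?E * ?O * (norm \<Phi>)\<^sup>2 * norm \<psi> ^ (4 * N - 4)) * (\<psi> * (1 / \<psi>\<^sup>2) ^ a * cnj (1 / \<psi>\<^sup>2) ^ b * (odd_profile N a \<beta> * cnj (even_profile N b \<beta>)))"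
      unfolding pp unfolding complex_norm_square[symmetric] of_real_mult by (simp only: mult_ac)
    finally have e: "(of_real (even_weight N ?k) * (\<psi> ^ Suc (2 * ?k) * coef n \<beta> (Suc (2 * ?k)))) * cnj (of_real (odd_weight N ?j) * (\<psi> ^ (2 * ?j) * coef n \<beta> (2 * ?j))) = \<dots>" .
    have "Im (of_real x * w) = x * Im w" for x w by simp
    thus ?thesis unfolding F_def e by (simp only:)
  qed
  have "density_sum N z = 2 * Im z * weight z * (X * (\<Sum>k<N. \<Sum>j\<le>k. F k j))"
    unfolding density_sum_def termk by (simp only: sum_distrib_left)
  also have "(\<Sum>k<N. \<Sum>j\<le>k. F k j) = (\<Sum>b<N. \<Sum>a\<le>b. F (N - 1 - a) (N - 1 - b))"
    by (rule sum_triangle_reverse)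
  also have "\<dots> = (\<Sum>b<N. \<Sum>a\<le>b. ?E * ?O * (norm \<Phi>)\<^sup>2 * norm \<psi> ^ (4 * N - 4) * Im (\<psi> * (1 / \<psi>\<^sup>2) ^ a * cnj (1 / \<psi>\<^sup>2) ^ b * (odd_profile N a \<beta> * cnj (even_profile N b \<beta>))))"
    by (intro sum.cong refl FN) auto
  also have "\<dots> = ?E * ?O * (norm \<Phi>)\<^sup>2 * norm \<psi> ^ (4 * N - 4) * (\<Sum>b<N. \<Sum>a\<le>b. Im (\<psi> * (1 / \<psi>\<^sup>2) ^ a * cnj (1 / \<psi>\<^sup>2) ^ b * (odd_profile N a \<beta> * cnj (even_profile N b \<beta>))))"
    by (simp only: sum_distrib_left)
  finally show ?thesis unfolding n\<Phi> X_def by (simp only: mult_ac)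
qed

end

section \<open>Assembly of the asymptotic formula\<close>

text \<open>
  By the product formula for the weights this is $(2N-2)!/(2N)^{2N-2}$ divided by its
  Stirling approximation.
\<close>

definition stirling_factor :: "nat \<Rightarrow> real" where
  "stirling_factor N = even_weight N (N - 1) * odd_weight N (N - 1) * exp (2 * real N) / (2 * sqrt (pi * real N))"

definition edge_sum :: "real \<Rightarrow> nat \<Rightarrow> complex \<Rightarrow> real" where
  "edge_sum \<tau> N \<psi> = (\<Sum>b<N. \<Sum>a\<le>b. Im (\<psi> * (1 / \<psi>\<^sup>2) ^ a * cnj (1 / \<psi>\<^sup>2) ^ b *
      (odd_profile N a (of_real \<tau> / \<psi>\<^sup>2) * cnj (even_profile N b (of_real \<tau> / \<psi>\<^sup>2)))))"

text \<open>
  At $\beta=0$ the scaled coefficient with index $2N$ is the quotient of Stirling's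
  approximation and $(2N)!$, so Laplace's method gives Stirling's formula with its error.
  The factor $2N/(2N-1)$ comes from $(2N-2)!$ in place of $(2N)!$.
\<close>

lemma stirling_factor_asymptotics:
  obtains C where "C \<ge> 0" "\<And>N. N \<ge> 1 \<Longrightarrow> C \<le> real N \<Longrightarrow> \<bar>stirling_factor N - 1\<bar> \<le> (2 + C) / real N"
proof -
  obtain C where C: "C \<ge> 0"
    "\<And>d m \<beta>. d > 0 \<Longrightarrow> m \<le> d \<Longrightarrow> norm \<beta> \<le> 0 \<Longrightarrow> norm (scaled_coef d m \<beta> - 1) \<le> C * (1 + (real m)\<^sup>2) / real d"
    using scaled_coef_asymptotics[of 0] by auto
  have coef0: "coef x 0 j = of_real (x ^ j / fact j)" for x j
  proof (induction j rule: induct_nat_012)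
    case (ge2 j)
    have "of_nat (Suc (Suc j)) \<noteq> (0 :: complex)" by (simp del: of_nat_Suc)
    have "coef x 0 (Suc (Suc j)) = of_real x * of_real (x ^ Suc j / fact (Suc j)) / of_nat (Suc (Suc j))"
      using ge2 by simp
    also have "\<dots> = of_real (x ^ Suc (Suc j) / fact (Suc (Suc j)))"
      by (simp only: fact_Suc[of "Suc j"] power_Suc[of x "Suc j"] of_real_mult of_real_divide of_real_of_nat_eq times_divide_eq_right divide_divide_eq_left mult.commute[of "of_nat _"])
    finally show ?case .
  qed simp_all
  have main: "\<bar>stirling_factor N - 1\<bar> \<le> (2 + C) / real N" if N: "N \<ge> 1" and NC: "C \<le> real N" for N
  proof -
    define w where "w = sqrt (4 * pi * real N) * exp (- (2 * real N)) * ((2 * real N) ^ (2 * N) / fact (2 * N))"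
    have "scaled_coef (2 * N) 0 0 = of_real w"
      unfolding scaled_coef_def coef0 w_def by (simp add: exp_of_real[symmetric])
    hence "norm (complex_of_real w - 1) \<le> C * (1 + 0) / real (2 * N)" using C(2)[of "2 * N" 0 0] N by simp
    moreover have "norm (complex_of_real w - 1) = \<bar>w - 1\<bar>" by (metis norm_of_real of_real_1 of_real_diff)
    ultimately have w1: "\<bar>w - 1\<bar> \<le> C / (2 * real N)" by simp
    have half: "C / (2 * real N) \<le> 1 / 2" using NC N by (simp add: field_simps)
    have w2: "w \<ge> 1 / 2" using w1 half by linarith
    have prod: "stirling_factor N * w = 2 * real N / (2 * real N - 1)"
    proof -
      have sq: "sqrt (4 * pi * real N) = 2 * sqrt (pi * real N)" by (simp add: real_sqrt_mult)
      have e: "exp (2 * real N) * exp (- (2 * real N)) = 1" by (simp add: exp_add[symmetric])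
      obtain M where M: "N = Suc M" using N by (cases N) auto
      have f: "fact (2 * N) = (2 * real N) * (2 * real N - 1) * fact (2 * M)" unfolding M by (simp add: algebra_simps)
      have p: "(2 * real N) ^ (2 * N) = (2 * real N)\<^sup>2 * (2 * real N) ^ (2 * M)" unfolding M by (simp add: power2_eq_square)
      have wp: "even_weight N (N - 1) * odd_weight N (N - 1) = fact (2 * M) / (2 * real N) ^ (2 * M)"
        using weight_product[of N "N - 1"] by (simp add: M)
      have nz: "sqrt (pi * real N) \<noteq> 0" "(2 * real N) ^ (2 * M) \<noteq> 0" "fact (2 * M) \<noteq> (0 :: real)" "2 * real N \<noteq> 0" "2 * real N - 1 \<noteq> 0"
        using N by auto
      have "stirling_factor N * w = (exp (2 * real N) * exp (- (2 * real N))) *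
         (fact (2 * M) / (2 * real N) ^ (2 * M) / (2 * sqrt (pi * real N)) * (2 * sqrt (pi * real N)) * ((2 * real N)\<^sup>2 * (2 * real N) ^ (2 * M) / ((2 * real N) * (2 * real N - 1) * fact (2 * M))))"
        unfolding stirling_factor_def w_def wp sq f p by (simp only: times_divide_eq_left times_divide_eq_right mult_ac)
      also have "\<dots> = 2 * real N / (2 * real N - 1)"
      proof -
        have cancel: "F / P / s * s * (y\<^sup>2 * P / (y * v * F)) = y / v" if "F \<noteq> 0" "P \<noteq> 0" "s \<noteq> 0" "y \<noteq> 0" "v \<noteq> 0" for F P s y v :: real
          using that by (simp add: field_simps power2_eq_square)
        show ?thesis unfolding e mult_1_left by (rule cancel) (use nz in simp_all)
      qed
      finally show ?thesis .
    qed
    have "(stirling_factor N - 1) * w = (2 * real N / (2 * real N - 1) - 1) + (1 - w)"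
      using prod by (simp add: algebra_simps)
    hence "\<bar>stirling_factor N - 1\<bar> * w = \<bar>(2 * real N / (2 * real N - 1) - 1) + (1 - w)\<bar>"
      using w2 by (metis abs_mult abs_of_nonneg order_trans zero_le_divide_1_iff zero_le_numeral)
    also have "\<dots> \<le> 1 / real N + C / (2 * real N)"
    proof -
      have "2 * real N / (2 * real N - 1) - 1 = 1 / (2 * real N - 1)" using N by (simp add: field_simps)
      moreover have "1 / (2 * real N - 1) \<le> 1 / real N" "0 \<le> 1 / (2 * real N - 1)" using N by (auto intro!: divide_left_mono)
      ultimately show ?thesis using w1 by linarith
    qed
    finally have a: "\<bar>stirling_factor N - 1\<bar> * w \<le> 1 / real N + C / (2 * real N)" .
    have "\<bar>stirling_factor N - 1\<bar> * (1 / 2) \<le> \<bar>stirling_factor N - 1\<bar> * w" using w2 by (intro mult_left_mono) auto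
    also note a
    finally have "\<bar>stirling_factor N - 1\<bar> \<le> 2 * (1 / real N + C / (2 * real N))" by simp
    also have "\<dots> = (2 + C) / real N" using N by (simp add: field_simps)
    finally show ?thesis .
  qed
  show ?thesis by (rule that[OF C(1)]) (use main in auto)
qed

text \<open>
  The one-point function and the claimed leading term share the factor $K$, which contains
  all exponentials and the distance to the real axis. What is left of the former is the sum
  with its Stirling factor, and of the latter the limit of that sum.
\<close>

lemma common_prefactor:
  assumes \<tau>: "0 \<le> \<tau>" "\<tau> < 1" and z: "z \<notin> ellipseE \<tau>" and N: "N \<ge> 1"
    and E: "eGinSE \<tau> N M g Z" and R: "one_point_function N M Z R"
  obtains K where "R z = stirling_factor N * edge_sum \<tau> N (psi \<tau> z) * K" "R_leading \<tau> N z = limit_sum (psi \<tau> z) * K"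
    "Im z = 0 \<Longrightarrow> K = 0"
proof -
  define \<psi> where "\<psi> = psi \<tau> z"
  define r where "r = norm \<psi>"
  define \<beta> where "\<beta> = of_real \<tau> / \<psi>\<^sup>2"
  have r1: "r > 1" and zeq: "z = \<psi> + of_real \<tau> / \<psi>"
    using psi_outside_ellipse[OF \<tau> z] unfolding r_def \<psi>_def by auto
  have nz: "\<psi> \<noteq> 0" using r1 by (auto simp: r_def)
  have N0: "N > 0" using N by simp
  interpret elliptic_weight \<tau> "2 * real N" by unfold_locales (use \<tau> N in auto)
  define w where "w = exp (- (2 * real N) * eGinSE_V \<tau> z)"
  have ww: "weight z = w" by (simp add: weight_def w_def)
  have t2: "1 - \<tau>\<^sup>2 > 0" using \<tau> by (simp add: power_less_one_iff abs_square_less_1)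
  have b1: "norm (1 - \<beta>) > 0"
  proof -
    have "norm \<beta> = \<tau> / r\<^sup>2" using \<tau> by (simp add: \<beta>_def r_def norm_divide norm_power)
    also have "\<dots> \<le> \<tau> / 1" using r1 \<tau> by (intro divide_left_mono) (auto simp: one_less_power less_imp_le)
    finally have "\<beta> \<noteq> 1" using \<tau> by auto
    thus ?thesis by simp
  qed
  define K where "K = Im z / (1 - \<tau>) * sqrt (real N / (pi ^ 3 * (1 - \<tau>\<^sup>2))) * (1 / norm (1 - \<beta>)) * 2 * r ^ (4 * N - 4) * (w * exp (2 * real N * (1 + Re \<beta>)))"
  have "R z = density_sum N z" by (rule one_point_function_eq[OF refl E R])
  also have "\<dots> = 2 * Im z * weight z * (2 * real N / ((1 - \<tau>) * pi * sqrt (1 - \<tau>\<^sup>2)))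
     * (even_weight N (N - 1) * odd_weight N (N - 1)) * (exp (2 * real N * (2 + Re \<beta>)) / (2 * pi * (2 * real N) * norm (1 - \<beta>)))
     * r ^ (4 * N - 4) * edge_sum \<tau> N \<psi>"
    using density_sum_joukowski[OF refl N0 r1[unfolded r_def]]
    by (simp only: zeq[symmetric] edge_sum_def r_def \<beta>_def)
  also have "\<dots> = stirling_factor N * edge_sum \<tau> N \<psi> * K"
  proof -
    define s where "s = sqrt (pi * real N)"
    have s: "s > 0" "s\<^sup>2 = pi * real N" using N by (auto simp: s_def)
    have ex: "exp (2 * real N * (2 + Re \<beta>)) = exp (2 * real N) * exp (2 * real N * (1 + Re \<beta>))"
      unfolding exp_add[symmetric] by (simp add: algebra_simps)
    have sq: "sqrt (real N / (pi ^ 3 * (1 - \<tau>\<^sup>2))) = s / (pi\<^sup>2 * sqrt (1 - \<tau>\<^sup>2))"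
    proof -
      have "real N / (pi ^ 3 * (1 - \<tau>\<^sup>2)) = (pi * real N) / ((pi\<^sup>2)\<^sup>2 * (1 - \<tau>\<^sup>2))"
        by (simp add: power2_eq_square power3_eq_cube)
      hence "sqrt (real N / (pi ^ 3 * (1 - \<tau>\<^sup>2))) = sqrt (pi * real N) / (sqrt ((pi\<^sup>2)\<^sup>2) * sqrt (1 - \<tau>\<^sup>2))"
        by (simp only: real_sqrt_divide real_sqrt_mult)
      moreover have "sqrt ((pi\<^sup>2)\<^sup>2) = pi\<^sup>2" by (rule real_sqrt_unique) simp_all
      ultimately show ?thesis by (simp only: s_def)
    qed
    have alg: "2 * y * w * (m / (t * pi * q)) * W * (E1 * E2 / (2 * pi * m * b)) * P * S
        = W * E1 / (2 * s) * S * (y / t * (s / (pi\<^sup>2 * q)) * (1 / b) * 2 * P * (w * E2))"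
      if "m \<noteq> 0" "t \<noteq> 0" "q \<noteq> 0" "b \<noteq> 0" for y m t q W E1 E2 b P S :: real
      using that s by (simp add: field_simps power2_eq_square)
    show ?thesis unfolding ww ex K_def sq stirling_factor_def s_def[symmetric]
      by (rule alg) (use N \<tau> t2 b1 in auto)
  qed
  finally have R: "R z = stirling_factor N * edge_sum \<tau> N \<psi> * K" .
  have lead: "R_leading \<tau> N z = limit_sum \<psi> * K"
  proof -
    have om: "exp (- 2 * real N * Omega \<tau> z) = w * exp (2 * real N * (1 + Re \<beta>)) * r ^ (4 * N)"
    proof -
      have zp: "2 * z / (z + sqrt_branch \<tau> z) = 1 + \<beta>"
      proof -
        have "z + sqrt_branch \<tau> z = 2 * \<psi>" by (simp add: \<psi>_def psi_def)
        hence "2 * z / (z + sqrt_branch \<tau> z) = z / \<psi>" by simp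
        also have "\<dots> = 1 + \<beta>" by (subst zeq) (use nz in \<open>simp add: \<beta>_def field_simps power2_eq_square\<close>)
        finally show ?thesis .
      qed
      have "cmod ((z + sqrt_branch \<tau> z) / 2) = r" by (simp add: r_def \<psi>_def psi_def)
      hence om1: "Omega \<tau> z = eGinSE_V \<tau> z - (1 + Re \<beta>) - 2 * ln r"
        unfolding Omega_def zp eGinSE_V_def by simp
      have "- 2 * real N * Omega \<tau> z = - (2 * real N) * eGinSE_V \<tau> z + 2 * real N * (1 + Re \<beta>) + real (4 * N) * ln r"
        unfolding om1 by (simp add: algebra_simps)
      hence "exp (- 2 * real N * Omega \<tau> z) = w * exp (2 * real N * (1 + Re \<beta>)) * exp (real (4 * N) * ln r)"
        by (simp only: exp_add w_def)
      also have "exp (real (4 * N) * ln r) = r ^ (4 * N)"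
        unfolding exp_of_nat_mult using r1 by simp
      finally show ?thesis .
    qed
    have rp: "r ^ (4 * N) = r ^ (4 * N - 4) * r ^ 4"
      using N by (simp flip: power_add)
    have L: "limit_sum \<psi> = r ^ 4 * (r\<^sup>2 * Im \<psi> / (r\<^sup>2 - 1)) / (norm (\<psi>\<^sup>2 - 1))\<^sup>2"
    proof -
      have "r ^ 6 = r ^ 4 * r\<^sup>2" by (simp flip: power_add)
      thus ?thesis unfolding limit_sum_def r_def[symmetric] by simp
    qed
    show ?thesis
      unfolding R_leading_def om rp psi_quotient_eq[OF \<tau> z] norm_deriv_psi[OF \<tau> z] \<psi>_def[symmetric] L K_def r_def[symmetric] \<beta>_def[symmetric]
      by (simp add: power_divide field_simps)
  qed
  show ?thesis
    by (rule that[of K]) (use R lead in \<open>auto simp: \<psi>_def K_def\<close>)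
qed

text \<open>
  On the real axis both sides of the formula vanish, so the value there is immaterial for
  the identity; 0 is uniformly small.
\<close>

definition relative_error :: "real \<Rightarrow> nat \<Rightarrow> complex \<Rightarrow> real" where
  "relative_error \<tau> N z = (if Im z = 0 then 0 else stirling_factor N * edge_sum \<tau> N (psi \<tau> z) / limit_sum (psi \<tau> z) - 1)"

lemma limit_sum_nonzero:
  assumes \<tau>: "0 \<le> \<tau>" "\<tau> < 1" and z: "z \<notin> ellipseE \<tau>" "Im z \<noteq> 0"
  shows "limit_sum (psi \<tau> z) \<noteq> 0"
proof -
  have r: "norm (psi \<tau> z) > 1" and zeq: "z = psi \<tau> z + of_real \<tau> / psi \<tau> z" using psi_outside_ellipse[OF \<tau> z(1)] by auto
  have nz: "psi \<tau> z \<noteq> 0" using r by auto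
  have "Im z = (1 - \<tau> / (norm (psi \<tau> z))\<^sup>2) * Im (psi \<tau> z)"
    using Re_Im_joukowski(2)[OF nz, of \<tau>] zeq by simp
  hence "Im (psi \<tau> z) \<noteq> 0" using z(2) by auto
  thus ?thesis using limit_sum_lower_bound[OF r] by auto
qed

lemma relative_error_bound:
  assumes \<tau>: "0 \<le> \<tau>" "\<tau> < 1" and r0: "r0 > 1"
  obtains C where "\<forall>\<^sub>F N in sequentially. \<forall>z. z \<notin> ellipseE \<tau> \<longrightarrow> r0 \<le> norm (psi \<tau> z) \<longrightarrow> \<bar>relative_error \<tau> N z\<bar> \<le> C / real N"
proof (rule profile_bounds_Im[OF \<tau>])
  fix C :: real
  assume C: "C \<ge> 0"
    "\<And>N a \<beta>. a < N \<Longrightarrow> norm \<beta> \<le> \<tau> \<Longrightarrow> norm (odd_profile N a \<beta> - 1) \<le> C * (1 + real a) ^ 8 / real N"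
    "\<And>N a \<beta>. a < N \<Longrightarrow> norm \<beta> \<le> \<tau> \<Longrightarrow> norm (even_profile N a \<beta> - 1) \<le> C * (1 + real a) ^ 8 / real N"
    "\<And>N a \<beta>. a < N \<Longrightarrow> norm \<beta> \<le> \<tau> \<Longrightarrow> \<bar>Im (odd_profile N a \<beta>)\<bar> \<le> C * (1 + real a) ^ 8 / real N * \<bar>Im \<beta>\<bar>"
    "\<And>N a \<beta>. a < N \<Longrightarrow> norm \<beta> \<le> \<tau> \<Longrightarrow> \<bar>Im (even_profile N a \<beta>)\<bar> \<le> C * (1 + real a) ^ 8 / real N * \<bar>Im \<beta>\<bar>"
  obtain D where D: "D \<ge> 0"
    "\<And>(N :: nat) \<psi> A B. N \<ge> 1 \<Longrightarrow> norm \<psi> \<ge> r0 \<Longrightarrow>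
      (\<And>a. a < N \<Longrightarrow> norm (A a - 1) \<le> C * (1 + real a) ^ 8 / real N) \<Longrightarrow>
      (\<And>a. a < N \<Longrightarrow> norm (B a - 1) \<le> C * (1 + real a) ^ 8 / real N) \<Longrightarrow>
      (\<And>a. a < N \<Longrightarrow> \<bar>Im (A a)\<bar> \<le> C * (1 + real a) ^ 8 / real N * \<bar>Im (1 / \<psi>\<^sup>2)\<bar>) \<Longrightarrow>
      (\<And>a. a < N \<Longrightarrow> \<bar>Im (B a)\<bar> \<le> C * (1 + real a) ^ 8 / real N * \<bar>Im (1 / \<psi>\<^sup>2)\<bar>) \<Longrightarrow>
      \<bar>(\<Sum>b<N. \<Sum>a\<le>b. Im (\<psi> * (1 / \<psi>\<^sup>2) ^ a * cnj (1 / \<psi>\<^sup>2) ^ b * (A a * cnj (B b)))) - limit_sum \<psi>\<bar>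
        \<le> D * \<bar>Im \<psi>\<bar> / real N"
    using dominant_sum_error[OF r0 C(1)] by blast
  obtain G where G: "G \<ge> 0" "\<And>N. N \<ge> 1 \<Longrightarrow> G \<le> real N \<Longrightarrow> \<bar>stirling_factor N - 1\<bar> \<le> (2 + G) / real N"
    using stirling_factor_asymptotics by blast
  define C' where "C' = (3 + G) * (4 * D) + (2 + G)"
  have C'0: "C' \<ge> 0" using G D by (simp add: C'_def)
  have bound: "\<bar>relative_error \<tau> N z\<bar> \<le> C' / real N"
    if N: "N \<ge> 1" "G \<le> real N" and z: "z \<notin> ellipseE \<tau>" and r: "r0 \<le> norm (psi \<tau> z)" for N z
  proof (cases "Im z = 0")
    case True
    thus ?thesis using C'0 by (simp add: relative_error_def)
  next
    case False
    define \<psi> where "\<psi> = psi \<tau> z"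
    define \<beta> where "\<beta> = of_real \<tau> / \<psi>\<^sup>2"
    let ?L = "limit_sum \<psi>" and ?S = "edge_sum \<tau> N \<psi>" and ?G = "stirling_factor N"
    have rr: "norm \<psi> > 1" "r0 \<le> norm \<psi>" using r r0 by (auto simp: \<psi>_def)
    have L: "?L \<noteq> 0" unfolding \<psi>_def by (rule limit_sum_nonzero[OF \<tau> z False])
    have n\<beta>: "norm \<beta> \<le> \<tau>"
    proof -
      have "norm \<beta> = \<tau> / (norm \<psi>)\<^sup>2" using \<tau> by (simp add: \<beta>_def norm_divide norm_power)
      also have "\<dots> \<le> \<tau> / 1" using rr \<tau> by (intro divide_left_mono) (auto simp: one_less_power less_imp_le)
      finally show ?thesis by simp
    qed
    have Im\<beta>: "\<bar>Im \<beta>\<bar> \<le> \<bar>Im (1 / \<psi>\<^sup>2)\<bar>"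
    proof -
      have "\<beta> = of_real \<tau> * (1 / \<psi>\<^sup>2)" by (simp add: \<beta>_def)
      moreover have "Im (of_real x * v) = x * Im v" for x v by simp
      ultimately have "Im \<beta> = \<tau> * Im (1 / \<psi>\<^sup>2)" by (simp only:)
      hence "\<bar>Im \<beta>\<bar> = \<tau> * \<bar>Im (1 / \<psi>\<^sup>2)\<bar>" using \<tau> by (simp add: abs_mult)
      also have "\<dots> \<le> 1 * \<bar>Im (1 / \<psi>\<^sup>2)\<bar>" using \<tau> by (intro mult_right_mono) auto
      finally show ?thesis by simp
    qed
    have imp: "x \<le> C * (1 + real a) ^ 8 / real N * \<bar>Im (1 / \<psi>\<^sup>2)\<bar>" if "x \<le> C * (1 + real a) ^ 8 / real N * \<bar>Im \<beta>\<bar>" for x a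
      using that by (rule order_trans) (intro mult_left_mono Im\<beta>, use C(1) in simp)
    have "\<bar>?S - ?L\<bar> \<le> D * \<bar>Im \<psi>\<bar> / real N"
      unfolding edge_sum_def \<beta>_def[symmetric]
      by (rule D(2)[OF N(1) rr(2)]) (use C(2-5) n\<beta> imp in auto)
    also have "\<dots> \<le> D * (4 * \<bar>?L\<bar>) / real N"
      using limit_sum_lower_bound[OF rr(1)] D(1) by (intro divide_right_mono mult_left_mono) auto
    finally have "\<bar>?S - ?L\<bar> / \<bar>?L\<bar> \<le> (D * (4 * \<bar>?L\<bar>) / real N) / \<bar>?L\<bar>" by (rule divide_right_mono) simp
    hence SL: "\<bar>?S / ?L - 1\<bar> \<le> 4 * D / real N"
    proof -
      assume a: "\<bar>?S - ?L\<bar> / \<bar>?L\<bar> \<le> (D * (4 * \<bar>?L\<bar>) / real N) / \<bar>?L\<bar>"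
      have "\<bar>?S / ?L - 1\<bar> = \<bar>?S - ?L\<bar> / \<bar>?L\<bar>" using L by (simp add: diff_divide_distrib flip: abs_divide)
      also note a
      also have "(D * (4 * \<bar>?L\<bar>) / real N) / \<bar>?L\<bar> = 4 * D / real N" using L by simp
      finally show ?thesis .
    qed
    have G1: "\<bar>?G - 1\<bar> \<le> (2 + G) / real N" by (rule G(2)[OF N])
    have G2: "\<bar>?G\<bar> \<le> 3 + G"
    proof -
      have "(2 + G) / real N \<le> (2 + G) / 1" using N(1) G(1) by (intro divide_left_mono) auto
      thus ?thesis using G1 by simp
    qed
    have "relative_error \<tau> N z = ?G * (?S / ?L - 1) + (?G - 1)"
      using False by (simp add: relative_error_def \<psi>_def algebra_simps)
    hence "\<bar>relative_error \<tau> N z\<bar> \<le> \<bar>?G\<bar> * \<bar>?S / ?L - 1\<bar> + \<bar>?G - 1\<bar>"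
      by (simp only: abs_mult[symmetric] abs_triangle_ineq)
    also have "\<dots> \<le> (3 + G) * (4 * D / real N) + (2 + G) / real N"
      using G(1) by (intro add_mono mult_mono G1 G2 SL) auto
    also have "\<dots> = C' / real N" by (simp add: C'_def add_divide_distrib)
    finally show ?thesis .
  qed
  have "\<forall>\<^sub>F N in sequentially. N \<ge> 1 \<and> G \<le> real N"
    using eventually_ge_at_top[of 1] eventually_ge_at_top[of "nat \<lceil>G\<rceil>"] by eventually_elim linarith
  hence "\<forall>\<^sub>F N in sequentially. \<forall>z. z \<notin> ellipseE \<tau> \<longrightarrow> r0 \<le> norm (psi \<tau> z) \<longrightarrow> \<bar>relative_error \<tau> N z\<bar> \<le> C' / real N"
    by eventually_elim (use bound in auto)
  thus ?thesis by (rule that)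
qed

text \<open>
  The exact identity is the common factor; both statements about the error follow from the
  bound on $\{|\psi|\ge r_0\}$, with $r_0=|\psi(z)|$ for a single point and $r_0=1+\delta/2$
  on a set at distance $\delta$ from the ellipse.
\<close>

theorem proposition4p4:
  fixes \<tau> :: real
    and M :: "nat \<Rightarrow> 'w measure"
    and g :: "nat \<Rightarrow> 'w \<Rightarrow> nat \<Rightarrow> nat \<Rightarrow> nat \<Rightarrow> real"
    and Z :: "nat \<Rightarrow> 'w \<Rightarrow> nat \<Rightarrow> complex"
    and R :: "nat \<Rightarrow> complex \<Rightarrow> real"
  assumes "0 \<le> \<tau>" and "\<tau> < 1"
    and "\<And>N. 1 \<le> N \<Longrightarrow> eGinSE \<tau> N (M N) (g N) (Z N)"
    and "\<And>N. 1 \<le> N \<Longrightarrow> one_point_function N (M N) (Z N) (R N)"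
  shows "\<exists>\<epsilon> :: nat \<Rightarrow> complex \<Rightarrow> real.
           (\<forall>N\<ge>1. \<forall>z. z \<notin> ellipseE \<tau> \<longrightarrow> R N z = R_leading \<tau> N z * (1 + \<epsilon> N z))
         \<and> (\<forall>z. z \<notin> ellipseE \<tau> \<longrightarrow> (\<lambda>N. \<epsilon> N z) \<in> O(\<lambda>N. 1 / real N))
         \<and> (\<forall>S. bounded_away (ellipseE \<tau>) S \<longrightarrow>
              (\<exists>C. \<forall>\<^sub>F N in sequentially. \<forall>z\<in>S. \<bar>\<epsilon> N z\<bar> \<le> C / real N))"
proof (rule exI[of _ "relative_error \<tau>"], intro conjI allI impI)
  fix N :: nat and z assume N: "1 \<le> N" and z: "z \<notin> ellipseE \<tau>"
  obtain K where K: "R N z = stirling_factor N * edge_sum \<tau> N (psi \<tau> z) * K" "R_leading \<tau> N z = limit_sum (psi \<tau> z) * K"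
    "Im z = 0 \<Longrightarrow> K = 0"
    by (rule common_prefactor[OF assms(1,2) z N assms(3)[OF N] assms(4)[OF N]], rule that) blast+
  show "R N z = R_leading \<tau> N z * (1 + relative_error \<tau> N z)"
  proof (cases "Im z = 0")
    case False
    thus ?thesis using K limit_sum_nonzero[OF assms(1,2) z False] by (simp add: relative_error_def)
  qed (use K in simp)
next
  fix z assume z: "z \<notin> ellipseE \<tau>"
  have "norm (psi \<tau> z) > 1" by (rule psi_outside_ellipse[OF assms(1,2) z])
  then obtain C where "\<forall>\<^sub>F N in sequentially. \<forall>z'. z' \<notin> ellipseE \<tau> \<longrightarrow> norm (psi \<tau> z) \<le> norm (psi \<tau> z') \<longrightarrow> \<bar>relative_error \<tau> N z'\<bar> \<le> C / real N"
    by (rule relative_error_bound[OF assms(1,2)])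
  hence "\<forall>\<^sub>F N in sequentially. norm (relative_error \<tau> N z) \<le> C * norm (1 / real N)"
    by eventually_elim (use z in simp)
  thus "(\<lambda>N. relative_error \<tau> N z) \<in> O(\<lambda>N. 1 / real N)" by (rule bigoI)
next
  fix S assume "bounded_away (ellipseE \<tau>) S"
  then obtain \<delta> where \<delta>: "\<delta> > 0" "\<And>z w. z \<in> S \<Longrightarrow> w \<in> ellipseE \<tau> \<Longrightarrow> \<delta> \<le> dist z w"
    by (auto simp: bounded_away_def)
  have out: "z \<notin> ellipseE \<tau>" if "z \<in> S" for z using \<delta>(2)[OF that, of z] \<delta>(1) by auto
  have "1 + \<delta> / 2 > 1" using \<delta> by simp
  then obtain C where C: "\<forall>\<^sub>F N in sequentially. \<forall>z. z \<notin> ellipseE \<tau> \<longrightarrow> 1 + \<delta> / 2 \<le> norm (psi \<tau> z) \<longrightarrow> \<bar>relative_error \<tau> N z\<bar> \<le> C / real N"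
    by (rule relative_error_bound[OF assms(1,2)])
  have "\<forall>\<^sub>F N in sequentially. \<forall>z\<in>S. \<bar>relative_error \<tau> N z\<bar> \<le> C / real N"
    using C by eventually_elim (use out psi_bounded_away[OF assms(1,2) out \<delta>(2)] in auto)
  thus "\<exists>C. \<forall>\<^sub>F N in sequentially. \<forall>z\<in>S. \<bar>relative_error \<tau> N z\<bar> \<le> C / real N" by blast
qed

end
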